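(* Let $H$ be a finite-dimensional Hopf algebra over a field $k$. Let $A(H)=H^*\otimes H$ be the associative algebra with unit $\varepsilon\otimes 1$ and product $$(\varphi\otimes h)(\varphi'\otimes h')=\varphi'^{(1)}(S^{-1}(h^{(3)}))\,\varphi'^{(3)}(S^2(h^{(1)}))\;\varphi\varphi'^{(2)}\otimes h^{(2)}h',$$ and let $D(H)$ be the Drinfeld double of $H$. Then the formula $$A(H)\to A(H)\otimes D(H),\qquad \varphi\otimes h\mapsto(\varphi^{(2)}\otimes h^{(1)})\otimes(\varphi^{(1)}\otimes h^{(2)})$$ makes $A(H)$ a right comodule algebra over $D(H)$.
   Context: Sumless Sweedler notation: $\Delta(h)=h^{(1)}\otimes h^{(2)}$, with iterated coproducts $h^{(1)}\otimes h^{(2)}\otimes h^{(3)}$; similarly in $H^*$. The antipode $S$ of $H$ is bijective. The dual Hopf algebra $H^*$ has the convolution product $(\varphi\varphi')(h)=\varphi(h^{(1)})\varphi'(h^{(2)})$, unit $\varepsilon$ (the counit of $H$), and coproduct determined by $\varphi^{(1)}(a)\varphi^{(2)}(b)=\varphi(ab)$. The Drinfeld double $D(H)$ is the Hopf algebra with underlying vector space $H^*\otimes H$, product $(\varphi\otimes h)(\varphi'\otimes h')=\varphi'^{(1)}(S^{-1}(h^{(3)}))\,\varphi'^{(3)}(h^{(1)})\;\varphi\varphi'^{(2)}\otimes h^{(2)}h'$, unit $\varepsilon\otimes 1$, coproduct $\varphi\otimes h\mapsto(\varphi^{(2)}\otimes h^{(1)})\otimes(\varphi^{(1)}\otimes h^{(2)})$,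 and counit $\varphi\otimes h\mapsto\varphi(1)\varepsilon(h)$. A right comodule algebra over a Hopf algebra $D$ is an algebra $A$ with a right $D$-coaction $A\to A\otimes D$ (coassociative and counital) that is a unital algebra homomorphism. *)

theory Defs
  imports Complex_Main "HOL-Library.Function_Algebras"
begin

text \<open>
  Throughout, the ground field is an arbitrary type \<open>'k :: field\<close>. A vector space is a
  subspace \<open>carrier V\<close> of an ambient type that is a vector space (in the sense of the library locale
  \<^locale>\<open>vector_space\<close>) under the scalar multiplication \<open>scl V\<close>; addition is that of the
  ambient type. Carriers are needed because duals and tensor products of a space that is given
  as a parameter cannot be types of their own. Operations are only constrained on the carriers.
\<close>

section \<open>Vector spaces and linear maps\<close>

record ('k, 'a) vspace =
  carrier :: "'a set"
  scl :: "'k \<Rightarrow> 'a \<Rightarrow> 'a"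

locale kspace =
  fixes V :: "('k::field, 'a::ab_group_add, 'z) vspace_scheme"
  assumes vector_space_scl: "vector_space (scl V)"
    and subspace_carrier: "module.subspace (scl V) (carrier V)"

definition fin_dim :: "('k::field, 'a::ab_group_add, 'z) vspace_scheme \<Rightarrow> bool" where
  "fin_dim V \<longleftrightarrow> (\<exists>B. finite B \<and> carrier V = module.span (scl V) B)"

definition linear_on ::
  "('k::field, 'a::ab_group_add, 'y) vspace_scheme \<Rightarrow> ('k, 'b::ab_group_add, 'z) vspace_scheme
    \<Rightarrow> ('a \<Rightarrow> 'b) \<Rightarrow> bool" where
  "linear_on V W f \<longleftrightarrow>
     (\<forall>x\<in>carrier V. f x \<in> carrier W) \<and>
     (\<forall>x\<in>carrier V. \<forall>y\<in>carrier V. f (x + y) = f x + f y) \<and>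
     (\<forall>c. \<forall>x\<in>carrier V. f (scl V c x) = scl W c (f x))"

definition bilinear_on ::
  "('k::field, 'a::ab_group_add, 'x) vspace_scheme \<Rightarrow> ('k, 'b::ab_group_add, 'y) vspace_scheme
    \<Rightarrow> ('k, 'c::ab_group_add, 'z) vspace_scheme \<Rightarrow> ('a \<Rightarrow> 'b \<Rightarrow> 'c) \<Rightarrow> bool" where
  "bilinear_on V W U \<beta> \<longleftrightarrow>
     (\<forall>v\<in>carrier V. linear_on W U (\<beta> v)) \<and> (\<forall>w\<in>carrier W. linear_on V U (\<lambda>v. \<beta> v w))"

definition scalars :: "('k::field, 'k) vspace" where
  "scalars = \<lparr>carrier = UNIV, scl = (*)\<rparr>"

text \<open>Pointwise scalar multiplication on \<open>'k\<close>-valued functions.\<close>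

definition fscale :: "'k::field \<Rightarrow> ('a \<Rightarrow> 'k) \<Rightarrow> 'a \<Rightarrow> 'k" where
  "fscale c f = (\<lambda>x. c * f x)"

section \<open>Tensor products\<close>

text \<open>
  The pure tensor \<open>v \<otimes> w\<close> is realised as evaluation at \<open>(v, w)\<close> on the bilinear forms on
  \<open>V \<times> W\<close>, and \<open>V \<otimes> W\<close> as the linear span of the pure tensors. The value at functions that
  are not bilinear forms is set to zero, so that equality of tensors is equality of functions.
  That this is the tensor product (for spaces of any dimension) is the universal property
  \<open>tensor_universal\<close> below.
\<close>

type_synonym ('k, 'a, 'b) tens = "('a \<Rightarrow> 'b \<Rightarrow> 'k) \<Rightarrow> 'k"

definition pure ::
  "('k::field, 'a::ab_group_add, 'y) vspace_scheme \<Rightarrow> ('k, 'b::ab_group_add, 'z) vspace_scheme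
    \<Rightarrow> 'a \<Rightarrow> 'b \<Rightarrow> ('k, 'a, 'b) tens" where
  "pure V W v w = (\<lambda>\<beta>. if bilinear_on V W scalars \<beta> then \<beta> v w else 0)"

definition tensor ::
  "('k::field, 'a::ab_group_add, 'y) vspace_scheme \<Rightarrow> ('k, 'b::ab_group_add, 'z) vspace_scheme
    \<Rightarrow> ('k, ('k, 'a, 'b) tens) vspace" where
  "tensor V W =
     \<lparr>carrier = module.span fscale {pure V W v w |v w. v \<in> carrier V \<and> w \<in> carrier W},
      scl = fscale\<rparr>"

text \<open>
  \<open>tlift V W \<beta> t\<close> is \<open>\<Sum>\<^sub>i \<beta> v\<^sub>i w\<^sub>i\<close> for any way of writing \<open>t = \<Sum>\<^sub>i v\<^sub>i \<otimes> w\<^sub>i\<close>; for bilinear \<open>\<beta>\<close> this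
  does not depend on the choice, and \<open>tlift V W \<beta>\<close> is the linear map on \<open>V \<otimes> W\<close>
  induced by \<open>\<beta>\<close>.
\<close>

definition tlift ::
  "('k::field, 'a::ab_group_add, 'y) vspace_scheme \<Rightarrow> ('k, 'b::ab_group_add, 'z) vspace_scheme
    \<Rightarrow> ('a \<Rightarrow> 'b \<Rightarrow> 'c::ab_group_add) \<Rightarrow> ('k, 'a, 'b) tens \<Rightarrow> 'c" where
  "tlift V W \<beta> t =
     (let ps = (SOME ps. set ps \<subseteq> carrier V \<times> carrier W \<and> t = (\<Sum>(v, w)\<leftarrow>ps. pure V W v w))
      in \<Sum>(v, w)\<leftarrow>ps. \<beta> v w)"

lemma vector_space_fscale: "vector_space (fscale :: 'k::field \<Rightarrow> ('a \<Rightarrow> 'k) \<Rightarrow> _)"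
  by unfold_locales (auto simp: fscale_def fun_eq_iff algebra_simps)

lemma vector_space_field: "vector_space ((*) :: 'k::field \<Rightarrow> 'k \<Rightarrow> 'k)"
  by unfold_locales (auto simp: algebra_simps)

lemma kspace_scalars: "kspace (scalars :: ('k::field, 'k) vspace)"
proof -
  interpret vector_space "(*) :: 'k \<Rightarrow> 'k \<Rightarrow> 'k" by (rule vector_space_field)
  show ?thesis by (rule kspace.intro) (simp_all add: scalars_def vector_space_axioms subspace_UNIV)
qed

lemma kspace_tensor:
  fixes V :: "('k::field, 'a::ab_group_add, 'y) vspace_scheme"
    and W :: "('k, 'b::ab_group_add, 'z) vspace_scheme"
  shows "kspace (tensor V W)"
proof -
  interpret vector_space "fscale :: 'k \<Rightarrow> (('a \<Rightarrow> 'b \<Rightarrow> 'k) \<Rightarrow> 'k) \<Rightarrow> _"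
    by (rule vector_space_fscale)
  show ?thesis by (rule kspace.intro) (simp_all add: tensor_def vector_space_axioms subspace_span)
qed

lemma bilinear_on_pure:
  fixes V :: "('k::field, 'a::ab_group_add, 'y) vspace_scheme"
    and W :: "('k, 'b::ab_group_add, 'z) vspace_scheme"
  shows "bilinear_on V W (tensor V W) (pure V W)"
proof -
  interpret vector_space "fscale :: 'k \<Rightarrow> (('a \<Rightarrow> 'b \<Rightarrow> 'k) \<Rightarrow> 'k) \<Rightarrow> _"
    by (rule vector_space_fscale)
  have closed: "pure V W v w \<in> carrier (tensor V W)" if "v \<in> carrier V" "w \<in> carrier W" for v w
    using that by (auto simp: tensor_def intro!: span_base)
  have "pure V W v (w + w') = pure V W v w + pure V W v w'"
    if "v \<in> carrier V" "w \<in> carrier W" "w' \<in> carrier W" for v w w'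
    using that by (intro ext) (simp add: pure_def bilinear_on_def linear_on_def)
  moreover have "pure V W (v + v') w = pure V W v w + pure V W v' w"
    if "v \<in> carrier V" "v' \<in> carrier V" "w \<in> carrier W" for v v' w
    using that by (intro ext) (simp add: pure_def bilinear_on_def linear_on_def)
  moreover have "pure V W (scl V c v) w = fscale c (pure V W v w)"
    if "v \<in> carrier V" "w \<in> carrier W" for c v w
    using that by (intro ext) (simp add: pure_def fscale_def bilinear_on_def linear_on_def scalars_def)
  moreover have "pure V W v (scl W c w) = fscale c (pure V W v w)"
    if "v \<in> carrier V" "w \<in> carrier W" for c v w
    using that by (intro ext) (simp add: pure_def fscale_def bilinear_on_def linear_on_def scalars_def)
  moreover have "scl (tensor V W) = fscale" by (simp add: tensor_def)
  ultimately show ?thesis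
    using closed by (simp add: bilinear_on_def linear_on_def)
qed

lemma pure_scale_left:
  "v \<in> carrier V \<Longrightarrow> w \<in> carrier W \<Longrightarrow> fscale c (pure V W v w) = pure V W (scl V c v) w"
  using bilinear_on_pure[of V W] by (simp add: bilinear_on_def linear_on_def tensor_def)

lemma pure_closed:
  "v \<in> carrier V \<Longrightarrow> w \<in> carrier W \<Longrightarrow> pure V W v w \<in> carrier (tensor V W)"
  using bilinear_on_pure[of V W] by (simp add: bilinear_on_def linear_on_def)

lemma sum_list_fun_apply: "(\<Sum>(v, w)\<leftarrow>ps. f v w) x = (\<Sum>(v, w)\<leftarrow>ps. f v w x)"
  by (induction ps) auto

lemma pure_sum_eq_imp:
  fixes V :: "('k::field, 'a::ab_group_add, 'y) vspace_scheme"
    and W :: "('k, 'b::ab_group_add, 'z) vspace_scheme"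
    and U :: "('k, 'c::ab_group_add, 'x) vspace_scheme"
  assumes U: "kspace U" and \<beta>: "bilinear_on V W U \<beta>"
    and ps: "set ps \<subseteq> carrier V \<times> carrier W"
    and qs: "set qs \<subseteq> carrier V \<times> carrier W"
    and eq: "(\<Sum>(v, w)\<leftarrow>ps. pure V W v w) = (\<Sum>(v, w)\<leftarrow>qs. pure V W v w)"
  shows "(\<Sum>(v, w)\<leftarrow>ps. \<beta> v w) = (\<Sum>(v, w)\<leftarrow>qs. \<beta> v w)"
proof (rule ccontr)
  define z where "z = (\<Sum>(v, w)\<leftarrow>ps. \<beta> v w) - (\<Sum>(v, w)\<leftarrow>qs. \<beta> v w)"
  assume "\<not> ?thesis"
  then have z: "z \<noteq> 0" by (simp add: z_def)
  interpret U: vector_space "scl U" using U by (simp add: kspace_def)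
  interpret K: vector_space "(*) :: 'k \<Rightarrow> 'k \<Rightarrow> 'k" by (rule vector_space_field)
  interpret P: vector_space_pair "scl U" "(*) :: 'k \<Rightarrow> 'k \<Rightarrow> 'k" ..
  have "U.independent {z}" using z by simp
  from P.linear_independent_extend[OF this, of "\<lambda>_. 1"]
  obtain g where g: "Vector_Spaces.linear (scl U) (*) g" and gz: "g z = 1" by auto
  interpret g: Vector_Spaces.linear "scl U" "(*)" g by fact
  define \<gamma> where "\<gamma> = (\<lambda>v w. g (\<beta> v w))"
  have bil: "bilinear_on V W scalars \<gamma>"
    using \<beta> by (auto simp: bilinear_on_def linear_on_def scalars_def \<gamma>_def g.add g.scale)
  have sum_g: "g (\<Sum>(v, w)\<leftarrow>rs. \<beta> v w) = (\<Sum>(v, w)\<leftarrow>rs. \<gamma> v w)" for rs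
    by (induction rs) (auto simp: \<gamma>_def g.add g.zero)
  have "(\<Sum>(v, w)\<leftarrow>ps. pure V W v w) \<gamma> = (\<Sum>(v, w)\<leftarrow>qs. pure V W v w) \<gamma>"
    using eq by simp
  then have "(\<Sum>(v, w)\<leftarrow>ps. \<gamma> v w) = (\<Sum>(v, w)\<leftarrow>qs. \<gamma> v w)"
    unfolding sum_list_fun_apply using bil by (simp add: pure_def)
  then have "g z = 0" by (simp add: z_def g.diff sum_g)
  with gz show False by simp
qed

lemma tensor_rep:
  fixes V :: "('k::field, 'a::ab_group_add, 'y) vspace_scheme"
    and W :: "('k, 'b::ab_group_add, 'z) vspace_scheme"
  assumes V: "kspace V" and t: "t \<in> carrier (tensor V W)"
  shows "\<exists>ps. set ps \<subseteq> carrier V \<times> carrier W \<and> t = (\<Sum>(v, w)\<leftarrow>ps. pure V W v w)"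
proof -
  interpret F: vector_space "fscale :: 'k \<Rightarrow> (('a \<Rightarrow> 'b \<Rightarrow> 'k) \<Rightarrow> 'k) \<Rightarrow> _"
    by (rule vector_space_fscale)
  interpret V: vector_space "scl V" using V by (simp add: kspace_def)
  have sub: "V.subspace (carrier V)" using V by (simp add: kspace_def)
  have "t \<in> F.span {pure V W v w |v w. v \<in> carrier V \<and> w \<in> carrier W}"
    using t by (simp add: tensor_def)
  then show ?thesis
  proof (induction rule: F.span_induct_alt)
    case base
    show ?case by (rule exI[of _ "[]"]) simp
  next
    case (step c x y)
    then obtain v w ps where vw: "v \<in> carrier V" "w \<in> carrier W" "x = pure V W v w"
      and ps: "set ps \<subseteq> carrier V \<times> carrier W" "y = (\<Sum>(v, w)\<leftarrow>ps. pure V W v w)"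
      by blast
    have "fscale c x = pure V W (scl V c v) w"
      using vw by (simp add: pure_scale_left)
    moreover have "scl V c v \<in> carrier V" using sub vw by (simp add: V.subspace_scale)
    ultimately show ?case
      using vw ps by (intro exI[of _ "(scl V c v, w) # ps"]) auto
  qed
qed

lemma tlift_eq:
  assumes U: "kspace U" and \<beta>: "bilinear_on V W U \<beta>"
    and ps: "set ps \<subseteq> carrier V \<times> carrier W"
  shows "tlift V W \<beta> (\<Sum>(v, w)\<leftarrow>ps. pure V W v w) = (\<Sum>(v, w)\<leftarrow>ps. \<beta> v w)"
proof -
  let ?P = "\<lambda>qs. set qs \<subseteq> carrier V \<times> carrier W \<and>
    (\<Sum>(v, w)\<leftarrow>ps. pure V W v w) = (\<Sum>(v, w)\<leftarrow>qs. pure V W v w)"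
  define qs where "qs = (SOME qs. ?P qs)"
  have qs: "?P qs" unfolding qs_def by (rule someI[of ?P ps]) (use ps in simp)
  have "(\<Sum>(v, w)\<leftarrow>qs. \<beta> v w) = (\<Sum>(v, w)\<leftarrow>ps. \<beta> v w)"
    by (rule pure_sum_eq_imp[OF U \<beta> ps conjunct1[OF qs] conjunct2[OF qs], symmetric])
  then show ?thesis
    unfolding tlift_def Let_def qs_def .
qed

theorem tensor_universal:
  fixes V :: "('k::field, 'a::ab_group_add, 'y) vspace_scheme"
    and W :: "('k, 'b::ab_group_add, 'z) vspace_scheme"
    and U :: "('k, 'c::ab_group_add, 'x) vspace_scheme"
  assumes V: "kspace V" and U: "kspace U" and \<beta>: "bilinear_on V W U \<beta>"
  shows "linear_on (tensor V W) U (tlift V W \<beta>)"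
    and "\<And>v w. v \<in> carrier V \<Longrightarrow> w \<in> carrier W \<Longrightarrow> tlift V W \<beta> (pure V W v w) = \<beta> v w"
    and "\<And>f t. linear_on (tensor V W) U f \<Longrightarrow>
           (\<And>v w. v \<in> carrier V \<Longrightarrow> w \<in> carrier W \<Longrightarrow> f (pure V W v w) = \<beta> v w) \<Longrightarrow>
           t \<in> carrier (tensor V W) \<Longrightarrow> f t = tlift V W \<beta> t"
proof -
  note tl = tlift_eq[OF U \<beta>]
  interpret F: vector_space "fscale :: 'k \<Rightarrow> (('a \<Rightarrow> 'b \<Rightarrow> 'k) \<Rightarrow> 'k) \<Rightarrow> _"
    by (rule vector_space_fscale)
  interpret V: vector_space "scl V" using V by (simp add: kspace_def)
  interpret U: vector_space "scl U" using U by (simp add: kspace_def)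
  have subV: "V.subspace (carrier V)" using V by (simp add: kspace_def)
  have subU: "U.subspace (carrier U)" using U by (simp add: kspace_def)
  have inU: "(\<Sum>(v, w)\<leftarrow>ps. \<beta> v w) \<in> carrier U" if "set ps \<subseteq> carrier V \<times> carrier W" for ps
    using that by (induction ps)
      (use subU \<beta> in \<open>auto simp: U.subspace_0 bilinear_on_def linear_on_def intro!: U.subspace_add\<close>)
  show pure: "tlift V W \<beta> (pure V W v w) = \<beta> v w" if "v \<in> carrier V" "w \<in> carrier W" for v w
    using tl[of "[(v, w)]"] that by simp
  show "linear_on (tensor V W) U (tlift V W \<beta>)"
    unfolding linear_on_def
  proof (intro conjI ballI allI)
    fix t assume t: "t \<in> carrier (tensor V W)"
    then obtain ps where ps: "set ps \<subseteq> carrier V \<times> carrier W" "t = (\<Sum>(v, w)\<leftarrow>ps. pure V W v w)"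
      using tensor_rep[OF V] by blast
    then show "tlift V W \<beta> t \<in> carrier U" using tl inU by simp
    fix c
    let ?qs = "map (\<lambda>(v, w). (scl V c v, w)) ps"
    have qs: "set ?qs \<subseteq> carrier V \<times> carrier W" using ps(1) subV by (auto intro: V.subspace_scale)
    have "fscale c (\<Sum>(v, w)\<leftarrow>ps. pure V W v w) = (\<Sum>(v, w)\<leftarrow>?qs. pure V W v w)"
      using ps(1)
    proof (induction ps)
      case Nil then show ?case by (simp add: fscale_def fun_eq_iff)
    next
      case (Cons p ps)
      obtain v w where p: "p = (v, w)" by force
      with Cons.prems have "fscale c (pure V W v w) = pure V W (scl V c v) w"
        by (intro pure_scale_left) auto
      with Cons p show ?case
        by (simp only: list.map sum_list.Cons prod.case F.scale_right_distrib list.set insert_subset)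
    qed
    moreover have "scl U c (\<Sum>(v, w)\<leftarrow>ps. \<beta> v w) = (\<Sum>(v, w)\<leftarrow>?qs. \<beta> v w)"
      using ps(1)
    proof (induction ps)
      case Nil then show ?case by simp
    next
      case (Cons p ps)
      obtain v w where p: "p = (v, w)" by force
      with Cons.prems have "scl U c (\<beta> v w) = \<beta> (scl V c v) w"
        using \<beta> by (simp add: bilinear_on_def linear_on_def)
      with Cons p show ?case
        by (simp only: list.map sum_list.Cons prod.case U.scale_right_distrib list.set insert_subset)
    qed
    moreover have "scl (tensor V W) = fscale" by (simp add: tensor_def)
    ultimately show "tlift V W \<beta> (scl (tensor V W) c t) = scl U c (tlift V W \<beta> t)"
      using tl[OF qs] tl[OF ps(1)] ps(2) by simp
  next
    fix s t assume "s \<in> carrier (tensor V W)" "t \<in> carrier (tensor V W)"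
    then obtain ps qs where ps: "set ps \<subseteq> carrier V \<times> carrier W" "s = (\<Sum>(v, w)\<leftarrow>ps. pure V W v w)"
      and qs: "set qs \<subseteq> carrier V \<times> carrier W" "t = (\<Sum>(v, w)\<leftarrow>qs. pure V W v w)"
      using tensor_rep[OF V] by blast
    show "tlift V W \<beta> (s + t) = tlift V W \<beta> s + tlift V W \<beta> t"
      using tl[of "ps @ qs"] tl[of ps] tl[of qs] ps qs by simp
  qed
  fix f t
  assume f: "linear_on (tensor V W) U f" and t: "t \<in> carrier (tensor V W)"
    and fp: "\<And>v w. v \<in> carrier V \<Longrightarrow> w \<in> carrier W \<Longrightarrow> f (pure V W v w) = \<beta> v w"
  from t obtain ps where ps: "set ps \<subseteq> carrier V \<times> carrier W" "t = (\<Sum>(v, w)\<leftarrow>ps. pure V W v w)"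
    using tensor_rep[OF V] by blast
  interpret T: kspace "tensor V W" by (rule kspace_tensor)
  have subT: "F.subspace (carrier (tensor V W))"
    using T.subspace_carrier by (simp add: tensor_def)
  have "f 0 = 0"
  proof -
    have "f (0 + 0) = f 0 + f 0"
      using f F.subspace_0[OF subT] unfolding linear_on_def by blast
    then show ?thesis by simp
  qed
  then have "(\<Sum>(v, w)\<leftarrow>ps. pure V W v w) \<in> carrier (tensor V W) \<and>
      f (\<Sum>(v, w)\<leftarrow>ps. pure V W v w) = (\<Sum>(v, w)\<leftarrow>ps. \<beta> v w)"
    using ps(1)
  proof (induction ps)
    case Nil then show ?case
      using F.subspace_0[OF subT] by (simp only: list.map sum_list.Nil simp_thms)
  next
    case (Cons p ps)
    obtain v w where p: "p = (v, w)" by force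
    with Cons.prems have vw: "v \<in> carrier V" "w \<in> carrier W" by auto
    let ?s = "\<Sum>(v, w)\<leftarrow>ps. pure V W v w"
    have s: "?s \<in> carrier (tensor V W)" "f ?s = (\<Sum>(v, w)\<leftarrow>ps. \<beta> v w)"
      using Cons by auto
    have "f (pure V W v w + ?s) = f (pure V W v w) + f ?s"
      using f s(1) pure_closed[OF vw] unfolding linear_on_def by blast
    then show ?case
      using F.subspace_add[OF subT pure_closed[OF vw] s(1)] s(2) fp[OF vw] p
      by (simp only: list.map sum_list.Cons prod.case simp_thms)
  qed
  then show "f t = tlift V W \<beta> t" using tl[OF ps(1)] ps(2) by simp
qed

section \<open>Algebras, coalgebras, Hopf algebras\<close>

record ('k, 'a) alg = "('k, 'a) vspace" +
  mul :: "'a \<Rightarrow> 'a \<Rightarrow> 'a"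
  unit :: 'a

record ('k, 'a) bialg = "('k, 'a) alg" +
  comul :: "'a \<Rightarrow> ('k, 'a, 'a) tens"
  counit :: "'a \<Rightarrow> 'k"

locale k_algebra = kspace A for A :: "('k::field, 'a::ab_group_add, 'z) alg_scheme" +
  assumes mul_bilinear: "bilinear_on A A A (mul A)"
    and mul_assoc: "\<lbrakk>x \<in> carrier A; y \<in> carrier A; z \<in> carrier A\<rbrakk>
          \<Longrightarrow> mul A (mul A x y) z = mul A x (mul A y z)"
    and unit_closed: "unit A \<in> carrier A"
    and unit_left: "x \<in> carrier A \<Longrightarrow> mul A (unit A) x = x"
    and unit_right: "x \<in> carrier A \<Longrightarrow> mul A x (unit A) = x"

definition algebra_hom ::
  "('k::field, 'a::ab_group_add, 'y) alg_scheme \<Rightarrow> ('k, 'b::ab_group_add, 'z) alg_scheme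
    \<Rightarrow> ('a \<Rightarrow> 'b) \<Rightarrow> bool" where
  "algebra_hom A B f \<longleftrightarrow> linear_on A B f \<and> f (unit A) = unit B \<and>
     (\<forall>x\<in>carrier A. \<forall>y\<in>carrier A. f (mul A x y) = mul B (f x) (f y))"

definition scalar_alg :: "('k::field, 'k) alg" where
  "scalar_alg = \<lparr>carrier = UNIV, scl = (*), mul = (*), unit = 1\<rparr>"

definition tensor_alg ::
  "('k::field, 'a::ab_group_add, 'y) alg_scheme \<Rightarrow> ('k, 'b::ab_group_add, 'z) alg_scheme
    \<Rightarrow> ('k, ('k, 'a, 'b) tens) alg" where
  "tensor_alg A B =
     \<lparr>carrier = carrier (tensor A B), scl = scl (tensor A B),
      mul = (\<lambda>s t. tlift A B (\<lambda>a b. tlift A B (\<lambda>a' b'. pure A B (mul A a a') (mul B b b')) t) s),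
      unit = pure A B (unit A) (unit B)\<rparr>"

text \<open>
  Sweedler notation: \<open>sw2 C (\<lambda>c\<^sub>1 c\<^sub>2. e)\<close> applied to \<open>c\<close> is \<open>e\<close> with \<open>c\<^sub>1 \<otimes> c\<^sub>2\<close> standing for
  the coproduct of \<open>c\<close>, and \<open>sw3\<close> is the same for \<open>c\<^sub>1 \<otimes> c\<^sub>2 \<otimes> c\<^sub>3 = (\<Delta> \<otimes> id) (\<Delta> c)\<close>.
\<close>

definition sw2 ::
  "('k::field, 'a::ab_group_add, 'z) bialg_scheme \<Rightarrow> ('a \<Rightarrow> 'a \<Rightarrow> 'c::ab_group_add) \<Rightarrow> 'a \<Rightarrow> 'c" where
  "sw2 C e c = tlift C C e (comul C c)"

definition sw3 ::
  "('k::field, 'a::ab_group_add, 'z) bialg_scheme \<Rightarrow> ('a \<Rightarrow> 'a \<Rightarrow> 'a \<Rightarrow> 'c::ab_group_add) \<Rightarrow> 'a \<Rightarrow> 'c" where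
  "sw3 C e c = sw2 C (\<lambda>x c3. sw2 C (\<lambda>c1 c2. e c1 c2 c3) x) c"

text \<open>Coassociativity is stated in \<open>(C \<otimes> C) \<otimes> C\<close>, reassociating \<open>(id \<otimes> \<Delta>) \<circ> \<Delta>\<close>.\<close>

locale k_coalgebra = kspace C for C :: "('k::field, 'a::ab_group_add, 'z) bialg_scheme" +
  assumes comul_linear: "linear_on C (tensor C C) (comul C)"
    and counit_linear: "linear_on C scalars (counit C)"
    and coassoc: "c \<in> carrier C \<Longrightarrow>
          sw2 C (\<lambda>x c3. sw2 C (\<lambda>c1 c2. pure (tensor C C) C (pure C C c1 c2) c3) x) c =
          sw2 C (\<lambda>c1 x. sw2 C (\<lambda>c2 c3. pure (tensor C C) C (pure C C c1 c2) c3) x) c"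
    and counit_left: "c \<in> carrier C \<Longrightarrow> sw2 C (\<lambda>c1 c2. scl C (counit C c1) c2) c = c"
    and counit_right: "c \<in> carrier C \<Longrightarrow> sw2 C (\<lambda>c1 c2. scl C (counit C c2) c1) c = c"

locale bialgebra = k_algebra H + k_coalgebra H
  for H :: "('k::field, 'a::ab_group_add, 'z) bialg_scheme" +
  assumes comul_hom: "algebra_hom H (tensor_alg H H) (comul H)"
    and counit_hom: "algebra_hom H scalar_alg (counit H)"

definition is_antipode ::
  "('k::field, 'a::ab_group_add, 'z) bialg_scheme \<Rightarrow> ('a \<Rightarrow> 'a) \<Rightarrow> bool" where
  "is_antipode H S \<longleftrightarrow> linear_on H H S \<and>
     (\<forall>h\<in>carrier H.
        sw2 H (\<lambda>h1 h2. mul H (S h1) h2) h = scl H (counit H h) (unit H) \<and>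
        sw2 H (\<lambda>h1 h2. mul H h1 (S h2)) h = scl H (counit H h) (unit H))"

locale hopf_algebra = bialgebra H for H :: "('k::field, 'a::ab_group_add, 'z) bialg_scheme" +
  assumes antipode_exists: "\<exists>S. is_antipode H S"

text \<open>An antipode is unique on the carrier, so the choice is immaterial there.\<close>

definition antipode :: "('k::field, 'a::ab_group_add, 'z) bialg_scheme \<Rightarrow> 'a \<Rightarrow> 'a" where
  "antipode H = (SOME S. is_antipode H S)"

definition inv_antipode :: "('k::field, 'a::ab_group_add, 'z) bialg_scheme \<Rightarrow> 'a \<Rightarrow> 'a" where
  "inv_antipode H = inv_into (carrier H) (antipode H)"

section \<open>The dual Hopf algebra\<close>

text \<open>Linear functionals are extended by zero outside the carrier, so that they are determined
  by their values on it.\<close>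

definition zero_ext :: "('k, 'a, 'z) vspace_scheme \<Rightarrow> ('a \<Rightarrow> 'k::field) \<Rightarrow> 'a \<Rightarrow> 'k" where
  "zero_ext V f = (\<lambda>x. if x \<in> carrier V then f x else 0)"

definition dual_space ::
  "('k::field, 'a::ab_group_add, 'z) vspace_scheme \<Rightarrow> ('k, 'a \<Rightarrow> 'k) vspace" where
  "dual_space V = \<lparr>carrier = {\<phi>. linear_on V scalars \<phi> \<and> zero_ext V \<phi> = \<phi>}, scl = fscale\<rparr>"

text \<open>The coproduct of \<open>\<phi>\<close> is the tensor with \<open>\<phi>\<^sub>1(a) \<phi>\<^sub>2(b) = \<phi>(ab)\<close>; it exists when \<open>H\<close> is
  finite-dimensional.\<close>

definition dual_hopf ::
  "('k::field, 'a::ab_group_add, 'z) bialg_scheme \<Rightarrow> ('k, 'a \<Rightarrow> 'k) bialg" where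
  "dual_hopf H =
     \<lparr>carrier = carrier (dual_space H), scl = scl (dual_space H),
      mul = (\<lambda>\<phi> \<psi>. zero_ext H (sw2 H (\<lambda>h1 h2. \<phi> h1 * \<psi> h2))),
      unit = zero_ext H (counit H),
      comul = (\<lambda>\<phi>. THE t. t \<in> carrier (tensor (dual_space H) (dual_space H)) \<and>
         (\<forall>a\<in>carrier H. \<forall>b\<in>carrier H.
            tlift (dual_space H) (dual_space H) (\<lambda>\<phi>1 \<phi>2. \<phi>1 a * \<phi>2 b) t = \<phi> (mul H a b))),
      counit = (\<lambda>\<phi>. \<phi> (unit H))\<rparr>"

section \<open>The algebra \<open>A(H)\<close> and the Drinfeld double\<close>

definition double_space ::
  "('k::field, 'a::ab_group_add, 'z) bialg_scheme \<Rightarrow> ('k, ('k, 'a \<Rightarrow> 'k, 'a) tens) vspace" where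
  "double_space H = tensor (dual_hopf H) H"

abbreviation dpure where "dpure H \<equiv> pure (dual_hopf H) H"

text \<open>
  Bilinear extension of
  \<open>(\<phi> \<otimes> h) (\<psi> \<otimes> g) = \<psi>\<^sub>1(S\<^sup>-\<^sup>1(h\<^sub>3)) \<psi>\<^sub>3(T(h\<^sub>1)) \<phi>\<psi>\<^sub>2 \<otimes> h\<^sub>2g\<close>,
  which is the product of \<open>D(H)\<close> for \<open>T = id\<close> and that of \<open>A(H)\<close> for \<open>T = S\<^sup>2\<close>.
\<close>

definition double_mul ::
  "('k::field, 'a::ab_group_add, 'z) bialg_scheme \<Rightarrow> ('a \<Rightarrow> 'a)
    \<Rightarrow> ('k, 'a \<Rightarrow> 'k, 'a) tens \<Rightarrow> ('k, 'a \<Rightarrow> 'k, 'a) tens \<Rightarrow> ('k, 'a \<Rightarrow> 'k, 'a) tens" where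
  "double_mul H T x y =
     tlift (dual_hopf H) H (\<lambda>\<phi> h.
       tlift (dual_hopf H) H (\<lambda>\<psi> g.
         sw3 (dual_hopf H) (\<lambda>\<psi>1 \<psi>2 \<psi>3.
           sw3 H (\<lambda>h1 h2 h3.
             fscale (\<psi>1 (inv_antipode H h3) * \<psi>3 (T h1))
               (dpure H (mul (dual_hopf H) \<phi> \<psi>2) (mul H h2 g))) h) \<psi>) y) x"

text \<open>Linear extension of \<open>\<phi> \<otimes> h \<mapsto> (\<phi>\<^sub>2 \<otimes> h\<^sub>1) \<otimes> (\<phi>\<^sub>1 \<otimes> h\<^sub>2)\<close>.\<close>

definition double_comul ::
  "('k::field, 'a::ab_group_add, 'z) bialg_scheme \<Rightarrow> ('k, 'a \<Rightarrow> 'k, 'a) tens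
    \<Rightarrow> ('k, ('k, 'a \<Rightarrow> 'k, 'a) tens, ('k, 'a \<Rightarrow> 'k, 'a) tens) tens" where
  "double_comul H =
     tlift (dual_hopf H) H (\<lambda>\<phi> h.
       sw2 (dual_hopf H) (\<lambda>\<phi>1 \<phi>2.
         sw2 H (\<lambda>h1 h2.
           pure (double_space H) (double_space H) (dpure H \<phi>2 h1) (dpure H \<phi>1 h2)) h) \<phi>)"

definition A_alg ::
  "('k::field, 'a::ab_group_add, 'z) bialg_scheme \<Rightarrow> ('k, ('k, 'a \<Rightarrow> 'k, 'a) tens) alg" where
  "A_alg H =
     \<lparr>carrier = carrier (double_space H), scl = scl (double_space H),
      mul = double_mul H (\<lambda>h. antipode H (antipode H h)),
      unit = dpure H (unit (dual_hopf H)) (unit H)\<rparr>"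

definition drinfeld_double ::
  "('k::field, 'a::ab_group_add, 'z) bialg_scheme \<Rightarrow> ('k, ('k, 'a \<Rightarrow> 'k, 'a) tens) bialg" where
  "drinfeld_double H =
     \<lparr>carrier = carrier (double_space H), scl = scl (double_space H),
      mul = double_mul H (\<lambda>h. h),
      unit = dpure H (unit (dual_hopf H)) (unit H),
      comul = double_comul H,
      counit = tlift (dual_hopf H) H (\<lambda>\<phi> h. \<phi> (unit H) * counit H h)\<rparr>"

text \<open>The same formula as \<open>double_comul\<close>, now read as a map \<open>A(H) \<rightarrow> A(H) \<otimes> D(H)\<close>.\<close>

definition A_coaction ::
  "('k::field, 'a::ab_group_add, 'z) bialg_scheme \<Rightarrow> ('k, 'a \<Rightarrow> 'k, 'a) tens
    \<Rightarrow> ('k, ('k, 'a \<Rightarrow> 'k, 'a) tens, ('k, 'a \<Rightarrow> 'k, 'a) tens) tens" where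
  "A_coaction H =
     tlift (dual_hopf H) H (\<lambda>\<phi> h.
       sw2 (dual_hopf H) (\<lambda>\<phi>1 \<phi>2.
         sw2 H (\<lambda>h1 h2.
           pure (A_alg H) (drinfeld_double H) (dpure H \<phi>2 h1) (dpure H \<phi>1 h2)) h) \<phi>)"

section \<open>Comodule algebras\<close>

text \<open>Coassociativity of the coaction is stated in \<open>(A \<otimes> D) \<otimes> D\<close>.\<close>

locale right_comodule_algebra = D: hopf_algebra D + A: k_algebra A
  for D :: "('k::field, 'd::ab_group_add, 'y) bialg_scheme"
    and A :: "('k, 'a::ab_group_add, 'z) alg_scheme" +
  fixes \<rho> :: "'a \<Rightarrow> ('k, 'a, 'd) tens"
  assumes coaction_hom: "algebra_hom A (tensor_alg A D) \<rho>"
    and coaction_coassoc: "a \<in> carrier A \<Longrightarrow>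
          tlift A D (\<lambda>x d. tlift A D (\<lambda>a0 a1. pure (tensor A D) D (pure A D a0 a1) d) (\<rho> x)) (\<rho> a) =
          tlift A D (\<lambda>a0 x. sw2 D (\<lambda>d1 d2. pure (tensor A D) D (pure A D a0 d1) d2) x) (\<rho> a)"
    and coaction_counit: "a \<in> carrier A \<Longrightarrow>
          tlift A D (\<lambda>a0 a1. scl A (counit D a1) a0) (\<rho> a) = a"

end

(*
  Write t in H* (x) H through its values <t, x (x) alpha> for x in H and alpha in H*.  The coaction
  becomes dual to a product: the value of rho(t) at (x, alpha), (y, beta) is the value of t at
  (yx, alpha*beta), so coassociativity and counitality are associativity and unitality in
  H^op (x) H*.  The product of t and s takes the value of t at x_1 and the functional
  h |-> <s, S^-1(h_3) x_2 T(h_1) (x) alpha(h_2 . )>, where T = id gives D(H) and T = S^2 gives A(H).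
  Associativity and multiplicativity of rho hold for every Hopf algebra endomorphism T; in the
  latter the factors S^-1(h_3) of A(H) and h_4 of D(H) cancel.  The antipode of D(H) is
  phi (x) h |-> (epsilon (x) S(h)) (phi o S^-1 (x) 1).  That S is bijective when H is
  finite-dimensional follows from the existence of a nonzero integral on H, obtained by projecting
  the Hopf module H* onto its coinvariants.
*)

theory Submission
  imports Defs
begin

section \<open>Tensors as finite sums of pure tensors\<close>

text \<open>The inverse antipode is only an \<open>inv_into\<close> on the carrier, so nothing can
  be computed in A(H) or D(H) before S is known to be bijective. A nonzero integral \<psi> forces
  this: if S(h) = 0, then h acts as zero on the Hopf module H*, while by left invariance of \<psi>
  the element h can be recovered from the functionals x \<mapsto> \<psi>(x S(h_1)) paired with h_2;
  so h = 0, and finite dimension turns injectivity into bijectivity. An arbitrary Hopf endomorphism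
  T can be allowed because T enters only through z \<mapsto> S^-1(h_3) z T(h_1). This is compatible
  with products in h, as S^-1 reverses them and T keeps them, and with the coproduct of z for the
  same reason. The practical obstacle is that \<open>tlift\<close> evaluates at a chosen
  representation and that every axiom holds on carriers only. Identities of tensors are therefore
  tested on separating families of functionals. What remains are scalar identities between finite
  sums over a basis, in which Sweedler sums can be exchanged and reassociated by rewriting under
  binders.\<close>

definition tensor_terms ::
  "('k::field, 'a::ab_group_add, 'y) vspace_scheme \<Rightarrow> ('k, 'b::ab_group_add, 'z) vspace_scheme
    \<Rightarrow> ('k, 'a, 'b) tens \<Rightarrow> ('a \<times> 'b) list" where
  "tensor_terms V W t =
     (SOME ps. set ps \<subseteq> carrier V \<times> carrier W \<and> t = (\<Sum>(v, w)\<leftarrow>ps. pure V W v w))"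

text \<open>The representation of t chosen inside \<open>tlift\<close> does not depend on \<beta>.
  For fixed t, \<open>tlift\<close> is thus one finite sum, and additivity in \<beta>, congruence
  and exchange of sums hold for arbitrary \<beta>, bilinear or not.\<close>

lemma tlift_terms: "tlift V W \<beta> t = (\<Sum>(v, w)\<leftarrow>tensor_terms V W t. \<beta> v w)"
  by (simp add: tlift_def tensor_terms_def)

lemma tensor_terms:
  assumes "kspace V" and "t \<in> carrier (tensor V W)"
  shows tensor_terms_subset: "set (tensor_terms V W t) \<subseteq> carrier V \<times> carrier W"
    and tensor_terms_sum: "(\<Sum>(v, w)\<leftarrow>tensor_terms V W t. pure V W v w) = t"
  using someI_ex[OF tensor_rep[OF assms]] unfolding tensor_terms_def by simp_all

lemma tlift_cong:
  assumes "kspace V" and "t \<in> carrier (tensor V W)"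
    and "\<And>v w. v \<in> carrier V \<Longrightarrow> w \<in> carrier W \<Longrightarrow> \<beta> v w = \<gamma> v w"
  shows "tlift V W \<beta> t = tlift V W \<gamma> t"
  unfolding tlift_terms using tensor_terms_subset[OF assms(1,2)] assms(3)
  by (intro arg_cong[where f = sum_list] map_cong) auto

lemma sum_list_pairs_add:
  "(\<Sum>(v, w)\<leftarrow>ps. f v w + g v w) = (\<Sum>(v, w)\<leftarrow>ps. f v w) + (\<Sum>(v, w)\<leftarrow>ps. g v w :: 'c::ab_group_add)"
  by (induction ps) (auto simp: algebra_simps)

lemma tlift_add:
  "tlift V W (\<lambda>v w. \<beta> v w + \<gamma> v w) t = tlift V W \<beta> t + tlift V W \<gamma> t"
  by (simp only: tlift_terms sum_list_pairs_add)

lemma tlift_zero: "tlift V W (\<lambda>v w. 0) t = 0"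
  unfolding tlift_terms by (induction "tensor_terms V W t") auto

lemma tlift_sum: "tlift V W (\<lambda>v w. \<Sum>i\<in>I. \<beta> i v w) t = (\<Sum>i\<in>I. tlift V W (\<beta> i) t)"
  by (induction I rule: infinite_finite_induct) (simp_all add: tlift_add tlift_zero)

lemma tlift_mult_left:
  "tlift V W (\<lambda>v w. c * \<beta> v w) t = c * (tlift V W \<beta> t :: 'c::ring)"
proof -
  have "(\<Sum>(v, w)\<leftarrow>ps. c * \<beta> v w) = c * (\<Sum>(v, w)\<leftarrow>ps. \<beta> v w)" for ps
    by (induction ps) (auto simp: algebra_simps)
  then show ?thesis by (simp only: tlift_terms)
qed

lemma tlift_mult_right:
  "tlift V W (\<lambda>v w. \<beta> v w * c) t = (tlift V W \<beta> t :: 'c::ring) * c"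
proof -
  have "(\<Sum>(v, w)\<leftarrow>ps. \<beta> v w * c) = (\<Sum>(v, w)\<leftarrow>ps. \<beta> v w) * c" for ps
    by (induction ps) (auto simp: algebra_simps)
  then show ?thesis by (simp only: tlift_terms)
qed

lemma tlift_swap:
  "tlift V W (\<lambda>v w. tlift V' W' (\<lambda>v' w'. \<beta> v w v' w') s) t =
   tlift V' W' (\<lambda>v' w'. tlift V W (\<lambda>v w. \<beta> v w v' w') t) s"
proof -
  have "(\<Sum>(v, w)\<leftarrow>ps. \<Sum>(v', w')\<leftarrow>qs. \<beta> v w v' w') = (\<Sum>(v', w')\<leftarrow>qs. \<Sum>(v, w)\<leftarrow>ps. \<beta> v w v' w')"
    for ps qs
  proof (induction ps)
    case Nil
    show ?case by (induction qs) auto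
  next
    case (Cons p ps)
    then show ?case by (cases p) (simp add: sum_list_pairs_add)
  qed
  then show ?thesis by (simp only: tlift_terms)
qed

section \<open>Linear maps on carriers\<close>

context kspace
begin

sublocale vs: vector_space "scl V" by (rule vector_space_scl)

lemma zero_closed: "0 \<in> carrier V"
  using subspace_carrier by (rule vs.subspace_0)

lemma add_closed: "x \<in> carrier V \<Longrightarrow> y \<in> carrier V \<Longrightarrow> x + y \<in> carrier V"
  using subspace_carrier by (rule vs.subspace_add)

lemma diff_closed: "x \<in> carrier V \<Longrightarrow> y \<in> carrier V \<Longrightarrow> x - y \<in> carrier V"
  using subspace_carrier by (rule vs.subspace_diff)

lemma scl_closed: "x \<in> carrier V \<Longrightarrow> scl V c x \<in> carrier V"
  using subspace_carrier by (rule vs.subspace_scale)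

lemma sum_closed: "(\<And>i. i \<in> I \<Longrightarrow> f i \<in> carrier V) \<Longrightarrow> (\<Sum>i\<in>I. f i) \<in> carrier V"
  using subspace_carrier by (rule vs.subspace_sum)

end

lemma linear_on_closed: "linear_on V W f \<Longrightarrow> x \<in> carrier V \<Longrightarrow> f x \<in> carrier W"
  and linear_on_add: "linear_on V W f \<Longrightarrow> x \<in> carrier V \<Longrightarrow> y \<in> carrier V \<Longrightarrow> f (x + y) = f x + f y"
  and linear_on_scl: "linear_on V W f \<Longrightarrow> x \<in> carrier V \<Longrightarrow> f (scl V c x) = scl W c (f x)"
  by (auto simp: linear_on_def)

lemma linear_on_zero:
  assumes "kspace V" "linear_on V W f" shows "f 0 = 0"
  using linear_on_add[OF assms(2), of 0 0] kspace.zero_closed[OF assms(1)] by simp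

lemma linear_on_diff:
  assumes "kspace V" "linear_on V W f" "x \<in> carrier V" "y \<in> carrier V"
  shows "f (x - y) = f x - f y"
  using linear_on_add[OF assms(2), of "x - y" y] kspace.diff_closed[OF assms(1)] assms(3,4) by simp

lemma linear_on_sum:
  assumes "kspace V" "linear_on V W f" "\<And>i. i \<in> I \<Longrightarrow> x i \<in> carrier V"
  shows "f (\<Sum>i\<in>I. x i) = (\<Sum>i\<in>I. f (x i))"
  using assms(3)
proof (induction I rule: infinite_finite_induct)
  case (insert i I)
  have "(\<Sum>i\<in>I. x i) \<in> carrier V" using insert by (intro kspace.sum_closed[OF assms(1)]) auto
  then show ?case using insert linear_on_add[OF assms(2), of "x i"] by simp
qed (simp_all add: linear_on_zero[OF assms(1,2)])

lemma bilinear_on_left: "bilinear_on V W U \<beta> \<Longrightarrow> w \<in> carrier W \<Longrightarrow> linear_on V U (\<lambda>v. \<beta> v w)"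
  and bilinear_on_right: "bilinear_on V W U \<beta> \<Longrightarrow> v \<in> carrier V \<Longrightarrow> linear_on W U (\<beta> v)"
  by (auto simp: bilinear_on_def)

lemma bilinear_on_closed:
  "bilinear_on V W U \<beta> \<Longrightarrow> v \<in> carrier V \<Longrightarrow> w \<in> carrier W \<Longrightarrow> \<beta> v w \<in> carrier U"
  by (auto simp: bilinear_on_def linear_on_def)

lemma linear_on_comp: "linear_on V W f \<Longrightarrow> linear_on W U g \<Longrightarrow> linear_on V U (\<lambda>x. g (f x))"
  by (auto simp: linear_on_def)

lemma bilinear_on_comp:
  "bilinear_on V W U \<beta> \<Longrightarrow> linear_on U U' f \<Longrightarrow> bilinear_on V W U' (\<lambda>v w. f (\<beta> v w))"
  by (auto simp: bilinear_on_def intro: linear_on_comp)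

lemma bilinear_on_mult:
  assumes "linear_on V scalars f" "linear_on W scalars g"
  shows "bilinear_on V W (scalars :: ('k::field, 'k) vspace) (\<lambda>v w. f v * g w)"
  using assms by (auto simp: bilinear_on_def linear_on_def scalars_def algebra_simps)

lemma linear_on_tlift:
  assumes "kspace V" "kspace U" "bilinear_on V W U \<beta>"
  shows "linear_on (tensor V W) U (tlift V W \<beta>)"
  by (rule tensor_universal(1)[OF assms])

lemma tlift_pure:
  assumes "kspace V" "kspace U" "bilinear_on V W U \<beta>" "v \<in> carrier V" "w \<in> carrier W"
  shows "tlift V W \<beta> (pure V W v w) = \<beta> v w"
  by (rule tensor_universal(2)[OF assms])

lemma sum_list_pairs_closed:
  assumes "kspace U" "\<And>v w. (v, w) \<in> set ps \<Longrightarrow> \<beta> v w \<in> carrier U"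
  shows "(\<Sum>(v, w)\<leftarrow>ps. \<beta> v w) \<in> carrier U"
  using assms(2)
  by (induction ps) (auto intro!: kspace.add_closed[OF assms(1)] kspace.zero_closed[OF assms(1)])

lemma tlift_closed:
  assumes "kspace V" "kspace U" "t \<in> carrier (tensor V W)"
    and "\<And>v w. v \<in> carrier V \<Longrightarrow> w \<in> carrier W \<Longrightarrow> \<beta> v w \<in> carrier U"
  shows "tlift V W \<beta> t \<in> carrier U"
  unfolding tlift_terms
  using tensor_terms_subset[OF assms(1,3)] assms(4)
  by (intro sum_list_pairs_closed[OF assms(2)]) auto

lemma linear_on_tlift_apply:
  assumes V: "kspace V" and U: "kspace U" and t: "t \<in> carrier (tensor V W)"
    and \<beta>: "\<And>v w. v \<in> carrier V \<Longrightarrow> w \<in> carrier W \<Longrightarrow> \<beta> v w \<in> carrier U"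
    and f: "linear_on U U' f"
  shows "f (tlift V W \<beta> t) = tlift V W (\<lambda>v w. f (\<beta> v w)) t"
proof -
  have "f (\<Sum>(v, w)\<leftarrow>ps. \<beta> v w) = (\<Sum>(v, w)\<leftarrow>ps. f (\<beta> v w))"
    if "set ps \<subseteq> carrier V \<times> carrier W" for ps
    using that
  proof (induction ps)
    case Nil
    show ?case by (simp add: linear_on_zero[OF U f])
  next
    case (Cons p ps)
    have "(\<Sum>(v, w)\<leftarrow>ps. \<beta> v w) \<in> carrier U"
      using Cons.prems \<beta> by (intro sum_list_pairs_closed[OF U]) auto
    with Cons \<beta> linear_on_add[OF f] show ?case by auto
  qed
  then show ?thesis using tensor_terms_subset[OF V t] by (simp only: tlift_terms)
qed

lemma linear_on_eq_on_pure:
  assumes V: "kspace V" and U: "kspace U"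
    and f: "linear_on (tensor V W) U f" and g: "linear_on (tensor V W) U g"
    and "\<And>v w. v \<in> carrier V \<Longrightarrow> w \<in> carrier W \<Longrightarrow> f (pure V W v w) = g (pure V W v w)"
    and "t \<in> carrier (tensor V W)"
  shows "f t = g t"
proof -
  have b: "bilinear_on V W U (\<lambda>v w. f (pure V W v w))"
    by (rule bilinear_on_comp[OF bilinear_on_pure f])
  show ?thesis
    using tensor_universal(3)[OF V U b f _ assms(6)] tensor_universal(3)[OF V U b g _ assms(6)]
      assms(5) by simp
qed

text \<open>By slicing. Pairing the first factor of the difference r with f in P leaves an element
  of W that all of Q kills; pairing the second factor with any linear g then leaves an element of V
  that all of P kills. As r is a finite sum, its second components have coordinates in a finite
  independent set, and these express the value of r at every bilinear form through such slices.
  Asking only for separation makes point evaluations usable and allows iteration to threefold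
  tensors.\<close>

lemma tensor_eqI_separating:
  fixes V :: "('k::field, 'a::ab_group_add, 'y) vspace_scheme"
    and W :: "('k, 'b::ab_group_add, 'z) vspace_scheme"
  assumes V: "kspace V" and W: "kspace W"
    and s: "s \<in> carrier (tensor V W)" and t: "t \<in> carrier (tensor V W)"
    and P: "\<And>f. f \<in> P \<Longrightarrow> linear_on V scalars f" and Q: "\<And>g. g \<in> Q \<Longrightarrow> linear_on W scalars g"
    and sepP: "\<And>v. v \<in> carrier V \<Longrightarrow> (\<And>f. f \<in> P \<Longrightarrow> f v = 0) \<Longrightarrow> v = 0"
    and sepQ: "\<And>w. w \<in> carrier W \<Longrightarrow> (\<And>g. g \<in> Q \<Longrightarrow> g w = 0) \<Longrightarrow> w = 0"
    and eq: "\<And>f g. f \<in> P \<Longrightarrow> g \<in> Q \<Longrightarrow>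
      tlift V W (\<lambda>v w. f v * g w) s = tlift V W (\<lambda>v w. f v * g w) t"
  shows "s = t"
proof -
  interpret V: kspace V by fact
  interpret W: kspace W by fact
  interpret T: kspace "tensor V W" by (rule kspace_tensor)
  define r where "r = s - t"
  have r: "r \<in> carrier (tensor V W)" unfolding r_def using s t by (rule T.diff_closed)
  have eq0: "tlift V W (\<lambda>v w. f v * g w) r = 0" if "f \<in> P" "g \<in> Q" for f g
    using linear_on_diff[OF kspace_tensor
        linear_on_tlift[OF V kspace_scalars bilinear_on_mult[OF P[OF that(1)] Q[OF that(2)]]] s t]
      eq[OF that] by (simp add: r_def)
  have left: "tlift V W (\<lambda>v w. scl W (f v) w) r = 0" if f: "f \<in> P" for f
  proof (rule sepQ)
    show "tlift V W (\<lambda>v w. scl W (f v) w) r \<in> carrier W"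
      by (rule tlift_closed[OF V W r]) (rule W.scl_closed)
    fix g assume g: "g \<in> Q"
    have "g (tlift V W (\<lambda>v w. scl W (f v) w) r) = tlift V W (\<lambda>v w. g (scl W (f v) w)) r"
      by (rule linear_on_tlift_apply[OF V W r _ Q[OF g]]) (rule W.scl_closed)
    also have "\<dots> = tlift V W (\<lambda>v w. f v * g w) r"
      using Q[OF g] by (intro tlift_cong[OF V r]) (simp add: linear_on_def scalars_def)
    finally show "g (tlift V W (\<lambda>v w. scl W (f v) w) r) = 0" using eq0[OF f g] by simp
  qed
  \<comment> \<open>Here g is an arbitrary linear functional, because coordinate functionals, which
    need not lie in Q, are plugged in later. The double pairing with f and g is g applied to the
    slice by f, which is already 0.\<close>
  have right: "tlift V W (\<lambda>v w. scl V (g w) v) r = 0" if g: "linear_on W scalars g" for g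
  proof (rule sepP)
    show "tlift V W (\<lambda>v w. scl V (g w) v) r \<in> carrier V"
      by (rule tlift_closed[OF V V r]) (rule V.scl_closed)
    fix f assume f: "f \<in> P"
    have "f (tlift V W (\<lambda>v w. scl V (g w) v) r) = tlift V W (\<lambda>v w. f (scl V (g w) v)) r"
      by (rule linear_on_tlift_apply[OF V V r _ P[OF f]]) (rule V.scl_closed)
    also have "\<dots> = tlift V W (\<lambda>v w. g (scl W (f v) w)) r"
      using P[OF f] g by (intro tlift_cong[OF V r]) (simp add: linear_on_def scalars_def)
    also have "\<dots> = g (tlift V W (\<lambda>v w. scl W (f v) w) r)"
      by (rule linear_on_tlift_apply[OF V W r _ g, symmetric]) (rule W.scl_closed)
    also have "\<dots> = 0" using left[OF f] linear_on_zero[OF W g] by simp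
    finally show "f (tlift V W (\<lambda>v w. scl V (g w) v) r) = 0" .
  qed
  define ws where "ws = snd ` set (tensor_terms V W r)"
  note sub = tensor_terms_subset[OF V r]
  obtain B where B: "B \<subseteq> ws" "W.vs.independent B" "ws \<subseteq> W.vs.span B"
    using W.vs.maximal_independent_subset[of ws] by blast
  have finB: "finite B" using B(1) by (auto simp: ws_def intro: finite_subset)
  have BW: "B \<subseteq> carrier W" using B(1) sub by (fastforce simp: ws_def)
  \<comment> \<open>\<open>representation B\<close> is zero off the span of B and hence not linear
    on W; coordinates with respect to a basis of the whole ambient type are.\<close>
  define B' where "B' = W.vs.extend_basis B"
  have B': "W.vs.independent B'" "W.vs.span B' = UNIV" "B \<subseteq> B'"
    using W.vs.independent_extend_basis W.vs.span_extend_basis W.vs.extend_basis_superset B(2)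
    unfolding B'_def by blast+
  define c where "c b w = W.vs.representation B' w b" for b w
  have c: "linear_on W scalars (c b)" for b
    using B' by (auto simp: linear_on_def scalars_def c_def W.vs.representation_add
        W.vs.representation_scale)
  have exp: "w = (\<Sum>b\<in>B. scl W (c b w) b)" if w: "w \<in> ws" for w
  proof -
    have "w \<in> W.vs.span B" using w B(3) by blast
    then have "W.vs.representation B' w = W.vs.representation B w"
      by (rule W.vs.representation_extend[OF B'(1) _ B'(3)])
    then show ?thesis
      using W.vs.sum_representation_eq[OF B(2) \<open>w \<in> W.vs.span B\<close> finB order_refl]
      by (simp add: c_def)
  qed
  have "r \<beta> = 0" for \<beta>
  proof (cases "bilinear_on V W scalars \<beta>")
    case False
    have "(\<Sum>(v, w)\<leftarrow>ps. pure V W v w) \<beta> = 0" for ps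
      using False by (induction ps) (auto simp: pure_def)
    from this[of "tensor_terms V W r"] show ?thesis by (simp only: tensor_terms_sum[OF V r])
  next
    case bil: True
    have "r \<beta> = tlift V W \<beta> r"
    proof -
      have "(\<Sum>(v, w)\<leftarrow>ps. pure V W v w) \<beta> = (\<Sum>(v, w)\<leftarrow>ps. \<beta> v w)" for ps
        using bil by (induction ps) (auto simp: pure_def)
      from this[of "tensor_terms V W r"] show ?thesis
        by (simp only: tensor_terms_sum[OF V r] tlift_terms)
    qed
    also have "\<dots> = tlift V W (\<lambda>v w. \<Sum>b\<in>B. \<beta> (scl V (c b w) v) b) r"
      unfolding tlift_terms
    proof (intro arg_cong[where f = sum_list] map_cong refl, clarify)
      fix v w assume vw: "(v, w) \<in> set (tensor_terms V W r)"
      then have v: "v \<in> carrier V" and w: "w \<in> ws" using sub by (auto simp: ws_def intro: rev_image_eqI)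
      have "\<beta> v w = \<beta> v (\<Sum>b\<in>B. scl W (c b w) b)" using exp[OF w] by simp
      also have "\<dots> = (\<Sum>b\<in>B. \<beta> v (scl W (c b w) b))"
        using BW by (intro linear_on_sum[OF W bilinear_on_right[OF bil v]]) (auto intro: W.scl_closed)
      also have "\<dots> = (\<Sum>b\<in>B. \<beta> (scl V (c b w) v) b)"
        using BW v bil by (intro sum.cong refl) (auto simp: bilinear_on_def linear_on_def)
      finally show "\<beta> v w = (\<Sum>b\<in>B. \<beta> (scl V (c b w) v) b)" .
    qed
    also have "\<dots> = (\<Sum>b\<in>B. tlift V W (\<lambda>v w. \<beta> (scl V (c b w) v) b) r)" by (rule tlift_sum)
    also have "\<dots> = (\<Sum>b\<in>B. \<beta> (tlift V W (\<lambda>v w. scl V (c b w) v) r) b)"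
      using BW by (intro sum.cong refl
          linear_on_tlift_apply[OF V V r _ bilinear_on_left[OF bil], symmetric])
        (auto intro: V.scl_closed)
    also have "\<dots> = 0"
      using BW by (intro sum.neutral ballI)
        (auto simp: right[OF c] intro!: linear_on_zero[OF V bilinear_on_left[OF bil]])
    finally show ?thesis .
  qed
  then have "r = 0" by (intro ext) simp
  then show ?thesis by (simp add: r_def)
qed

section \<open>Expansion of linear maps and tensors in coordinates\<close>

definition coord_system ::
  "('k::field, 'a::ab_group_add, 'z) vspace_scheme \<Rightarrow> 'i set \<Rightarrow> ('i \<Rightarrow> 'a) \<Rightarrow> ('i \<Rightarrow> 'a \<Rightarrow> 'k) \<Rightarrow> bool" where
  "coord_system V I v c \<longleftrightarrow> finite I \<and> (\<forall>i\<in>I. v i \<in> carrier V \<and> linear_on V scalars (c i)) \<and>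
     (\<forall>x\<in>carrier V. x = (\<Sum>i\<in>I. scl V (c i x) (v i)))"

lemma linear_on_expand:
  assumes V: "kspace V" and co: "coord_system V I v c" and f: "linear_on V U f" and x: "x \<in> carrier V"
  shows "f x = (\<Sum>i\<in>I. scl U (c i x) (f (v i)))"
proof -
  have "f x = f (\<Sum>i\<in>I. scl V (c i x) (v i))" using co x by (simp add: coord_system_def)
  also have "\<dots> = (\<Sum>i\<in>I. f (scl V (c i x) (v i)))"
    using co by (intro linear_on_sum[OF V f] kspace.scl_closed[OF V]) (auto simp: coord_system_def)
  also have "\<dots> = (\<Sum>i\<in>I. scl U (c i x) (f (v i)))"
    using co by (intro sum.cong refl linear_on_scl[OF f]) (auto simp: coord_system_def)
  finally show ?thesis .
qed

lemma linear_on_scl_vector: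
  assumes "kspace U" "z \<in> carrier U"
  shows "linear_on scalars U (\<lambda>r. scl U r z)"
proof -
  interpret kspace U by fact
  show ?thesis
    using assms(2) by (auto simp: linear_on_def scalars_def scl_closed vs.scale_left_distrib)
qed

text \<open>The coefficients of t are its pairings with c i and d j. Applied to a coproduct, they
  become the structure constants \<open>cop\<close>.\<close>

lemma tlift_expand:
  assumes V: "kspace V" and W: "kspace W" and U: "kspace U"
    and cV: "coord_system V I v c" and cW: "coord_system W J w d"
    and \<beta>: "bilinear_on V W U \<beta>" and t: "t \<in> carrier (tensor V W)"
  shows "tlift V W \<beta> t =
    (\<Sum>i\<in>I. \<Sum>j\<in>J. scl U (tlift V W (\<lambda>x y. c i x * d j y) t) (\<beta> (v i) (w j)))"
proof -
  interpret U: kspace U by fact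
  have v: "v i \<in> carrier V" if "i \<in> I" for i using cV that by (simp add: coord_system_def)
  have w: "w j \<in> carrier W" if "j \<in> J" for j using cW that by (simp add: coord_system_def)
  have "tlift V W \<beta> t = tlift V W (\<lambda>x y. \<Sum>i\<in>I. \<Sum>j\<in>J. scl U (c i x * d j y) (\<beta> (v i) (w j))) t"
  proof (rule tlift_cong[OF V t])
    fix x y assume x: "x \<in> carrier V" and y: "y \<in> carrier W"
    have "\<beta> x y = (\<Sum>i\<in>I. scl U (c i x) (\<beta> (v i) y))"
      by (rule linear_on_expand[OF V cV bilinear_on_left[OF \<beta> y] x])
    also have "\<dots> = (\<Sum>i\<in>I. scl U (c i x) (\<Sum>j\<in>J. scl U (d j y) (\<beta> (v i) (w j))))"
      using linear_on_expand[OF W cW bilinear_on_right[OF \<beta> v] y]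
      by (intro sum.cong refl) simp
    also have "\<dots> = (\<Sum>i\<in>I. \<Sum>j\<in>J. scl U (c i x * d j y) (\<beta> (v i) (w j)))"
      by (simp add: U.vs.scale_sum_right)
    finally show "\<beta> x y = \<dots>" .
  qed
  also have "\<dots> = (\<Sum>i\<in>I. \<Sum>j\<in>J. tlift V W (\<lambda>x y. scl U (c i x * d j y) (\<beta> (v i) (w j))) t)"
    by (simp only: tlift_sum)
  also have "\<dots> = (\<Sum>i\<in>I. \<Sum>j\<in>J. scl U (tlift V W (\<lambda>x y. c i x * d j y) t) (\<beta> (v i) (w j)))"
    using v w by (intro sum.cong refl linear_on_tlift_apply[OF V kspace_scalars t _
          linear_on_scl_vector[OF U], symmetric] bilinear_on_closed[OF \<beta>])
      (auto simp: scalars_def)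
  finally show ?thesis .
qed

section \<open>Sweedler calculus with scalar values\<close>

locale fd_hopf_algebra = hopf_algebra H
  for H :: "('k::field, 'a::ab_group_add, 'z) bialg_scheme" +
  assumes fin_dim: "fin_dim H"
begin

lemma kspace_H: "kspace H" by (rule kspace_axioms)

definition bas :: "'a set" where
  "bas = (SOME B. finite B \<and> vs.independent B \<and> vs.span B = carrier H)"

lemma bas: "finite bas" "vs.independent bas" "vs.span bas = carrier H"
proof -
  obtain F where F: "finite F" "carrier H = vs.span F" using fin_dim by (auto simp: fin_dim_def)
  obtain B where B: "B \<subseteq> F" "vs.independent B" "F \<subseteq> vs.span B"
    using vs.maximal_independent_subset[of F] by blast
  have "vs.span B = vs.span F"
    using B by (metis vs.span_mono vs.span_span subset_antisym)
  then have "\<exists>B. finite B \<and> vs.independent B \<and> vs.span B = carrier H"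
    using B F by (metis finite_subset)
  from someI_ex[OF this] show "finite bas" "vs.independent bas" "vs.span bas = carrier H"
    unfolding bas_def by blast+
qed

lemma bas_closed: "b \<in> bas \<Longrightarrow> b \<in> carrier H"
  using bas(3) vs.span_base by blast

text \<open>Coordinate functionals are defined on the whole ambient type, hence all identities below
  need no hypotheses that arguments lie in the carrier.\<close>

definition crd :: "'a \<Rightarrow> 'a \<Rightarrow> 'k" where
  "crd b x = (if b \<in> bas then vs.representation (vs.extend_basis bas) x b else 0)"

text \<open>The projection of the ambient type onto the carrier along the vectors that
  \<open>extend_basis\<close> adds to \<open>bas\<close>. Composing with it makes operations total
  that are specified on the carrier only.\<close>

definition prj :: "'a \<Rightarrow> 'a" where
  "prj x = (\<Sum>b\<in>bas. scl H (crd b x) b)"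

lemma crd_add: "crd b (x + y) = crd b x + crd b y"
  and crd_scl: "crd b (scl H c x) = c * crd b x"
  using vs.independent_extend_basis[OF bas(2)] vs.span_extend_basis[OF bas(2)]
  by (simp_all add: crd_def vs.representation_add vs.representation_scale)

lemma crd_bas: "b \<in> bas \<Longrightarrow> crd a b = (if a = b then 1 else 0)"
  using vs.independent_extend_basis[OF bas(2)] vs.extend_basis_superset[OF bas(2)]
  by (auto simp: crd_def vs.representation_basis subset_eq)

lemma crd_zero: "crd b 0 = 0" using crd_scl[of b 0 0] by simp

lemma crd_sum: "crd b (\<Sum>i\<in>I. f i) = (\<Sum>i\<in>I. crd b (f i))"
  by (induction I rule: infinite_finite_induct) (simp_all add: crd_zero crd_add)

lemma prj_closed [simp]: "prj x \<in> carrier H"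
  unfolding prj_def by (intro sum_closed scl_closed bas_closed)

lemma crd_prj [simp]: "crd b (prj x) = crd b x"
proof -
  have "crd b (prj x) = (\<Sum>a\<in>bas. crd a x * (if b = a then 1 else 0))"
    unfolding prj_def by (simp add: crd_sum crd_scl crd_bas)
  also have "\<dots> = crd b x"
    using bas(1) by (simp add: if_distrib sum.delta cong: if_cong) (simp add: crd_def)
  finally show ?thesis .
qed

lemma prj_id: "x \<in> carrier H \<Longrightarrow> prj x = x"
proof -
  assume "x \<in> carrier H"
  then have x: "x \<in> vs.span bas" using bas(3) by simp
  have "vs.representation (vs.extend_basis bas) x = vs.representation bas x"
    by (rule vs.representation_extend[OF vs.independent_extend_basis[OF bas(2)] x
          vs.extend_basis_superset[OF bas(2)]])
  then show ?thesis
    using vs.sum_representation_eq[OF bas(2) x bas(1) order_refl] by (simp add: prj_def crd_def)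
qed

lemma prj_prj [simp]: "prj (prj x) = prj x" by (simp add: prj_id)

lemma prj_bas: "b \<in> bas \<Longrightarrow> prj b = b" by (simp add: prj_id bas_closed)

lemma crd_eqI: "(\<And>b. crd b x = crd b y) \<Longrightarrow> prj x = prj y"
  by (simp add: prj_def)

lemma linear_crd: "linear_on H scalars (crd b)"
  by (simp add: linear_on_def scalars_def crd_add crd_scl)

lemma coord_H: "coord_system H bas (\<lambda>b. b) crd"
  using bas(1) linear_crd bas_closed prj_id by (simp add: coord_system_def prj_def)

subsection \<open>Linear functionals and endomorphisms\<close>

text \<open>Agreeing with the expansion in the basis means being linear and invariant under \<open>prj\<close>.\<close>

definition lin :: "('a \<Rightarrow> 'k) \<Rightarrow> bool" where
  "lin f \<longleftrightarrow> (\<forall>x. f x = (\<Sum>b\<in>bas. crd b x * f b))"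

definition lin_map :: "('a \<Rightarrow> 'a) \<Rightarrow> bool" where
  "lin_map g \<longleftrightarrow> (\<forall>b. lin (\<lambda>x. crd b (g x)))"

lemma lin_expand: "lin f \<Longrightarrow> f x = (\<Sum>b\<in>bas. crd b x * f b)"
  unfolding lin_def by blast

lemma lin_collapse: "lin f \<Longrightarrow> (\<Sum>b\<in>bas. crd b x * f b) = f x"
  using lin_expand[of f x] by simp

lemma lin_prj: "lin f \<Longrightarrow> f (prj x) = f x"
  using lin_expand[of f x] lin_expand[of f "prj x"] by simp

lemma lin_add: "lin f \<Longrightarrow> f (x + y) = f x + f y"
  using lin_expand[of f x] lin_expand[of f y] lin_expand[of f "x + y"]
  by (simp add: crd_add distrib_right sum.distrib)

lemma lin_scl: "lin f \<Longrightarrow> f (scl H c x) = c * f x"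
  using lin_expand[of f x] lin_expand[of f "scl H c x"]
  by (simp add: crd_scl sum_distrib_left mult.assoc)

lemma linear_on_lin: "lin f \<Longrightarrow> linear_on H scalars f"
  by (simp add: linear_on_def scalars_def lin_add lin_scl)

lemma lin_linear_on:
  assumes "linear_on H scalars f" shows "lin (\<lambda>x. f (prj x))"
  unfolding lin_def
proof
  show "f (prj x) = (\<Sum>b\<in>bas. crd b x * f (prj b))" for x
    using linear_on_expand[OF kspace_H coord_H assms, of "prj x"]
    by (simp add: scalars_def prj_bas)
qed

lemma lin_crd [simp]: "lin (crd b)"
  using lin_linear_on[OF linear_crd, of b] by simp

lemma lin_zero [simp]: "lin (\<lambda>x. 0)" by (simp add: lin_def)

lemma lin_mult_left [simp]: "lin f \<Longrightarrow> lin (\<lambda>x. c * f x)"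
  unfolding lin_def
proof
  assume f: "\<forall>x. f x = (\<Sum>b\<in>bas. crd b x * f b)"
  show "c * f x = (\<Sum>b\<in>bas. crd b x * (c * f b))" for x
    using f[rule_format, of x] by (simp add: sum_distrib_left mult.left_commute)
qed

lemma lin_mult_right [simp]: "lin f \<Longrightarrow> lin (\<lambda>x. f x * c)"
  using lin_mult_left[of f c] by (simp add: mult.commute)

lemma lin_plus [simp]: "lin f \<Longrightarrow> lin g \<Longrightarrow> lin (\<lambda>x. f x + g x)"
  unfolding lin_def[of "\<lambda>x. f x + g x"] using lin_expand[of f] lin_expand[of g]
  by (simp add: distrib_left sum.distrib lin_collapse)

lemma lin_sum [simp]: "(\<And>i. i \<in> I \<Longrightarrow> lin (f i)) \<Longrightarrow> lin (\<lambda>x. \<Sum>i\<in>I. f i x)"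
  by (induction I rule: infinite_finite_induct) simp_all

lemma lin_comp: "lin f \<Longrightarrow> lin_map g \<Longrightarrow> lin (\<lambda>x. f (g x))"
proof -
  assume f: "lin f" and g: "lin_map g"
  have "f (g x) = (\<Sum>b\<in>bas. crd b (g x) * f b)" for x by (rule lin_expand[OF f])
  moreover have "lin (\<lambda>x. \<Sum>b\<in>bas. crd b (g x) * f b)"
    using g by (intro lin_sum lin_mult_right) (simp add: lin_map_def)
  ultimately show ?thesis by simp
qed

lemma lin_map_id [simp]: "lin_map (\<lambda>x. x)" by (simp add: lin_map_def)

lemma lin_map_comp: "lin_map f \<Longrightarrow> lin_map g \<Longrightarrow> lin_map (\<lambda>x. f (g x))"
  unfolding lin_map_def[of f] lin_map_def[of "\<lambda>x. f (g x)"]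
  by (auto intro: lin_comp[where f = "\<lambda>x. crd b (f x)" for b])

lemma lin_map_linear_on: "linear_on H H g \<Longrightarrow> lin_map (\<lambda>x. g (prj x))"
  unfolding lin_map_def
  by (intro allI lin_linear_on[where f = "\<lambda>x. crd b (g x)" for b] linear_on_comp[OF _ linear_crd])

lemma lin_eqI: "(\<And>f. lin f \<Longrightarrow> f x = f y) \<Longrightarrow> prj x = prj y"
  by (rule crd_eqI) simp

definition bilin :: "('a \<Rightarrow> 'a \<Rightarrow> 'k) \<Rightarrow> bool" where
  "bilin e \<longleftrightarrow> (\<forall>a. lin (e a)) \<and> (\<forall>b. lin (\<lambda>a. e a b))"

lemma bilinI: "(\<And>a. lin (e a)) \<Longrightarrow> (\<And>b. lin (\<lambda>a. e a b)) \<Longrightarrow> bilin e"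
  by (simp add: bilin_def)

lemma bilinear_on_bilin: "bilin e \<Longrightarrow> bilinear_on H H scalars e"
  by (simp add: bilin_def bilinear_on_def linear_on_lin)

subsection \<open>The total operations\<close>

definition mult :: "'a \<Rightarrow> 'a \<Rightarrow> 'a" (infixl \<open>\<cdot>\<close> 75) where
  "x \<cdot> y = mul H (prj x) (prj y)"

definition one :: 'a (\<open>\<one>\<close>) where "\<one> = unit H"

definition cou :: "'a \<Rightarrow> 'k" where "cou x = counit H (prj x)"

definition ant :: "'a \<Rightarrow> 'a" where "ant x = antipode H (prj x)"

text \<open>The structure constants of the coproduct in the basis \<open>bas\<close>.\<close>

definition cop :: "'a \<Rightarrow> 'a \<Rightarrow> 'a \<Rightarrow> 'k" where
  "cop h i j = tlift H H (\<lambda>a b. crd i a * crd j b) (comul H (prj h))"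

text \<open>Sweedler sums are taken over a basis, so that they are linear in \<open>e\<close> and satisfy
  coassociativity even when \<open>e\<close> is not multilinear.\<close>

definition sw :: "('a \<Rightarrow> 'a \<Rightarrow> 'k) \<Rightarrow> 'a \<Rightarrow> 'k" where
  "sw e h = (\<Sum>i\<in>bas. \<Sum>j\<in>bas. cop h i j * e i j)"

lemma comul_closed: "x \<in> carrier H \<Longrightarrow> comul H x \<in> carrier (tensor H H)"
  by (rule linear_on_closed[OF comul_linear])

lemma bilinear_crd: "bilinear_on H H scalars (\<lambda>a b. crd i a * crd j b)"
  by (intro bilinear_on_mult linear_crd)

lemma lin_cop [simp]: "lin (\<lambda>h. cop h i j)"
  unfolding cop_def
  by (rule lin_linear_on[OF linear_on_comp[OF comul_linear
          linear_on_tlift[OF kspace_H kspace_scalars bilinear_crd]]])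

lemma sw2_vector:
  assumes "kspace U" "bilinear_on H H U e" "h \<in> carrier H"
  shows "sw2 H e h = (\<Sum>i\<in>bas. \<Sum>j\<in>bas. scl U (cop h i j) (e i j))"
  unfolding sw2_def cop_def prj_id[OF assms(3)]
  by (rule tlift_expand[OF kspace_H kspace_H assms(1) coord_H coord_H assms(2)
        comul_closed[OF assms(3)]])

lemma sw2_sw:
  assumes "bilinear_on H H scalars e" "h \<in> carrier H" shows "sw2 H e h = sw e h"
  using sw2_vector[OF kspace_scalars assms] by (simp add: sw_def scalars_def)

lemma lin_sw [simp]: "lin (sw e)"
  unfolding sw_def[abs_def] by simp

lemma lin_sw_comp [simp]: "lin_map g \<Longrightarrow> lin (\<lambda>x. sw e (g x))"
  by (rule lin_comp[OF lin_sw])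

lemma lin_sw_inner [simp]: "(\<And>a b. lin (\<lambda>x. e x a b)) \<Longrightarrow> lin (\<lambda>x. sw (\<lambda>a b. e x a b) h)"
  unfolding sw_def by simp

lemma sw_prj [simp]: "sw e (prj h) = sw e h" by (simp add: lin_prj)

lemma sw_mult_left: "sw (\<lambda>a b. c * e a b) h = c * sw e h"
  unfolding sw_def by (simp add: sum_distrib_left mult.left_commute)

lemma sw_mult_right: "sw (\<lambda>a b. e a b * c) h = sw e h * c"
  unfolding sw_def by (simp add: sum_distrib_right mult.assoc)

lemma sw_sum: "sw (\<lambda>a b. \<Sum>i\<in>I. e i a b) h = (\<Sum>i\<in>I. sw (e i) h)"
  unfolding sw_def
  by (induction I rule: infinite_finite_induct) (simp_all add: sum.distrib distrib_left)

lemma sw_swap: "sw (\<lambda>a b. sw (\<lambda>c d. e a b c d) y) x = sw (\<lambda>c d. sw (\<lambda>a b. e a b c d) x) y"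
proof -
  have "sw (\<lambda>a b. sw (\<lambda>c d. e a b c d) y) x =
      (\<Sum>i\<in>bas. \<Sum>j\<in>bas. \<Sum>k\<in>bas. \<Sum>l\<in>bas. cop x i j * cop y k l * e i j k l)"
    unfolding sw_def by (simp add: sum_distrib_left mult.assoc)
  also have "\<dots> = (\<Sum>i\<in>bas. \<Sum>k\<in>bas. \<Sum>j\<in>bas. \<Sum>l\<in>bas. cop x i j * cop y k l * e i j k l)"
    by (intro sum.cong refl sum.swap)
  also have "\<dots> = (\<Sum>k\<in>bas. \<Sum>i\<in>bas. \<Sum>j\<in>bas. \<Sum>l\<in>bas. cop x i j * cop y k l * e i j k l)"
    by (rule sum.swap)
  also have "\<dots> = (\<Sum>k\<in>bas. \<Sum>i\<in>bas. \<Sum>l\<in>bas. \<Sum>j\<in>bas. cop x i j * cop y k l * e i j k l)"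
    by (intro sum.cong refl sum.swap)
  also have "\<dots> = (\<Sum>k\<in>bas. \<Sum>l\<in>bas. \<Sum>i\<in>bas. \<Sum>j\<in>bas. cop x i j * cop y k l * e i j k l)"
    by (intro sum.cong refl sum.swap)
  also have "\<dots> = sw (\<lambda>c d. sw (\<lambda>a b. e a b c d) x) y"
    unfolding sw_def by (simp add: sum_distrib_left mult_ac)
  finally show ?thesis .
qed

text \<open>Obtained by pairing both sides of \<open>coassoc\<close> with the three coordinate
  functionals \<open>crd a\<close>, \<open>crd b\<close>, \<open>crd c\<close>; this pairing is the
  F of the proof.\<close>

lemma cop_coassoc:
  assumes a: "a \<in> bas" and b: "b \<in> bas" and c: "c \<in> bas"
  shows "(\<Sum>x\<in>bas. cop h x c * cop x a b) = (\<Sum>x\<in>bas. cop h a x * cop x b c)"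
proof -
  note K = kspace_H
  let ?HH = "tensor H H" and ?HHH = "tensor (tensor H H) H"
  let ?P = "\<lambda>c1 c2 c3. pure ?HH H (pure H H c1 c2) c3"
  define F where "F = tlift ?HH H (\<lambda>s z. tlift H H (\<lambda>p q. crd a p * crd b q) s * crd c z)"
  have bl: "bilinear_on ?HH H scalars (\<lambda>s z. tlift H H (\<lambda>p q. crd a p * crd b q) s * crd c z)"
    by (intro bilinear_on_mult linear_crd linear_on_tlift[OF K kspace_scalars bilinear_crd])
  have F: "linear_on ?HHH scalars F"
    unfolding F_def by (rule linear_on_tlift[OF kspace_tensor kspace_scalars bl])
  have P: "?P c1 c2 c3 \<in> carrier ?HHH"
    if "c1 \<in> carrier H" "c2 \<in> carrier H" "c3 \<in> carrier H" for c1 c2 c3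
    using that by (intro pure_closed)
  have FP: "F (?P c1 c2 c3) = crd a c1 * crd b c2 * crd c c3"
    if "c1 \<in> carrier H" "c2 \<in> carrier H" "c3 \<in> carrier H" for c1 c2 c3
    using that unfolding F_def
    by (simp add: tlift_pure[OF kspace_tensor kspace_scalars bl] pure_closed
        tlift_pure[OF K kspace_scalars bilinear_crd])
  have closed2: "tlift H H e (comul H x) \<in> carrier ?HHH"
    if "\<And>v w. v \<in> carrier H \<Longrightarrow> w \<in> carrier H \<Longrightarrow> e v w \<in> carrier ?HHH" "x \<in> carrier H" for e x
    using that by (intro tlift_closed[OF K kspace_tensor comul_closed])
  have Fsw: "F (tlift H H e (comul H x)) = tlift H H (\<lambda>v w. F (e v w)) (comul H x)"
    if "\<And>v w. v \<in> carrier H \<Longrightarrow> w \<in> carrier H \<Longrightarrow> e v w \<in> carrier ?HHH" "x \<in> carrier H" for e x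
    using that F by (intro linear_on_tlift_apply[OF K kspace_tensor comul_closed])
  have p: "prj h \<in> carrier H" by simp
  have "F (sw2 H (\<lambda>x c3. sw2 H (\<lambda>c1 c2. ?P c1 c2 c3) x) (prj h)) =
      tlift H H (\<lambda>x c3. tlift H H (\<lambda>c1 c2. crd a c1 * crd b c2 * crd c c3) (comul H x)) (comul H (prj h))"
    unfolding sw2_def
    apply (subst Fsw[OF closed2])
       apply (simp_all add: P)
    apply (rule tlift_cong[OF K comul_closed[OF p]])
    apply (subst Fsw)
      apply (simp_all add: P)
    apply (rule tlift_cong[OF K comul_closed])
     apply (simp_all add: FP)
    done
  also have "\<dots> = sw2 H (\<lambda>x c3. cop x a b * crd c c3) (prj h)"
    unfolding sw2_def cop_def
    by (rule tlift_cong[OF K comul_closed[OF p]]) (simp add: tlift_mult_right prj_id)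
  also have "\<dots> = sw (\<lambda>x c3. cop x a b * crd c c3) h"
    by (subst sw2_sw) (auto intro!: bilinear_on_bilin bilinI)
  also have "\<dots> = (\<Sum>x\<in>bas. cop h x c * cop x a b)"
    unfolding sw_def using bas(1) c
    by (simp add: crd_bas if_distrib sum.delta' cong: if_cong sum.cong_simp)
  finally have L: "F (sw2 H (\<lambda>x c3. sw2 H (\<lambda>c1 c2. ?P c1 c2 c3) x) (prj h)) =
    (\<Sum>x\<in>bas. cop h x c * cop x a b)" .
  have "F (sw2 H (\<lambda>c1 x. sw2 H (\<lambda>c2 c3. ?P c1 c2 c3) x) (prj h)) =
      tlift H H (\<lambda>c1 x. tlift H H (\<lambda>c2 c3. crd a c1 * (crd b c2 * crd c c3)) (comul H x)) (comul H (prj h))"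
    unfolding sw2_def
    apply (subst Fsw[OF closed2])
       apply (simp_all add: P)
    apply (rule tlift_cong[OF K comul_closed[OF p]])
    apply (subst Fsw)
      apply (simp_all add: P)
    apply (rule tlift_cong[OF K comul_closed])
     apply (simp_all add: FP)
    done
  also have "\<dots> = sw2 H (\<lambda>c1 x. crd a c1 * cop x b c) (prj h)"
    unfolding sw2_def cop_def
    by (rule tlift_cong[OF K comul_closed[OF p]]) (simp add: tlift_mult_left prj_id)
  also have "\<dots> = sw (\<lambda>c1 x. crd a c1 * cop x b c) h"
    by (subst sw2_sw) (auto intro!: bilinear_on_bilin bilinI)
  also have "\<dots> = (\<Sum>i\<in>bas. if a = i then \<Sum>j\<in>bas. cop h i j * cop j b c else 0)"
    unfolding sw_def by (intro sum.cong refl) (auto simp: crd_bas)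
  also have "\<dots> = (\<Sum>x\<in>bas. cop h a x * cop x b c)"
    using bas(1) a by (simp add: sum.delta')
  finally show ?thesis using L coassoc[OF p] by simp
qed

text \<open>As a rewrite rule it nests iterated Sweedler sums to the right. Bringing sums to this
  nesting is how legs are renumbered in the computations below.\<close>

lemma sw_coassoc: "sw (\<lambda>x c. sw (\<lambda>a b. e a b c) x) h = sw (\<lambda>a x. sw (\<lambda>b c. e a b c) x) h"
proof -
  have "sw (\<lambda>x c. sw (\<lambda>a b. e a b c) x) h =
     (\<Sum>x\<in>bas. \<Sum>c\<in>bas. \<Sum>a\<in>bas. \<Sum>b\<in>bas. cop h x c * cop x a b * e a b c)"
    unfolding sw_def by (simp add: sum_distrib_left mult.assoc)
  also have "\<dots> = (\<Sum>c\<in>bas. \<Sum>x\<in>bas. \<Sum>a\<in>bas. \<Sum>b\<in>bas. cop h x c * cop x a b * e a b c)"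
    by (rule sum.swap)
  also have "\<dots> = (\<Sum>c\<in>bas. \<Sum>a\<in>bas. \<Sum>x\<in>bas. \<Sum>b\<in>bas. cop h x c * cop x a b * e a b c)"
    by (intro sum.cong refl sum.swap)
  also have "\<dots> = (\<Sum>c\<in>bas. \<Sum>a\<in>bas. \<Sum>b\<in>bas. \<Sum>x\<in>bas. cop h x c * cop x a b * e a b c)"
    by (intro sum.cong refl sum.swap)
  also have "\<dots> = (\<Sum>c\<in>bas. \<Sum>a\<in>bas. \<Sum>b\<in>bas. (\<Sum>x\<in>bas. cop h a x * cop x b c) * e a b c)"
    by (intro sum.cong refl) (simp add: cop_coassoc sum_distrib_right[symmetric])
  also have "\<dots> = (\<Sum>a\<in>bas. \<Sum>c\<in>bas. \<Sum>b\<in>bas. \<Sum>x\<in>bas. cop h a x * cop x b c * e a b c)"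
    by (subst sum.swap) (simp add: sum_distrib_right)
  also have "\<dots> = (\<Sum>a\<in>bas. \<Sum>b\<in>bas. \<Sum>c\<in>bas. \<Sum>x\<in>bas. cop h a x * cop x b c * e a b c)"
    by (intro sum.cong refl sum.swap)
  also have "\<dots> = (\<Sum>a\<in>bas. \<Sum>b\<in>bas. \<Sum>x\<in>bas. \<Sum>c\<in>bas. cop h a x * cop x b c * e a b c)"
    by (intro sum.cong refl sum.swap)
  also have "\<dots> = (\<Sum>a\<in>bas. \<Sum>x\<in>bas. \<Sum>b\<in>bas. \<Sum>c\<in>bas. cop h a x * cop x b c * e a b c)"
    by (intro sum.cong refl sum.swap)
  also have "\<dots> = sw (\<lambda>a x. sw (\<lambda>b c. e a b c) x) h"
    unfolding sw_def by (simp add: sum_distrib_left mult.assoc)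
  finally show ?thesis .
qed

lemma prj_mult [simp]: "prj (x \<cdot> y) = x \<cdot> y"
  and mult_prj_left [simp]: "prj x \<cdot> y = x \<cdot> y"
  and mult_prj_right [simp]: "x \<cdot> prj y = x \<cdot> y"
  using bilinear_on_closed[OF mul_bilinear] by (simp_all add: mult_def prj_id)

lemma prj_one [simp]: "prj \<one> = \<one>"
  using unit_closed by (simp add: one_def prj_id)

lemma mult_one_left [simp]: "\<one> \<cdot> x = prj x"
  and mult_one_right [simp]: "x \<cdot> \<one> = prj x"
  using unit_closed by (simp_all add: mult_def one_def prj_id unit_left unit_right)

lemma mult_assoc: "x \<cdot> y \<cdot> z = x \<cdot> (y \<cdot> z)"
  using bilinear_on_closed[OF mul_bilinear] by (simp add: mult_def prj_id mul_assoc)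

lemma lin_map_mult_left [simp]: "lin_map g \<Longrightarrow> lin_map (\<lambda>x. g x \<cdot> c)"
proof -
  have "linear_on H H (\<lambda>x. mul H x (prj c))" using mul_bilinear by (simp add: bilinear_on_def)
  from lin_map_linear_on[OF this] have "lin_map (\<lambda>x. x \<cdot> c)" by (simp add: mult_def)
  then show "lin_map g \<Longrightarrow> lin_map (\<lambda>x. g x \<cdot> c)" by (rule lin_map_comp)
qed

lemma lin_map_mult_right [simp]: "lin_map g \<Longrightarrow> lin_map (\<lambda>x. c \<cdot> g x)"
proof -
  have "linear_on H H (mul H (prj c))" using mul_bilinear by (simp add: bilinear_on_def)
  from lin_map_linear_on[OF this] have "lin_map (\<lambda>x. c \<cdot> x)" by (simp add: mult_def)
  then show "lin_map g \<Longrightarrow> lin_map (\<lambda>x. c \<cdot> g x)" by (rule lin_map_comp)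
qed

lemma lin_cou [simp]: "lin cou"
  unfolding cou_def[abs_def] by (rule lin_linear_on[OF counit_linear])

lemma lin_cou_comp [simp]: "lin_map g \<Longrightarrow> lin (\<lambda>x. cou (g x))"
  by (rule lin_comp[OF lin_cou])

lemma cou_mult [simp]: "cou (x \<cdot> y) = cou x * cou y"
  using counit_hom bilinear_on_closed[OF mul_bilinear]
  by (simp add: algebra_hom_def scalar_alg_def cou_def mult_def prj_id)

lemma cou_one [simp]: "cou \<one> = 1"
  using counit_hom unit_closed by (simp add: algebra_hom_def scalar_alg_def cou_def one_def prj_id)

lemma cou_prj [simp]: "cou (prj x) = cou x" by (simp add: lin_prj)

lemma sw_counit_left:
  assumes "lin f" shows "sw (\<lambda>a b. cou a * f b) h = f h"
proof -
  have "prj h = sw2 H (\<lambda>a b. scl H (counit H a) b) (prj h)" by (simp add: counit_left)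
  also have "\<dots> = tlift H H (\<lambda>a b. scl H (counit H a) b) (comul H (prj h))" by (simp add: sw2_def)
  finally have "f (prj h) = tlift H H (\<lambda>a b. f (scl H (counit H a) b)) (comul H (prj h))"
    using linear_on_tlift_apply[OF kspace_H kspace_H comul_closed, of "prj h"
        "\<lambda>a b. scl H (counit H a) b" scalars f] linear_on_lin[OF assms]
    by (simp add: scl_closed)
  also have "\<dots> = tlift H H (\<lambda>a b. cou a * f b) (comul H (prj h))"
    by (rule tlift_cong[OF kspace_H comul_closed]) (simp_all add: lin_scl[OF assms] cou_def prj_id)
  also have "\<dots> = sw (\<lambda>a b. cou a * f b) h"
    using assms by (subst sw2_def[symmetric], subst sw2_sw) (auto intro!: bilinear_on_bilin bilinI)
  finally show ?thesis using assms by (simp add: lin_prj)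
qed

lemma sw_counit_right:
  assumes "lin f" shows "sw (\<lambda>a b. cou b * f a) h = f h"
proof -
  have "prj h = sw2 H (\<lambda>a b. scl H (counit H b) a) (prj h)" by (simp add: counit_right)
  also have "\<dots> = tlift H H (\<lambda>a b. scl H (counit H b) a) (comul H (prj h))" by (simp add: sw2_def)
  finally have "f (prj h) = tlift H H (\<lambda>a b. f (scl H (counit H b) a)) (comul H (prj h))"
    using linear_on_tlift_apply[OF kspace_H kspace_H comul_closed, of "prj h"
        "\<lambda>a b. scl H (counit H b) a" scalars f] linear_on_lin[OF assms]
    by (simp add: scl_closed)
  also have "\<dots> = tlift H H (\<lambda>a b. cou b * f a) (comul H (prj h))"
    by (rule tlift_cong[OF kspace_H comul_closed]) (simp_all add: lin_scl[OF assms] cou_def prj_id)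
  also have "\<dots> = sw (\<lambda>a b. cou b * f a) h"
    using assms by (subst sw2_def[symmetric], subst sw2_sw) (auto intro!: bilinear_on_bilin bilinI)
  finally show ?thesis using assms by (simp add: lin_prj)
qed

lemma sw_one:
  assumes "bilin e" shows "sw e \<one> = e \<one> \<one>"
proof -
  have "sw e \<one> = sw2 H e \<one>"
    using unit_closed by (subst sw2_sw[OF bilinear_on_bilin[OF assms]]) (simp_all add: one_def)
  also have "\<dots> = e \<one> \<one>"
    using comul_hom unit_closed
    by (simp add: sw2_def one_def algebra_hom_def tensor_alg_def
        tlift_pure[OF kspace_H kspace_scalars bilinear_on_bilin[OF assms]])
  finally show ?thesis .
qed

lemma sw_mult:
  assumes e: "bilin e"
  shows "sw e (x \<cdot> y) = sw (\<lambda>a b. sw (\<lambda>c d. e (a \<cdot> c) (b \<cdot> d)) y) x"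
proof -
  note K = kspace_H and b = bilinear_on_bilin[OF e]
  have lin1: "lin (e a)" "lin (\<lambda>a. e a b)" for a b using e by (simp_all add: bilin_def)
  note l [simp] = lin_comp[OF lin1(1)] lin_comp[OF lin1(2)]
  let ?f = "tlift H H e"
  have F: "linear_on (tensor H H) scalars ?f" by (rule linear_on_tlift[OF K kspace_scalars b])
  have mc: "mul H a c \<in> carrier H" if "a \<in> carrier H" "c \<in> carrier H" for a c
    using bilinear_on_closed[OF mul_bilinear that] .
  have X: "comul H (prj x) \<in> carrier (tensor H H)" and Y: "comul H (prj y) \<in> carrier (tensor H H)"
    by (simp_all add: comul_closed)
  have "sw e (x \<cdot> y) = ?f (comul H (x \<cdot> y))"
    by (subst sw2_sw[symmetric, OF b]) (auto simp: sw2_def mult_def mc)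
  also have "comul H (x \<cdot> y) = tlift H H (\<lambda>a b. tlift H H (\<lambda>c d. pure H H (mul H a c) (mul H b d))
      (comul H (prj y))) (comul H (prj x))"
    using comul_hom by (simp add: mult_def algebra_hom_def tensor_alg_def)
  also have "?f \<dots> = tlift H H (\<lambda>a b. ?f (tlift H H (\<lambda>c d. pure H H (mul H a c) (mul H b d))
      (comul H (prj y)))) (comul H (prj x))"
    by (intro linear_on_tlift_apply[OF K kspace_tensor X _ F] tlift_closed[OF K kspace_tensor Y]
        pure_closed mc)
  also have "\<dots> = tlift H H (\<lambda>a b. sw2 H (\<lambda>c d. e (a \<cdot> c) (b \<cdot> d)) (prj y)) (comul H (prj x))"
    unfolding sw2_def
  proof (rule tlift_cong[OF K X])
    fix v w assume vw: "v \<in> carrier H" "w \<in> carrier H"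
    have "?f (tlift H H (\<lambda>c d. pure H H (mul H v c) (mul H w d)) (comul H (prj y))) =
       tlift H H (\<lambda>c d. ?f (pure H H (mul H v c) (mul H w d))) (comul H (prj y))"
      using vw by (intro linear_on_tlift_apply[OF K kspace_tensor Y _ F] pure_closed mc)
    also have "\<dots> = tlift H H (\<lambda>c d. e (v \<cdot> c) (w \<cdot> d)) (comul H (prj y))"
      using vw by (intro tlift_cong[OF K Y]) (simp add: tlift_pure[OF K kspace_scalars b] mc mult_def prj_id)
    finally show "?f (tlift H H (\<lambda>c d. pure H H (mul H v c) (mul H w d)) (comul H (prj y))) = \<dots>" .
  qed
  also have "\<dots> = sw2 H (\<lambda>a b. sw (\<lambda>c d. e (a \<cdot> c) (b \<cdot> d)) y) (prj x)"
    by (subst sw2_sw) (auto intro!: bilinear_on_bilin bilinI simp: sw2_def)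
  also have "\<dots> = sw (\<lambda>a b. sw (\<lambda>c d. e (a \<cdot> c) (b \<cdot> d)) y) x"
    by (subst sw2_sw) (auto intro!: bilinear_on_bilin bilinI)
  finally show ?thesis .
qed

subsection \<open>The antipode\<close>

lemma is_antipode_antipode: "is_antipode H (antipode H)"
  unfolding antipode_def by (rule someI_ex[OF antipode_exists])

lemma antipode_linear: "linear_on H H (antipode H)"
  using is_antipode_antipode by (simp add: is_antipode_def)

lemma lin_map_ant [simp]: "lin_map g \<Longrightarrow> lin_map (\<lambda>x. ant (g x))"
  using lin_map_comp[OF lin_map_linear_on[OF antipode_linear]] by (simp add: ant_def)

lemma prj_ant [simp]: "prj (ant x) = ant x"
  using linear_on_closed[OF antipode_linear] by (simp add: ant_def prj_id)

lemma ant_prj [simp]: "ant (prj x) = ant x" by (simp add: ant_def)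

lemma
  assumes f: "lin f"
  shows sw_ant_left: "sw (\<lambda>a b. f (ant a \<cdot> b)) h = cou h * f \<one>"
    and sw_ant_right: "sw (\<lambda>a b. f (a \<cdot> ant b)) h = cou h * f \<one>"
proof -
  note K = kspace_H
  note [simp] = lin_comp[OF f]
  have mc: "mul H a c \<in> carrier H" if "a \<in> carrier H" "c \<in> carrier H" for a c
    using bilinear_on_closed[OF mul_bilinear that] .
  have ac: "antipode H a \<in> carrier H" if "a \<in> carrier H" for a
    using linear_on_closed[OF antipode_linear that] .
  have p: "prj h \<in> carrier H" by simp
  have "sw (\<lambda>a b. f (ant a \<cdot> b)) h = sw2 H (\<lambda>a b. f (ant a \<cdot> b)) (prj h)"
    by (subst sw2_sw) (auto intro!: bilinear_on_bilin bilinI)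
  also have "\<dots> = f (sw2 H (\<lambda>a b. mul H (antipode H a) b) (prj h))"
    unfolding sw2_def
    by (subst linear_on_tlift_apply[OF K K comul_closed[OF p] _ linear_on_lin[OF f]])
      (auto intro!: mc ac tlift_cong[OF K comul_closed[OF p]] simp: ant_def mult_def prj_id ac)
  also have "\<dots> = cou h * f \<one>"
    using is_antipode_antipode by (simp add: is_antipode_def lin_scl[OF f] cou_def one_def)
  finally show "sw (\<lambda>a b. f (ant a \<cdot> b)) h = cou h * f \<one>" .
  have "sw (\<lambda>a b. f (a \<cdot> ant b)) h = sw2 H (\<lambda>a b. f (a \<cdot> ant b)) (prj h)"
    by (subst sw2_sw) (auto intro!: bilinear_on_bilin bilinI)
  also have "\<dots> = f (sw2 H (\<lambda>a b. mul H a (antipode H b)) (prj h))"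
    unfolding sw2_def
    by (subst linear_on_tlift_apply[OF K K comul_closed[OF p] _ linear_on_lin[OF f]])
      (auto intro!: mc ac tlift_cong[OF K comul_closed[OF p]] simp: ant_def mult_def prj_id ac)
  also have "\<dots> = cou h * f \<one>"
    using is_antipode_antipode by (simp add: is_antipode_def lin_scl[OF f] cou_def one_def)
  finally show "sw (\<lambda>a b. f (a \<cdot> ant b)) h = cou h * f \<one>" .
qed

lemma bilin_left: "bilin e \<Longrightarrow> lin (\<lambda>a. e a b)" and bilin_right: "bilin e \<Longrightarrow> lin (e a)"
  by (simp_all add: bilin_def)

lemma bilin_prj_left: "bilin e \<Longrightarrow> e (prj x) = e x"
  by (rule ext) (rule lin_prj[OF bilin_left])

lemma sw_ant_left_cancel:
  assumes "\<And>c. lin (\<lambda>z. F z c)" "\<And>z. lin (F z)"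
  shows "sw (\<lambda>a r. sw (\<lambda>b c. F (ant a \<cdot> b) c) r) h = F \<one> h"
  using assms by (simp add: sw_coassoc[symmetric] sw_ant_left[where f = "\<lambda>z. F z c" for c] sw_counit_left)

lemma sw_ant_right_cancel:
  assumes "\<And>c. lin (\<lambda>z. F z c)" "\<And>z. lin (F z)"
  shows "sw (\<lambda>a r. sw (\<lambda>b c. F (a \<cdot> ant b) c) r) h = F \<one> h"
  using assms by (simp add: sw_coassoc[symmetric] sw_ant_right[where f = "\<lambda>z. F z c" for c] sw_counit_left)

text \<open>In the form h_1 \<otimes> h_2 S(h_3) = h \<otimes> 1, this serves to insert a trivial
  factor into a product before the legs are regrouped.\<close>

lemma sw_ant_right_insert:
  assumes "\<And>c. lin (\<lambda>z. F z c)" "\<And>z. lin (F z)"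
  shows "sw (\<lambda>c r. sw (\<lambda>a b. F (a \<cdot> ant b) c) r) h = F \<one> h"
  using assms by (simp add: sw_ant_right[where f = "\<lambda>z. F z c" for c] sw_counit_right)

subsection \<open>The antipode is an anti-homomorphism\<close>

text \<open>Both sides are convolution inverse to the multiplication H \<otimes> H \<rightarrow> H.
  Elementwise: x_2 S(x_3) and y_2 S(y_3) are inserted behind S(x_1 y_1), and after regrouping S(x_1
  y_1) (x_2 y_2) collapses, which leaves S(y) S(x).\<close>

lemma ant_mult: "ant (x \<cdot> y) = ant y \<cdot> ant x"
proof -
  have "f (ant (x \<cdot> y)) = f (ant y \<cdot> ant x)" if f: "lin f" for f
  proof -
    note [simp] = lin_comp[OF f]
    have "f (ant (x \<cdot> y)) = sw (\<lambda>x1 x'. sw (\<lambda>x2 x3. f (ant (x1 \<cdot> y) \<cdot> (x2 \<cdot> ant x3))) x') x"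
      by (subst sw_ant_right_insert[where F = "\<lambda>z a. f (ant (a \<cdot> y) \<cdot> z)"]) simp_all
    also have "\<dots> = sw (\<lambda>x1 x'. sw (\<lambda>x2 x3. sw (\<lambda>y1 y'. sw (\<lambda>y2 y3.
        f (ant (x1 \<cdot> y1) \<cdot> (x2 \<cdot> ((y2 \<cdot> ant y3) \<cdot> ant x3)))) y') y) x') x"
      by (subst sw_ant_right_insert[where F = "\<lambda>z a. f (ant (x1 \<cdot> a) \<cdot> (x2 \<cdot> (z \<cdot> ant x3)))" for x1 x2 x3])
        simp_all
    also have "\<dots> = sw (\<lambda>x' x3. sw (\<lambda>x1 x2. sw (\<lambda>y' y3. sw (\<lambda>y1 y2.
        f (ant (x1 \<cdot> y1) \<cdot> (x2 \<cdot> y2) \<cdot> (ant y3 \<cdot> ant x3))) y') y) x') x"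
      by (simp only: sw_coassoc mult_assoc)
    also have "\<dots> = sw (\<lambda>x' x3. sw (\<lambda>y' y3. sw (\<lambda>x1 x2. sw (\<lambda>y1 y2.
        f (ant (x1 \<cdot> y1) \<cdot> (x2 \<cdot> y2) \<cdot> (ant y3 \<cdot> ant x3))) y') x') y) x"
      by (subst sw_swap[where y = y]) (rule refl)
    also have "\<dots> = sw (\<lambda>x' x3. sw (\<lambda>y' y3. sw (\<lambda>a b.
        f (ant a \<cdot> b \<cdot> (ant y3 \<cdot> ant x3))) (x' \<cdot> y')) y) x"
      by (subst sw_mult) (auto intro!: bilinI)
    also have "\<dots> = sw (\<lambda>x' x3. sw (\<lambda>y' y3. cou x' * (cou y' * f (ant y3 \<cdot> ant x3))) y) x"
      by (subst sw_ant_left[where f = "\<lambda>z. f (z \<cdot> (ant y3 \<cdot> ant x3))" for x3 y3]) (simp_all add: mult.assoc)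
    also have "\<dots> = f (ant y \<cdot> ant x)"
      by (simp add: sw_mult_left sw_counit_left[where f = "\<lambda>b. f (ant b \<cdot> c)" for c]
          sw_counit_left[where f = "\<lambda>b. f (c \<cdot> ant b)" for c])
    finally show ?thesis .
  qed
  from lin_eqI[of "ant (x \<cdot> y)" "ant y \<cdot> ant x", OF this] show ?thesis by simp
qed

lemma ant_one [simp]: "ant \<one> = \<one>"
proof -
  have "f (ant \<one>) = f \<one>" if f: "lin f" for f
  proof -
    note [simp] = lin_comp[OF f]
    have "sw (\<lambda>a b. f (ant a \<cdot> b)) \<one> = f (ant \<one>)"
      by (subst sw_one) (auto intro!: bilinI)
    then show ?thesis using sw_ant_left[OF f, of \<one>] by simp
  qed
  from lin_eqI[of "ant \<one>" \<one>, OF this] show ?thesis by simp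
qed

lemma cou_ant [simp]: "cou (ant x) = cou x"
proof -
  have "cou (ant x) = sw (\<lambda>a b. cou b * cou (ant a)) x" by (simp add: sw_counit_right)
  also have "\<dots> = sw (\<lambda>a b. cou (ant a \<cdot> b)) x" by (simp add: mult.commute)
  also have "\<dots> = cou x" by (simp only: sw_ant_left[OF lin_cou] cou_one mult_1_right)
  finally show ?thesis .
qed

text \<open>Dual to \<open>ant_mult\<close>: both sides describe a convolution inverse of the
  coproduct. One trivial factor a S(d) is inserted in each tensor leg behind the coproduct of
  S(x_1); regrouped, the coproducts of S(x_1) and x_2 multiply to that of S(x_1) x_2, which
  collapses to 1 \<otimes> 1.\<close>

lemma sw_ant:
  assumes e: "bilin e"
  shows "sw e (ant x) = sw (\<lambda>a b. e (ant b) (ant a)) x"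
proof -
  note [simp] = lin_comp[OF bilin_left[OF e]] lin_comp[OF bilin_right[OF e]]
    bilin_prj_left[OF e] lin_prj[OF bilin_right[OF e]] bilin_left[OF e] bilin_right[OF e]
  have "sw e (ant x) = sw (\<lambda>x1 x'. sw (\<lambda>a d. sw (\<lambda>p q. e (p \<cdot> (a \<cdot> ant d)) q) (ant x1)) x') x"
    by (subst sw_ant_right_insert[where F = "\<lambda>z a. sw (\<lambda>p q. e (p \<cdot> z) q) (ant a)"]) simp_all
  also have "\<dots> = sw (\<lambda>x1 x'. sw (\<lambda>a d. sw (\<lambda>a1 a2. sw (\<lambda>b c.
      sw (\<lambda>p q. e (p \<cdot> (a1 \<cdot> ant d)) (q \<cdot> (b \<cdot> ant c))) (ant x1)) a2) a) x') x"
    by (subst sw_ant_right_insert[where F = "\<lambda>z a. sw (\<lambda>p q. e (p \<cdot> (a \<cdot> ant d)) (q \<cdot> z)) (ant x1)"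
        for d x1]) simp_all
  also have "\<dots> = sw (\<lambda>w r. sw (\<lambda>x1 v. sw (\<lambda>a1 b. sw (\<lambda>c d.
      sw (\<lambda>p q. e ((p \<cdot> a1) \<cdot> ant d) ((q \<cdot> b) \<cdot> ant c)) (ant x1)) r) v) w) x"
    by (simp only: sw_coassoc mult_assoc)
  also have "\<dots> = sw (\<lambda>w r. sw (\<lambda>x1 v. sw (\<lambda>c d. sw (\<lambda>p q. sw (\<lambda>a1 b.
      e ((p \<cdot> a1) \<cdot> ant d) ((q \<cdot> b) \<cdot> ant c)) v) (ant x1)) r) w) x"
    by (subst sw_swap[where y = r and x = v for r v], subst sw_swap[where y = "ant x" and x = v for x v])
      (rule refl)
  also have "\<dots> = sw (\<lambda>w r. sw (\<lambda>x1 v. sw (\<lambda>c d. sw (\<lambda>s t. e (s \<cdot> ant d) (t \<cdot> ant c)) (ant x1 \<cdot> v)) r) w) x"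
    by (subst sw_mult[where e = "\<lambda>s t. e (s \<cdot> ant d) (t \<cdot> ant c)" for c d]) (auto intro!: bilinI)
  also have "\<dots> = sw (\<lambda>w r. cou w * sw (\<lambda>c d. e (ant d) (ant c)) r) x"
    by (subst sw_ant_left[where f = "\<lambda>z. sw (\<lambda>c d. sw (\<lambda>s t. e (s \<cdot> ant d) (t \<cdot> ant c)) z) r" for r])
      (simp_all add: sw_one[OF bilinI])
  also have "\<dots> = sw (\<lambda>a b. e (ant b) (ant a)) x"
    by (subst sw_counit_left) simp_all
  finally show ?thesis .
qed

subsection \<open>Integrals and bijectivity of the antipode\<close>

text \<open>This identity says that the action of \<open>H\<close> by \<open>(\<chi> \<cdot> h) (x) = \<chi> (x S(h))\<close> makes the dual,
  with its regular coaction, a Hopf module.\<close>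

lemma dual_hopf_module:
  assumes f: "lin f" and \<chi>: "lin \<chi>"
  shows "sw (\<lambda>a b. f a * \<chi> (b \<cdot> ant h)) x =
    sw (\<lambda>h1 h2. sw (\<lambda>p q. f (p \<cdot> h2) * \<chi> q) (x \<cdot> ant h1)) h"
proof -
  note [simp] = lin_comp[OF f] lin_comp[OF \<chi>] f \<chi> lin_prj[OF f] lin_prj[OF \<chi>]
  have "sw (\<lambda>h1 h2. sw (\<lambda>p q. f (p \<cdot> h2) * \<chi> q) (x \<cdot> ant h1)) h =
    sw (\<lambda>h1 h2. sw (\<lambda>x1 x2. sw (\<lambda>c d. f (x1 \<cdot> c \<cdot> h2) * \<chi> (x2 \<cdot> d)) (ant h1)) x) h"
    by (subst sw_mult) (auto intro!: bilinI)
  also have "\<dots> = sw (\<lambda>h1 h2. sw (\<lambda>x1 x2. sw (\<lambda>c d. f (x1 \<cdot> (ant d \<cdot> h2)) * \<chi> (x2 \<cdot> ant c)) h1) x) h"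
    by (subst sw_ant) (auto intro!: bilinI simp: mult_assoc)
  also have "\<dots> = sw (\<lambda>x1 x2. sw (\<lambda>h1 h2. sw (\<lambda>c d. f (x1 \<cdot> (ant d \<cdot> h2)) * \<chi> (x2 \<cdot> ant c)) h1) h) x"
    by (rule sw_swap)
  also have "\<dots> = sw (\<lambda>x1 x2. sw (\<lambda>c r. sw (\<lambda>d h2. f (x1 \<cdot> (ant d \<cdot> h2)) * \<chi> (x2 \<cdot> ant c)) r) h) x"
    by (simp only: sw_coassoc)
  also have "\<dots> = sw (\<lambda>x1 x2. sw (\<lambda>c r. cou r * (f x1 * \<chi> (x2 \<cdot> ant c))) h) x"
    by (subst sw_ant_left[where f = "\<lambda>z. f (x1 \<cdot> z) * \<chi> (x2 \<cdot> ant c)" for x1 x2 c]) simp_all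
  also have "\<dots> = sw (\<lambda>a b. f a * \<chi> (b \<cdot> ant h)) x"
    by (subst sw_counit_right) simp_all
  finally show ?thesis by simp
qed

text \<open>The projection \<open>\<phi> \<mapsto> \<phi>\<^sub>0 S(\<phi>\<^sub>1)\<close> onto the coinvariants of this Hopf module, i.e. onto the
  left integrals.\<close>

definition integral :: "('a \<Rightarrow> 'k) \<Rightarrow> 'a \<Rightarrow> 'k" where
  "integral \<phi> x = (\<Sum>i\<in>bas. sw (\<lambda>a b. crd i a * \<phi> b) (x \<cdot> ant (ant i)))"

lemma lin_integral: "lin (integral \<phi>)"
  unfolding integral_def[abs_def] by simp

text \<open>The coaction on the dual is \<phi> \<mapsto> \<Sum>l. (\<open>crd l\<close> convolved
  with \<phi>) \<otimes> l, and convolution with \<theta> is recovered by applying \<theta> to its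
  second factor. This is the origin of the basis sum in \<open>integral\<close>.\<close>

lemma sw_crd_collapse:
  assumes "lin \<theta>"
  shows "(\<Sum>l\<in>bas. \<theta> l * sw (\<lambda>z b. crd l z * \<phi> b) y) = sw (\<lambda>z b. \<theta> z * \<phi> b) y"
proof -
  have "sw (\<lambda>z b. \<theta> z * \<phi> b) y = sw (\<lambda>z b. \<Sum>l\<in>bas. \<theta> l * (crd l z * \<phi> b)) y"
    by (subst (1) lin_expand[OF assms]) (simp add: sum_distrib_left sum_distrib_right mult_ac)
  also have "\<dots> = (\<Sum>l\<in>bas. \<theta> l * sw (\<lambda>z b. crd l z * \<phi> b) y)"
    by (simp add: sw_sum sw_mult_left)
  finally show ?thesis by simp
qed

text \<open>The standard computation that m_0 S(m_1) is coinvariant. With \<Sum>l.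
  \<open>A l\<close> \<otimes> l as the coaction of \<phi>, the Hopf module identity at S(i)
  produces f(p S(i_1)); coassociativity (\<open>AA\<close>) makes p and i consecutive legs of one
  basis element l, and l_1 S(l_2) collapses.\<close>

lemma integral_left_invariant:
  assumes f: "lin f" and \<phi>: "lin \<phi>"
  shows "sw (\<lambda>a b. f a * integral \<phi> b) x = f \<one> * integral \<phi> x"
proof -
  note [simp] = lin_comp[OF f] lin_comp[OF \<phi>] f \<phi> lin_prj[OF f] lin_prj[OF \<phi>]
  define A where "A l y = sw (\<lambda>z b. crd l z * \<phi> b) y" for l y
  have linA [simp]: "lin (A l)" for l unfolding A_def[abs_def] by simp
  note [simp] = lin_comp[OF linA] lin_prj[OF linA]
  have AA: "sw (\<lambda>p q. f (p \<cdot> c) * A i q) y = (\<Sum>l\<in>bas. sw (\<lambda>p a. f (p \<cdot> c) * crd i a) l * A l y)"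
    for c i y
  proof -
    have "sw (\<lambda>p q. f (p \<cdot> c) * A i q) y = sw (\<lambda>z b. sw (\<lambda>p a. f (p \<cdot> c) * crd i a) z * \<phi> b) y"
      by (simp add: A_def sw_mult_left[symmetric] sw_mult_right[symmetric] sw_coassoc mult.assoc)
    then show ?thesis
      by (simp only: A_def, subst sw_crd_collapse) simp_all
  qed
  have "sw (\<lambda>a b. f a * integral \<phi> b) x =
      (\<Sum>i\<in>bas. sw (\<lambda>a b. f a * A i (b \<cdot> ant (ant i))) x)"
    by (simp add: integral_def A_def sum_distrib_left sw_sum)
  also have "\<dots> = (\<Sum>i\<in>bas. sw (\<lambda>i1 i2. sw (\<lambda>p q. f (p \<cdot> ant i1) * A i q) (x \<cdot> ant (ant i2))) i)"
    by (subst dual_hopf_module, simp, simp, subst sw_ant) (auto intro!: bilinI)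
  also have "\<dots> = (\<Sum>i\<in>bas. \<Sum>l\<in>bas. sw (\<lambda>i1 i2.
      sw (\<lambda>p a. crd i a * (f (p \<cdot> ant i1) * A l (x \<cdot> ant (ant i2)))) l) i)"
    by (simp only: AA sw_sum sw_mult_right[symmetric]) (simp only: mult_ac)
  also have "\<dots> = (\<Sum>l\<in>bas. \<Sum>i\<in>bas. sw (\<lambda>p a. crd i a *
      sw (\<lambda>i1 i2. f (p \<cdot> ant i1) * A l (x \<cdot> ant (ant i2))) i) l)"
    by (subst sum.swap, subst sw_swap) (simp only: sw_mult_left)
  also have "\<dots> = (\<Sum>l\<in>bas. sw (\<lambda>p a. sw (\<lambda>i1 i2. f (p \<cdot> ant i1) * A l (x \<cdot> ant (ant i2))) a) l)"
    by (simp add: sw_sum[symmetric] lin_collapse)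
  also have "\<dots> = (\<Sum>l\<in>bas. f \<one> * A l (x \<cdot> ant (ant l)))"
    by (subst sw_ant_right_cancel[where F = "\<lambda>z c. f z * A l (x \<cdot> ant (ant c))" for l]) simp_all
  also have "\<dots> = f \<one> * integral \<phi> x"
    by (simp add: integral_def A_def sum_distrib_left)
  finally show ?thesis .
qed

lemma sw_crd: "i \<in> bas \<Longrightarrow> j \<in> bas \<Longrightarrow> sw (\<lambda>a b. crd i a * crd j b) x = cop x i j"
proof -
  assume ij: "i \<in> bas" "j \<in> bas"
  have "sw (\<lambda>a b. crd i a * crd j b) x =
      (\<Sum>a\<in>bas. if a = i then \<Sum>b\<in>bas. if b = j then cop x a b else 0 else 0)"
    unfolding sw_def by (intro sum.cong refl) (auto simp: crd_bas intro!: sum.neutral sum.cong)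
  then show ?thesis using bas(1) ij by simp
qed

text \<open>The part m_0 S(m_1) m_2 = m of the fundamental theorem of Hopf modules. By
  \<open>ant_mult\<close> the two actions combine to the action of S(i) j, which collapses after the
  legs i, j are recognised as the coproduct of one basis element k.\<close>

lemma integral_reconstruct:
  assumes \<phi>: "lin \<phi>"
  shows "(\<Sum>j\<in>bas. integral (\<lambda>y. sw (\<lambda>a b. crd j a * \<phi> b) y) (x \<cdot> ant j)) = \<phi> x"
proof -
  note [simp] = lin_comp[OF \<phi>] \<phi> lin_prj[OF \<phi>]
  define A where "A l y = sw (\<lambda>z b. crd l z * \<phi> b) y" for l y
  have linA [simp]: "lin (A l)" for l unfolding A_def[abs_def] by simp
  note [simp] = lin_comp[OF linA] lin_prj[OF linA]
  have AA: "sw (\<lambda>a b. crd i a * A j b) y = (\<Sum>k\<in>bas. cop k i j * A k y)"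
    if "i \<in> bas" "j \<in> bas" for i j y
  proof -
    have "sw (\<lambda>a b. crd i a * A j b) y = sw (\<lambda>z c. sw (\<lambda>a b. crd i a * crd j b) z * \<phi> c) y"
      by (simp add: A_def sw_mult_left[symmetric] sw_mult_right[symmetric] sw_coassoc mult.assoc)
    also have "\<dots> = (\<Sum>k\<in>bas. sw (\<lambda>a b. crd i a * crd j b) k * A k y)"
      by (simp only: A_def, subst sw_crd_collapse) simp_all
    finally show ?thesis using that by (simp add: sw_crd)
  qed
  have "(\<Sum>j\<in>bas. integral (A j) (x \<cdot> ant j)) =
      (\<Sum>j\<in>bas. \<Sum>i\<in>bas. \<Sum>k\<in>bas. cop k i j * A k (x \<cdot> ant (ant i \<cdot> j)))"
    unfolding integral_def by (intro sum.cong refl) (simp add: AA ant_mult mult_assoc)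
  also have "\<dots> = (\<Sum>j\<in>bas. \<Sum>k\<in>bas. \<Sum>i\<in>bas. cop k i j * A k (x \<cdot> ant (ant i \<cdot> j)))"
    by (intro sum.cong refl sum.swap)
  also have "\<dots> = (\<Sum>k\<in>bas. \<Sum>j\<in>bas. \<Sum>i\<in>bas. cop k i j * A k (x \<cdot> ant (ant i \<cdot> j)))"
    by (rule sum.swap)
  also have "\<dots> = (\<Sum>k\<in>bas. sw (\<lambda>i j. A k (x \<cdot> ant (ant i \<cdot> j))) k)"
    unfolding sw_def by (intro sum.cong refl sum.swap)
  also have "\<dots> = (\<Sum>k\<in>bas. cou k * A k x)"
    by (subst sw_ant_left[where f = "\<lambda>z. A k (x \<cdot> ant z)" for k]) simp_all
  also have "\<dots> = sw (\<lambda>z c. cou z * \<phi> c) x"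
    unfolding A_def by (rule sw_crd_collapse) simp
  also have "\<dots> = \<phi> x" by (simp add: sw_counit_left)
  finally show ?thesis unfolding A_def[abs_def] .
qed

text \<open>If every projection onto the integrals vanished, reconstructing the counit from them
  would give \<open>cou \<one> = 0\<close>.\<close>

lemma nonzero_integral:
  obtains \<psi> x0 where "lin \<psi>" "\<psi> x0 \<noteq> 0"
    "\<And>f x. lin f \<Longrightarrow> sw (\<lambda>a b. f a * \<psi> b) x = f \<one> * \<psi> x"
proof -
  have "\<exists>j x. integral (\<lambda>y. sw (\<lambda>a b. crd j a * cou b) y) x \<noteq> 0"
  proof (rule ccontr)
    assume "\<not> ?thesis"
    then have "cou \<one> = 0"
      using integral_reconstruct[OF lin_cou, of \<one>] by simp
    then show False by simp
  qed
  then obtain j x where "integral (\<lambda>y. sw (\<lambda>a b. crd j a * cou b) y) x \<noteq> 0" by blast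
  then show thesis
    by (intro that[of "integral (\<lambda>y. sw (\<lambda>a b. crd j a * cou b) y)"] lin_integral
        integral_left_invariant) simp_all
qed

text \<open>With S(h) = 0 the left side of the Hopf module identity for the integral \<psi> is 0,
  and left invariance of \<psi> turns its right side into \<gamma>(h_2) \<psi>(x S(h_1)). These
  values, for all x and \<gamma>, determine h.\<close>

lemma ant_eq_zero:
  assumes h: "ant h = 0" shows "prj h = 0"
proof -
  obtain \<psi> x0 where \<psi>: "lin \<psi>" and x0: "\<psi> x0 \<noteq> 0"
    and inv: "\<And>f x. lin f \<Longrightarrow> sw (\<lambda>a b. f a * \<psi> b) x = f \<one> * \<psi> x"
    by (rule nonzero_integral) blast
  note [simp] = lin_comp[OF \<psi>] \<psi> lin_prj[OF \<psi>]
  have "\<beta> h = \<beta> 0" if \<beta>: "lin \<beta>" for \<beta>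
  proof -
    note [simp] = lin_comp[OF \<beta>] \<beta> lin_prj[OF \<beta>]
    have zero: "sw (\<lambda>h1 h2. \<gamma> h2 * \<psi> (x \<cdot> ant h1)) h = 0" if \<gamma>: "lin \<gamma>" for x \<gamma>
    proof -
      note [simp] = lin_comp[OF \<gamma>] lin_prj[OF \<gamma>]
      have "\<psi> (b \<cdot> 0) = 0" for b
        using lin_scl[of "\<lambda>z. \<psi> (b \<cdot> z)" 0 0] by simp
      then have "0 = sw (\<lambda>a b. \<gamma> a * \<psi> (b \<cdot> ant h)) x"
        using h by (simp add: sw_def)
      also have "\<dots> = sw (\<lambda>h1 h2. sw (\<lambda>p q. \<gamma> (p \<cdot> h2) * \<psi> q) (x \<cdot> ant h1)) h"
        by (rule dual_hopf_module[OF \<gamma> \<psi>])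
      also have "\<dots> = sw (\<lambda>h1 h2. \<gamma> h2 * \<psi> (x \<cdot> ant h1)) h"
        by (subst inv[where f = "\<lambda>p. \<gamma> (p \<cdot> h)" for h]) simp_all
      finally show ?thesis by simp
    qed
    \<comment> \<open>Since S(h_1 S(h_2)) = S^2(h_2) S(h_1), the right side is a combination of
      terms \<gamma>(r) \<psi>(x S(h_1)) with r the remaining leg of h and x = x0 S^2(a), all of
      which vanish by \<open>zero\<close>. Expanding r in the basis separates it from its own legs a
      and b.\<close>
    have "\<psi> x0 * \<beta> h = sw (\<lambda>h1 r. sw (\<lambda>a b. \<psi> (x0 \<cdot> ant (h1 \<cdot> ant a)) * \<beta> b) r) h"
      by (subst sw_ant_right_cancel[where F = "\<lambda>z b. \<psi> (x0 \<cdot> ant z) * \<beta> b"]) simp_all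
    also have "\<dots> = sw (\<lambda>h1 r. \<Sum>l\<in>bas. crd l r * sw (\<lambda>a b. \<psi> (x0 \<cdot> ant (h1 \<cdot> ant a)) * \<beta> b) l) h"
      by (simp add: lin_collapse)
    also have "\<dots> = (\<Sum>l\<in>bas. sw (\<lambda>a b. sw (\<lambda>h1 r. crd l r * \<psi> (x0 \<cdot> ant (ant a) \<cdot> ant h1)) h * \<beta> b) l)"
      by (simp add: sw_sum sw_mult_left[symmetric] sw_mult_right[symmetric] ant_mult mult_assoc mult.assoc)
        (subst sw_swap, rule refl)
    also have "\<dots> = 0" by (simp add: zero) (simp add: sw_def)
    finally have "\<beta> h = 0" using x0 by simp
    moreover have "\<beta> 0 = 0" using lin_scl[OF \<beta>, of 0 0] by simp
    ultimately show ?thesis by simp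
  qed
  from lin_eqI[of h 0, OF this] show ?thesis by (simp add: prj_id zero_closed)
qed

lemma prj_add: "prj (x + y) = prj x + prj y"
  by (simp add: prj_def crd_add vs.scale_left_distrib sum.distrib)

lemma prj_scl: "prj (scl H c x) = scl H c (prj x)"
  by (simp add: prj_def crd_scl vs.scale_sum_right)

text \<open>A dimension count: by injectivity the image of \<open>bas\<close> is independent and as
  large as \<open>bas\<close>, so it spans the carrier.\<close>

lemma bij_betw_antipode: "bij_betw (antipode H) (carrier H) (carrier H)"
proof -
  interpret vs2: vector_space_pair "scl H" "scl H" ..
  have lin: "Vector_Spaces.linear (scl H) (scl H) ant"
    by unfold_locales (simp_all add: ant_def prj_add prj_scl linear_on_add[OF antipode_linear]
        linear_on_scl[OF antipode_linear] vs.scale_right_distrib vs.scale_left_distrib)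
  have inj: "inj_on ant (carrier H)"
  proof (rule inj_onI)
    fix x y assume xy: "x \<in> carrier H" "y \<in> carrier H" "ant x = ant y"
    have "ant (x - y) = 0"
      using vs2.linear_diff[OF lin, of x y] xy(3) by simp
    then have "x - y = 0"
      using ant_eq_zero[of "x - y"] diff_closed[OF xy(1,2)] by (simp add: prj_id)
    then show "x = y" by simp
  qed
  have indep: "vs.independent (ant ` bas)"
    using vs2.linear_independent_injective_image[OF lin bas(2)] inj bas(3) by simp
  have card: "card (ant ` bas) = card bas"
    by (rule card_image) (use inj bas_closed in \<open>auto intro: inj_on_subset\<close>)
  have closed: "ant ` carrier H \<subseteq> carrier H" by (auto simp: ant_def intro: linear_on_closed[OF antipode_linear])
  have "carrier H \<subseteq> vs.span (ant ` bas)"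
  proof
    fix y assume y: "y \<in> carrier H"
    show "y \<in> vs.span (ant ` bas)"
    proof (rule ccontr)
      assume n: "y \<notin> vs.span (ant ` bas)"
      then have "vs.independent (insert y (ant ` bas))" by (rule vs.independent_insertI) (rule indep)
      moreover have "insert y (ant ` bas) \<subseteq> vs.span bas"
        using y closed bas_closed bas(3) by auto
      ultimately have "card (insert y (ant ` bas)) \<le> card bas"
        using vs.independent_span_bound[OF bas(1)] by blast
      moreover have "y \<notin> ant ` bas" using n vs.span_base by blast
      ultimately show False using card bas(1) by simp
    qed
  qed
  also have "vs.span (ant ` bas) = ant ` carrier H"
    using vs2.linear_span_image[OF lin] bas(3) by simp
  finally have "ant ` carrier H = carrier H" using closed by blast
  with inj have "bij_betw ant (carrier H) (carrier H)" by (simp add: bij_betw_def)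
  then show ?thesis by (rule bij_betw_cong[THEN iffD1, rotated]) (simp add: ant_def prj_id)
qed

section \<open>The inverse antipode and its Sweedler rules\<close>

definition ian :: "'a \<Rightarrow> 'a" where "ian x = inv_antipode H (prj x)"

lemma inv_antipode_closed: "x \<in> carrier H \<Longrightarrow> inv_antipode H x \<in> carrier H"
  unfolding inv_antipode_def using bij_betw_antipode by (metis bij_betw_def inv_into_into)

lemma prj_ian [simp]: "prj (ian x) = ian x"
  by (simp add: ian_def prj_id inv_antipode_closed)

lemma ian_prj [simp]: "ian (prj x) = ian x" by (simp add: ian_def)

lemma ant_ian [simp]: "ant (ian x) = prj x"
  unfolding ant_def prj_ian
  using bij_betw_antipode by (simp add: ian_def inv_antipode_def bij_betw_inv_into_right)

lemma ian_ant [simp]: "ian (ant x) = prj x"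
  unfolding ian_def prj_ant
  using bij_betw_antipode by (simp add: ant_def inv_antipode_def bij_betw_inv_into_left)

lemma ian_eqI: "prj x = ant y \<Longrightarrow> ian x = prj y"
  by (metis ian_ant ian_prj)

lemma inv_antipode_linear: "linear_on H H (inv_antipode H)"
proof -
  have eq: "inv_antipode H x = ian x" if "x \<in> carrier H" for x using that by (simp add: ian_def prj_id)
  have a: "ant (ian x) = x" if "x \<in> carrier H" for x using that by (simp add: prj_id)
  show ?thesis
    unfolding linear_on_def
  proof (intro conjI ballI allI)
    fix x y assume xy: "x \<in> carrier H" "y \<in> carrier H"
    have "ant (ian x + ian y) = x + y"
      using linear_on_add[OF antipode_linear, of "ian x" "ian y"] xy a
      by (simp add: ant_def prj_add prj_id inv_antipode_closed ian_def)
    then have "ian (x + y) = ian x + ian y"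
      using ian_eqI[of "x + y" "ian x + ian y"] xy by (simp add: prj_id add_closed prj_add)
    then show "inv_antipode H (x + y) = inv_antipode H x + inv_antipode H y"
      using xy by (simp add: eq add_closed)
  next
    fix c x assume x: "x \<in> carrier H"
    have "ant (scl H c (ian x)) = scl H c x"
      using linear_on_scl[OF antipode_linear, of "ian x"] x a
      by (simp add: ant_def prj_scl prj_id inv_antipode_closed ian_def)
    then have "ian (scl H c x) = scl H c (ian x)"
      using ian_eqI[of "scl H c x" "scl H c (ian x)"] x by (simp add: prj_id scl_closed prj_scl)
    then show "inv_antipode H (scl H c x) = scl H c (inv_antipode H x)"
      using x by (simp add: eq scl_closed)
  qed (rule inv_antipode_closed)
qed

lemma lin_map_ian [simp]: "lin_map g \<Longrightarrow> lin_map (\<lambda>x. ian (g x))"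
  using lin_map_comp[OF lin_map_linear_on[OF inv_antipode_linear]] by (simp add: ian_def)

lemma ian_mult: "ian (x \<cdot> y) = ian y \<cdot> ian x"
  using ian_eqI[of "x \<cdot> y" "ian y \<cdot> ian x"] by (simp add: ant_mult)

lemma ian_one [simp]: "ian \<one> = \<one>"
  using ian_ant[of \<one>] by simp

lemma cou_ian [simp]: "cou (ian x) = cou x"
  using cou_ant[of "ian x"] by simp

lemma sw_ian:
  assumes e: "bilin e"
  shows "sw e (ian x) = sw (\<lambda>a b. e (ian b) (ian a)) x"
proof -
  note [simp] = lin_comp[OF bilin_left[OF e]] lin_comp[OF bilin_right[OF e]]
    bilin_prj_left[OF e] lin_prj[OF bilin_right[OF e]]
  have "sw (\<lambda>a b. e (ian b) (ian a)) (ant (ian x)) = sw e (ian x)"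
    by (subst sw_ant) (auto intro!: bilinI)
  then show ?thesis by simp
qed

text \<open>The antipode axioms at S^-1(h): writing h = S(S^-1(h)) and pushing the coproduct through
  S reverses the two legs and cancels one inverse antipode.\<close>

lemma
  assumes f: "lin f"
  shows sw_ian_left: "sw (\<lambda>a b. f (ian b \<cdot> a)) h = cou h * f \<one>"
    and sw_ian_right: "sw (\<lambda>a b. f (b \<cdot> ian a)) h = cou h * f \<one>"
proof -
  note [simp] = lin_comp[OF f]
  have "sw (\<lambda>a b. f (ian b \<cdot> a)) (ant (ian h)) = cou h * f \<one>"
    by (subst sw_ant) (auto intro!: bilinI simp: sw_ant_right[OF f])
  then show "sw (\<lambda>a b. f (ian b \<cdot> a)) h = cou h * f \<one>" by simp
  have "sw (\<lambda>a b. f (b \<cdot> ian a)) (ant (ian h)) = cou h * f \<one>"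
    by (subst sw_ant) (auto intro!: bilinI simp: sw_ant_left[OF f])
  then show "sw (\<lambda>a b. f (b \<cdot> ian a)) h = cou h * f \<one>" by simp
qed

end

section \<open>Linear dependence of induced maps on a parameter\<close>

lemma linear_on_scl_map:
  assumes "kspace U" shows "linear_on U U (scl U c)"
proof -
  interpret kspace U by fact
  show ?thesis by (simp add: linear_on_def scl_closed vs.scale_right_distrib mult.commute)
qed

lemma linear_on_tlift_param:
  assumes V: "kspace V" and U: "kspace U" and t: "t \<in> carrier (tensor V W)"
    and \<beta>: "\<And>v w. v \<in> carrier V \<Longrightarrow> w \<in> carrier W \<Longrightarrow> linear_on Z U (\<lambda>z. \<beta> z v w)"
  shows "linear_on Z U (\<lambda>z. tlift V W (\<beta> z) t)"
  unfolding linear_on_def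
proof (intro conjI ballI allI)
  fix z assume z: "z \<in> carrier Z"
  have c: "\<beta> z v w \<in> carrier U" if "v \<in> carrier V" "w \<in> carrier W" for v w
    by (rule linear_on_closed[OF \<beta>[OF that] z])
  show "tlift V W (\<beta> z) t \<in> carrier U" by (rule tlift_closed[OF V U t c])
  fix a
  have "scl U a (tlift V W (\<beta> z) t) = tlift V W (\<lambda>v w. scl U a (\<beta> z v w)) t"
    by (rule linear_on_tlift_apply[OF V U t _ linear_on_scl_map[OF U]]) (rule c)
  also have "\<dots> = tlift V W (\<beta> (scl Z a z)) t"
    by (rule tlift_cong[OF V t]) (simp add: linear_on_scl[OF \<beta> z])
  finally show "tlift V W (\<beta> (scl Z a z)) t = scl U a (tlift V W (\<beta> z) t)" by simp
next
  fix y z assume yz: "y \<in> carrier Z" "z \<in> carrier Z"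
  show "tlift V W (\<beta> (y + z)) t = tlift V W (\<beta> y) t + tlift V W (\<beta> z) t"
    unfolding tlift_add[symmetric] by (rule tlift_cong[OF V t]) (rule linear_on_add[OF \<beta> yz])
qed

lemma linear_on_mult_left: "linear_on Z scalars f \<Longrightarrow> linear_on Z scalars (\<lambda>z. c * f z)"
  and linear_on_mult_right: "linear_on Z scalars f \<Longrightarrow> linear_on Z scalars (\<lambda>z. f z * c)"
  by (auto simp: linear_on_def scalars_def algebra_simps)

lemma linear_on_sum_functions:
  "(\<And>i. i \<in> I \<Longrightarrow> linear_on Z scalars (f i)) \<Longrightarrow> linear_on Z scalars (\<lambda>z. \<Sum>i\<in>I. f i z)"
  by (simp add: linear_on_def scalars_def sum.distrib sum_distrib_left)

lemma scl_tensor: "scl (tensor V W) = fscale" by (simp add: tensor_def)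

context fd_hopf_algebra
begin

section \<open>The dual Hopf algebra\<close>

abbreviation Hd where "Hd \<equiv> dual_hopf H"

text \<open>Elements of \<open>carrier Hd\<close> vanish off the carrier of H, whereas functionals
  satisfying \<open>lin\<close> are constant on the fibres of \<open>prj\<close>. \<open>ext\<close>
  and \<open>res\<close> translate between these two ways of fixing the values off the
  carrier.\<close>

definition ext :: "('a \<Rightarrow> 'k) \<Rightarrow> 'a \<Rightarrow> 'k" where "ext \<phi> = (\<lambda>x. \<phi> (prj x))"

definition res :: "('a \<Rightarrow> 'k) \<Rightarrow> 'a \<Rightarrow> 'k" where "res f = zero_ext H f"

lemma carrier_dual: "carrier Hd = {\<phi>. linear_on H scalars \<phi> \<and> zero_ext H \<phi> = \<phi>}"
  and scl_dual [simp]: "scl Hd = fscale"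
  by (simp_all add: dual_hopf_def dual_space_def)

lemma lin_ext [simp]: "\<phi> \<in> carrier Hd \<Longrightarrow> lin (ext \<phi>)"
  unfolding ext_def by (intro lin_linear_on) (simp add: carrier_dual)

lemma lin_ext_comp [simp]: "\<phi> \<in> carrier Hd \<Longrightarrow> lin_map g \<Longrightarrow> lin (\<lambda>x. ext \<phi> (g x))"
  by (rule lin_comp[OF lin_ext])

lemma ext_prj [simp]: "ext \<phi> (prj x) = ext \<phi> x" by (simp add: ext_def)

lemma ext_eq: "x \<in> carrier H \<Longrightarrow> ext \<phi> x = \<phi> x" by (simp add: ext_def prj_id)

lemma dual_eqI: "\<phi> \<in> carrier Hd \<Longrightarrow> \<psi> \<in> carrier Hd \<Longrightarrow> (\<And>x. ext \<phi> x = ext \<psi> x) \<Longrightarrow> \<phi> = \<psi>"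
  by (rule ext, simp add: carrier_dual) (metis ext_eq zero_ext_def)

lemma res_closed [simp]: "lin f \<Longrightarrow> res f \<in> carrier Hd"
  using linear_on_lin[of f]
  by (auto simp: carrier_dual res_def zero_ext_def linear_on_def add_closed scl_closed)

lemma ext_res [simp]: "lin f \<Longrightarrow> ext (res f) = f"
  by (rule HOL.ext) (simp add: ext_def res_def zero_ext_def lin_prj)

lemma ext_add: "ext (\<phi> + \<psi>) x = ext \<phi> x + ext \<psi> x" and ext_fscale: "ext (fscale c \<phi>) x = c * ext \<phi> x"
  by (simp_all add: ext_def fscale_def)

lemma linear_ext: "linear_on Hd scalars (\<lambda>\<phi>. ext \<phi> x)"
  by (simp add: linear_on_def scalars_def ext_add ext_fscale)

lemma kspace_dual: "kspace Hd"
proof (rule kspace.intro)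
  interpret F: vector_space "fscale :: 'k \<Rightarrow> ('a \<Rightarrow> 'k) \<Rightarrow> _" by (rule vector_space_fscale)
  show "vector_space (scl Hd)" by (simp add: F.vector_space_axioms)
  have zero: "zero_ext H \<phi> = \<phi> \<longleftrightarrow> (\<forall>x. x \<notin> carrier H \<longrightarrow> \<phi> x = 0)" for \<phi> :: "'a \<Rightarrow> 'k"
    by (auto simp: zero_ext_def fun_eq_iff)
  show "module.subspace (scl Hd) (carrier Hd)"
    by (rule F.subspaceI[folded scl_dual])
      (auto simp: carrier_dual linear_on_def scalars_def zero fscale_def algebra_simps)
qed

lemma mul_dual_closed: "\<phi> \<in> carrier Hd \<Longrightarrow> \<psi> \<in> carrier Hd \<Longrightarrow> mul Hd \<phi> \<psi> \<in> carrier Hd"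
  and ext_mul_dual: "\<phi> \<in> carrier Hd \<Longrightarrow> \<psi> \<in> carrier Hd \<Longrightarrow>
    ext (mul Hd \<phi> \<psi>) x = sw (\<lambda>a b. ext \<phi> a * ext \<psi> b) x"
proof -
  assume \<phi>: "\<phi> \<in> carrier Hd" and \<psi>: "\<psi> \<in> carrier Hd"
  have "sw2 H (\<lambda>a b. \<phi> a * \<psi> b) h = sw (\<lambda>a b. ext \<phi> a * ext \<psi> b) h" if h: "h \<in> carrier H" for h
  proof -
    have "sw2 H (\<lambda>a b. \<phi> a * \<psi> b) h = sw2 H (\<lambda>a b. ext \<phi> a * ext \<psi> b) h"
      unfolding sw2_def by (rule tlift_cong[OF kspace_H comul_closed[OF h]]) (simp add: ext_eq)
    also have "\<dots> = sw (\<lambda>a b. ext \<phi> a * ext \<psi> b) h"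
      using \<phi> \<psi> h by (intro sw2_sw bilinear_on_bilin bilinI) simp_all
    finally show ?thesis .
  qed
  then have *: "mul Hd \<phi> \<psi> = res (sw (\<lambda>a b. ext \<phi> a * ext \<psi> b))"
    by (auto simp: dual_hopf_def res_def zero_ext_def fun_eq_iff)
  show "mul Hd \<phi> \<psi> \<in> carrier Hd" by (simp add: *)
  show "ext (mul Hd \<phi> \<psi>) x = sw (\<lambda>a b. ext \<phi> a * ext \<psi> b) x" by (simp add: *)
qed

lemma unit_dual: "unit Hd = res cou"
  by (simp add: dual_hopf_def res_def zero_ext_def cou_def prj_id fun_eq_iff)

lemma bilinear_ext: "bilinear_on Hd Hd scalars (\<lambda>\<phi> \<psi>. ext \<phi> a * ext \<psi> b)"
  by (intro bilinear_on_mult linear_ext)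

lemma dual_tensor_eqI:
  assumes "s \<in> carrier (tensor Hd Hd)" "t \<in> carrier (tensor Hd Hd)"
    and "\<And>a b. tlift Hd Hd (\<lambda>\<phi>1 \<phi>2. ext \<phi>1 a * ext \<phi>2 b) s = tlift Hd Hd (\<lambda>\<phi>1 \<phi>2. ext \<phi>1 a * ext \<phi>2 b) t"
  shows "s = t"
proof (rule tensor_eqI_separating[OF kspace_dual kspace_dual assms(1,2)])
  let ?P = "range (\<lambda>x \<phi>. ext \<phi> x)"
  have sep: "\<phi> = 0" if "\<phi> \<in> carrier Hd" "\<And>f. f \<in> ?P \<Longrightarrow> f \<phi> = 0" for \<phi>
    by (rule dual_eqI[OF that(1) kspace.zero_closed[OF kspace_dual]])
      (use that(2) in \<open>auto simp: ext_def\<close>)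
  show "\<phi> = 0" if "\<phi> \<in> carrier Hd" "\<And>f. f \<in> ?P \<Longrightarrow> f \<phi> = 0" for \<phi> using that by (rule sep)
  show "\<phi> = 0" if "\<phi> \<in> carrier Hd" "\<And>f. f \<in> ?P \<Longrightarrow> f \<phi> = 0" for \<phi> using that by (rule sep)
qed (use assms(3) linear_ext in auto)

text \<open>The description by THE in \<open>dual_hopf\<close> is met by the tensor with
  coefficients \<phi>(i j) in the dual basis \<open>res (crd i)\<close>. Its uniqueness holds
  because point evaluations separate the tensors over the dual.\<close>

lemma
  assumes \<phi>: "\<phi> \<in> carrier Hd"
  shows comul_dual_closed: "comul Hd \<phi> \<in> carrier (tensor Hd Hd)"
    and comul_dual: "tlift Hd Hd (\<lambda>\<phi>1 \<phi>2. ext \<phi>1 a * ext \<phi>2 b) (comul Hd \<phi>) = ext \<phi> (a \<cdot> b)"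
proof -
  let ?T = "tensor Hd Hd"
  interpret T: kspace ?T by (rule kspace_tensor)
  define t where "t = (\<Sum>i\<in>bas. \<Sum>j\<in>bas. scl ?T (ext \<phi> (i \<cdot> j)) (pure Hd Hd (res (crd i)) (res (crd j))))"
  have pc: "pure Hd Hd (res (crd i)) (res (crd j)) \<in> carrier ?T" for i j by (intro pure_closed) simp_all
  have t: "t \<in> carrier ?T" unfolding t_def by (intro T.sum_closed T.scl_closed pc)
  have tt: "tlift Hd Hd (\<lambda>\<phi>1 \<phi>2. ext \<phi>1 a * ext \<phi>2 b) t = ext \<phi> (a \<cdot> b)" for a b
  proof -
    let ?L = "tlift Hd Hd (\<lambda>\<phi>1 \<phi>2. ext \<phi>1 a * ext \<phi>2 b)"
    have L: "linear_on ?T scalars ?L"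
      by (rule linear_on_tlift[OF kspace_dual kspace_scalars bilinear_ext])
    have "?L t = (\<Sum>i\<in>bas. \<Sum>j\<in>bas. ext \<phi> (i \<cdot> j) * ?L (pure Hd Hd (res (crd i)) (res (crd j))))"
      unfolding t_def
      by (subst linear_on_sum[OF kspace_tensor L], intro T.sum_closed T.scl_closed pc,
          subst linear_on_sum[OF kspace_tensor L], intro T.scl_closed pc,
          subst linear_on_scl[OF L pc]) (simp add: scalars_def)
    also have "\<dots> = (\<Sum>i\<in>bas. \<Sum>j\<in>bas. ext \<phi> (i \<cdot> j) * (crd i a * crd j b))"
      by (simp add: tlift_pure[OF kspace_dual kspace_scalars bilinear_ext])
    also have "\<dots> = (\<Sum>i\<in>bas. crd i a * (\<Sum>j\<in>bas. crd j b * ext \<phi> (i \<cdot> j)))"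
      by (simp add: sum_distrib_left mult_ac)
    also have "\<dots> = ext \<phi> (a \<cdot> b)"
      using \<phi> by (simp add: lin_collapse[where f = "\<lambda>j. ext \<phi> (i \<cdot> j)" for i]
          lin_collapse[where f = "\<lambda>i. ext \<phi> (i \<cdot> b)"])
    finally show ?thesis .
  qed
  let ?Q = "\<lambda>t. t \<in> carrier (tensor (dual_space H) (dual_space H)) \<and>
      (\<forall>a\<in>carrier H. \<forall>b\<in>carrier H.
        tlift (dual_space H) (dual_space H) (\<lambda>\<phi>1 \<phi>2. \<phi>1 a * \<phi>2 b) t = \<phi> (mul H a b))"
  \<comment> \<open>The definition of the coproduct refers to tensors over
    \<open>dual_space H\<close>. That record has the carrier and the scalars of \<open>Hd\<close>,
    so all tensor notions coincide.\<close>
  have bl: "bilinear_on (dual_space H) (dual_space H) = bilinear_on Hd Hd"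
    by (simp add: bilinear_on_def[abs_def] linear_on_def dual_hopf_def)
  have pu: "pure (dual_space H) (dual_space H) = pure Hd Hd"
    unfolding pure_def[abs_def] by (simp add: bl)
  have ca: "carrier (dual_space H) = carrier Hd" by (simp add: dual_hopf_def)
  have te: "tensor (dual_space H) (dual_space H) = ?T" by (simp add: tensor_def pu ca)
  have tl: "tlift (dual_space H) (dual_space H) = tlift Hd Hd"
    by (simp add: tlift_def[abs_def] pu ca)
  have Q: "?Q s \<longleftrightarrow> s \<in> carrier ?T \<and>
      (\<forall>a b. tlift Hd Hd (\<lambda>\<phi>1 \<phi>2. ext \<phi>1 a * ext \<phi>2 b) s = ext \<phi> (a \<cdot> b))" for s
  proof -
    have "(\<forall>a\<in>carrier H. \<forall>b\<in>carrier H. tlift Hd Hd (\<lambda>\<phi>1 \<phi>2. \<phi>1 a * \<phi>2 b) s = \<phi> (mul H a b)) \<longleftrightarrow>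
        (\<forall>a b. tlift Hd Hd (\<lambda>\<phi>1 \<phi>2. ext \<phi>1 a * ext \<phi>2 b) s = ext \<phi> (a \<cdot> b))" (is "?l \<longleftrightarrow> ?r")
    proof
      assume ?l
      then have "tlift Hd Hd (\<lambda>\<phi>1 \<phi>2. \<phi>1 (prj a) * \<phi>2 (prj b)) s = \<phi> (mul H (prj a) (prj b))" for a b
        by simp
      then show ?r
        using bilinear_on_closed[OF mul_bilinear] by (simp add: ext_def mult_def prj_id)
    next
      assume r: ?r
      show ?l
      proof (intro ballI)
        fix a b assume "a \<in> carrier H" "b \<in> carrier H"
        then show "tlift Hd Hd (\<lambda>\<phi>1 \<phi>2. \<phi>1 a * \<phi>2 b) s = \<phi> (mul H a b)"
          using r[rule_format, of a b] bilinear_on_closed[OF mul_bilinear]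
          by (simp add: ext_def mult_def prj_id)
      qed
    qed
    then show ?thesis by (simp add: te tl)
  qed
  have "comul Hd \<phi> = (THE s. ?Q s)" by (simp add: dual_hopf_def)
  also have "\<dots> = t"
    unfolding Q by (rule the_equality) (use t tt dual_tensor_eqI in auto)
  finally have "comul Hd \<phi> = t" .
  then show "comul Hd \<phi> \<in> carrier (tensor Hd Hd)"
    and "tlift Hd Hd (\<lambda>\<phi>1 \<phi>2. ext \<phi>1 a * ext \<phi>2 b) (comul Hd \<phi>) = ext \<phi> (a \<cdot> b)"
    using t tt by simp_all
qed

lemma comul_dual_linear: "linear_on Hd (tensor Hd Hd) (comul Hd)"
proof -
  interpret T: kspace "tensor Hd Hd" by (rule kspace_tensor)
  interpret D: kspace Hd by (rule kspace_dual)
  have L: "linear_on (tensor Hd Hd) scalars (tlift Hd Hd (\<lambda>\<phi>1 \<phi>2. ext \<phi>1 a * ext \<phi>2 b))" for a b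
    by (rule linear_on_tlift[OF kspace_dual kspace_scalars bilinear_ext])
  show ?thesis
    unfolding linear_on_def
  proof (intro conjI ballI allI)
    fix \<phi> \<psi> assume "\<phi> \<in> carrier Hd" "\<psi> \<in> carrier Hd"
    then show "comul Hd (\<phi> + \<psi>) = comul Hd \<phi> + comul Hd \<psi>"
      by (intro dual_tensor_eqI)
        (simp_all add: comul_dual_closed D.add_closed T.add_closed linear_on_add[OF L] comul_dual ext_add)
  next
    fix c \<phi> assume \<phi>: "\<phi> \<in> carrier Hd"
    have "fscale c \<phi> \<in> carrier Hd" using D.scl_closed[OF \<phi>] by simp
    then show "comul Hd (scl Hd c \<phi>) = scl (tensor Hd Hd) c (comul Hd \<phi>)"
      using \<phi> by (intro dual_tensor_eqI)
        (simp_all add: comul_dual_closed T.scl_closed linear_on_scl[OF L] comul_dual ext_fscale,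
          simp add: scalars_def)
  qed (rule comul_dual_closed)
qed

subsection \<open>Interchanging finite sums\<close>

lemma tlift_sw:
  "tlift V W (\<lambda>v w. sw (\<lambda>a b. e v w a b) h) t = sw (\<lambda>a b. tlift V W (\<lambda>v w. e v w a b) t) h"
  unfolding sw_def by (simp only: tlift_sum tlift_mult_left)

lemma lin_tlift:
  assumes V: "kspace V" and t: "t \<in> carrier (tensor V W)"
    and e: "\<And>v w. v \<in> carrier V \<Longrightarrow> w \<in> carrier W \<Longrightarrow> lin (\<lambda>x. e x v w)"
  shows "lin (\<lambda>x. tlift V W (e x) t)"
  unfolding lin_def
proof
  fix x
  have "tlift V W (e x) t = tlift V W (\<lambda>v w. \<Sum>b\<in>bas. crd b x * e b v w) t"
    by (rule tlift_cong[OF V t]) (rule lin_expand[OF e])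
  then show "tlift V W (e x) t = (\<Sum>b\<in>bas. crd b x * tlift V W (e b) t)"
    by (simp only: tlift_sum tlift_mult_left)
qed

lemma linear_on_sw:
  "(\<And>a b. linear_on Z scalars (\<lambda>z. e z a b)) \<Longrightarrow> linear_on Z scalars (\<lambda>z. sw (\<lambda>a b. e z a b) h)"
  unfolding sw_def by (intro linear_on_sum_functions linear_on_mult_left) auto

text \<open>Passes from the left-nested \<open>sw3\<close>, whose argument e is controlled on the
  carrier only, to right-nested sums with a total version f of e.\<close>

lemma sw3_sw:
  assumes e: "\<And>a b c. a \<in> carrier H \<Longrightarrow> b \<in> carrier H \<Longrightarrow> c \<in> carrier H \<Longrightarrow> e a b c = f a b c"
    and f: "\<And>b c. lin (\<lambda>a. f a b c)" "\<And>a c. lin (\<lambda>b. f a b c)" "\<And>a b. lin (f a b)"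
    and h: "h \<in> carrier H"
  shows "sw3 H e h = sw (\<lambda>h1 r. sw (\<lambda>h2 h3. f h1 h2 h3) r) h"
proof -
  have "sw3 H e h = sw2 H (\<lambda>x c. sw (\<lambda>a b. f a b c) x) h"
    unfolding sw3_def
  proof (subst (1 3) sw2_def, rule tlift_cong[OF kspace_H comul_closed[OF h]])
    fix x c assume x: "x \<in> carrier H" and c: "c \<in> carrier H"
    have "sw2 H (\<lambda>a b. e a b c) x = sw2 H (\<lambda>a b. f a b c) x"
      unfolding sw2_def by (rule tlift_cong[OF kspace_H comul_closed[OF x]]) (simp add: e c)
    also have "\<dots> = sw (\<lambda>a b. f a b c) x"
      using f x by (intro sw2_sw bilinear_on_bilin bilinI)
    finally show "sw2 H (\<lambda>a b. e a b c) x = sw (\<lambda>a b. f a b c) x" .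
  qed
  also have "\<dots> = sw (\<lambda>x c. sw (\<lambda>a b. f a b c) x) h"
    using f h by (intro sw2_sw bilinear_on_bilin bilinI) simp_all
  finally show ?thesis by (simp only: sw_coassoc)
qed

lemma sw3_dual:
  assumes "\<phi> \<in> carrier Hd"
  shows "sw3 Hd (\<lambda>\<phi>1 \<phi>2 \<phi>3. ext \<phi>1 a * ext \<phi>2 b * ext \<phi>3 c) \<phi> = ext \<phi> (a \<cdot> b \<cdot> c)"
proof -
  have "sw3 Hd (\<lambda>\<phi>1 \<phi>2 \<phi>3. ext \<phi>1 a * ext \<phi>2 b * ext \<phi>3 c) \<phi> =
      tlift Hd Hd (\<lambda>\<chi> \<phi>3. ext \<chi> (a \<cdot> b) * ext \<phi>3 c) (comul Hd \<phi>)"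
    unfolding sw3_def sw2_def
    by (rule tlift_cong[OF kspace_dual comul_dual_closed[OF assms]])
      (simp add: tlift_mult_right comul_dual)
  then show ?thesis using assms by (simp add: comul_dual)
qed

lemma sw3_linear_apply:
  assumes C: "kspace C" and U: "kspace U" and com: "\<And>x. x \<in> carrier C \<Longrightarrow> comul C x \<in> carrier (tensor C C)"
    and e: "\<And>a b c. a \<in> carrier C \<Longrightarrow> b \<in> carrier C \<Longrightarrow> c \<in> carrier C \<Longrightarrow> e a b c \<in> carrier U"
    and x: "x \<in> carrier C"
  shows sw3_closed: "sw3 C e x \<in> carrier U"
    and "linear_on U U' L \<Longrightarrow> L (sw3 C e x) = sw3 C (\<lambda>a b c. L (e a b c)) x"
proof -
  have i: "tlift C C (\<lambda>a b. e a b c) (comul C y) \<in> carrier U"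
    if "y \<in> carrier C" "c \<in> carrier C" for y c
    using that e by (intro tlift_closed[OF C U com])
  then show "sw3 C e x \<in> carrier U"
    unfolding sw3_def sw2_def by (intro tlift_closed[OF C U com[OF x]])
  assume L: "linear_on U U' L"
  show "L (sw3 C e x) = sw3 C (\<lambda>a b c. L (e a b c)) x"
    unfolding sw3_def sw2_def
    by (subst linear_on_tlift_apply[OF C U com[OF x] _ L], erule (1) i,
        rule tlift_cong[OF C com[OF x]], rule linear_on_tlift_apply[OF C U com _ L])
      (simp_all add: e)
qed

section \<open>The twisted double\<close>

abbreviation DS where "DS \<equiv> double_space H"

lemma kspace_DS: "kspace DS" by (simp add: double_space_def kspace_tensor)

lemma scl_DS: "scl DS = fscale" by (simp add: double_space_def scl_tensor)

lemma dpure_closed: "\<phi> \<in> carrier Hd \<Longrightarrow> h \<in> carrier H \<Longrightarrow> dpure H \<phi> h \<in> carrier DS"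
  unfolding double_space_def by (rule pure_closed)

text \<open>The pairing of H* \<otimes> H with H \<otimes> H*. Since \<alpha> may be any function,
  sums and scalars move in and out of that slot without side conditions, as in \<open>ev_sw\<close>
  and \<open>ev_mult_left\<close>.\<close>

definition ev :: "('k, 'a \<Rightarrow> 'k, 'a) tens \<Rightarrow> 'a \<Rightarrow> ('a \<Rightarrow> 'k) \<Rightarrow> 'k" where
  "ev t x \<alpha> = tlift Hd H (\<lambda>\<phi> h. ext \<phi> x * \<alpha> h) t"

lemma bilinear_ev: "lin \<alpha> \<Longrightarrow> bilinear_on Hd H scalars (\<lambda>\<phi> h. ext \<phi> x * \<alpha> h)"
  by (intro bilinear_on_mult linear_ext linear_on_lin)

lemma linear_ev: "lin \<alpha> \<Longrightarrow> linear_on DS scalars (\<lambda>t. ev t x \<alpha>)"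
  unfolding ev_def double_space_def
  by (rule linear_on_tlift[OF kspace_dual kspace_scalars bilinear_ev])

lemma ev_add: "lin \<alpha> \<Longrightarrow> s \<in> carrier DS \<Longrightarrow> t \<in> carrier DS \<Longrightarrow> ev (s + t) x \<alpha> = ev s x \<alpha> + ev t x \<alpha>"
  by (rule linear_on_add[OF linear_ev])

lemma ev_fscale: "lin \<alpha> \<Longrightarrow> t \<in> carrier DS \<Longrightarrow> ev (fscale c t) x \<alpha> = c * ev t x \<alpha>"
  using linear_on_scl[OF linear_ev] by (simp add: scl_DS scalars_def)

lemma lin_0: "lin f \<Longrightarrow> f 0 = 0"
  using lin_scl[of f 0 0] by simp

lemma ev_pure: "lin \<alpha> \<Longrightarrow> \<phi> \<in> carrier Hd \<Longrightarrow> h \<in> carrier H \<Longrightarrow> ev (dpure H \<phi> h) x \<alpha> = ext \<phi> x * \<alpha> h"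
  unfolding ev_def by (rule tlift_pure[OF kspace_dual kspace_scalars bilinear_ev])

lemma ev_prj [simp]: "ev t (prj x) \<alpha> = ev t x \<alpha>" by (simp add: ev_def)

lemma lin_ev [simp]: "t \<in> carrier DS \<Longrightarrow> lin (\<lambda>x. ev t x \<alpha>)"
  unfolding ev_def double_space_def by (rule lin_tlift[OF kspace_dual]) simp_all

lemma lin_ev_comp [simp]: "t \<in> carrier DS \<Longrightarrow> lin_map g \<Longrightarrow> lin (\<lambda>x. ev t (g x) \<alpha>)"
  by (rule lin_comp[OF lin_ev])

lemma lin_ev_inner [simp]:
  "t \<in> carrier DS \<Longrightarrow> (\<And>g. lin (\<lambda>z. \<theta> z g)) \<Longrightarrow> lin (\<lambda>z. ev t x (\<lambda>g. \<theta> z g))"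
  unfolding ev_def double_space_def by (rule lin_tlift[OF kspace_dual]) simp_all

lemma ev_sw: "ev t x (\<lambda>g. sw (\<lambda>a b. \<theta> g a b) h) = sw (\<lambda>a b. ev t x (\<lambda>g. \<theta> g a b)) h"
  unfolding ev_def by (simp only: tlift_sw[symmetric] sw_mult_left[symmetric])

lemma ev_mult_left: "ev t x (\<lambda>g. c * \<theta> g) = c * ev t x \<theta>"
  unfolding ev_def by (simp add: tlift_mult_left[symmetric] mult.left_commute)

lemma ev_mult_right: "ev t x (\<lambda>g. \<theta> g * c) = ev t x \<theta> * c"
  unfolding ev_def by (simp add: tlift_mult_right[symmetric] mult.assoc)

lemma DS_separating:
  assumes t: "t \<in> carrier DS" and z: "\<And>x \<alpha>. lin \<alpha> \<Longrightarrow> ev t x \<alpha> = 0"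
  shows "t = 0"
proof -
  let ?P = "range (\<lambda>x \<phi>. ext \<phi> x)" and ?Q = "Collect lin"
  have t': "t \<in> carrier (tensor Hd H)" using t by (simp add: double_space_def)
  show ?thesis
  proof (rule tensor_eqI_separating[OF kspace_dual kspace_H t' kspace.zero_closed[OF kspace_tensor],
        of ?P ?Q])
    show "\<phi> = 0" if "\<phi> \<in> carrier Hd" "\<And>f. f \<in> ?P \<Longrightarrow> f \<phi> = 0" for \<phi>
      by (rule dual_eqI[OF that(1) kspace.zero_closed[OF kspace_dual]])
        (use that(2) in \<open>auto simp: ext_def\<close>)
    show "h = 0" if "h \<in> carrier H" "\<And>f. f \<in> ?Q \<Longrightarrow> f h = 0" for h
    proof -
      have "prj h = prj 0" by (rule lin_eqI) (simp add: that(2) lin_0)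
      then show ?thesis using that(1) by (simp add: prj_id zero_closed)
    qed
    show "tlift Hd H (\<lambda>v w. f v * g w) t = tlift Hd H (\<lambda>v w. f v * g w) 0" if "f \<in> ?P" "g \<in> ?Q" for f g
    proof -
      have "ev 0 x g = 0" for x
        using linear_on_zero[OF kspace_DS linear_ev] that(2) by simp
      then show ?thesis using that z by (auto simp: ev_def)
    qed
  qed (auto intro: linear_ext linear_on_lin)
qed

lemma ev_eqI:
  assumes "s \<in> carrier DS" "t \<in> carrier DS" "\<And>x \<alpha>. lin \<alpha> \<Longrightarrow> ev s x \<alpha> = ev t x \<alpha>"
  shows "s = t"
proof -
  interpret D: kspace DS by (rule kspace_DS)
  have "s - t = 0"
    using assms by (intro DS_separating D.diff_closed) (simp_all add: linear_on_diff[OF kspace_DS linear_ev])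
  then show ?thesis by simp
qed

text \<open>Evaluations separate points of \<open>DS\<close>, so linearity can be read off from
  scalar formulas such as \<open>ev_pprod\<close>.\<close>

lemma linear_on_DS:
  assumes Z: "kspace Z" and c: "\<And>z. z \<in> carrier Z \<Longrightarrow> f z \<in> carrier DS"
    and l: "\<And>x \<alpha>. lin \<alpha> \<Longrightarrow> linear_on Z scalars (\<lambda>z. ev (f z) x \<alpha>)"
  shows "linear_on Z DS f"
proof -
  interpret Z: kspace Z by fact
  interpret D: kspace DS by (rule kspace_DS)
  show ?thesis
    unfolding linear_on_def
    by (intro conjI ballI allI c ev_eqI Z.add_closed Z.scl_closed D.add_closed D.scl_closed)
      (simp_all add: c ev_add linear_on_add[OF l] linear_on_scl[OF l] scl_DS ev_fscale,
        simp_all add: scalars_def)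
qed

text \<open>The last clause is compatibility with the coproduct, tested on bilinear forms. The
  \<open>prj\<close> keep T from being applied off the carrier, where its values are
  arbitrary.\<close>

definition hopf_endo :: "('a \<Rightarrow> 'a) \<Rightarrow> bool" where
  "hopf_endo T \<longleftrightarrow> linear_on H H T \<and> (\<forall>x y. T (x \<cdot> y) = T (prj x) \<cdot> T (prj y)) \<and> T \<one> = \<one> \<and>
     (\<forall>x. cou (T (prj x)) = cou x) \<and>
     (\<forall>e x. bilin e \<longrightarrow> sw e (T (prj x)) = sw (\<lambda>a b. e (T (prj a)) (T (prj b))) x)"

lemma hopf_endo_id: "hopf_endo (\<lambda>h. h)"
proof -
  have "sw e x = sw (\<lambda>a b. e (prj a) (prj b)) x" if "bilin e" for e x
    using that by (simp add: bilin_prj_left lin_prj[OF bilin_right])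
  then show ?thesis by (simp add: hopf_endo_def linear_on_def)
qed

text \<open>S reverses both products and coproducts, so its square preserves both.\<close>

lemma hopf_endo_antipode_sq: "hopf_endo (\<lambda>h. antipode H (antipode H h))"
proof -
  have a: "antipode H (antipode H (prj x)) = ant (ant x)" for x
    by (metis ant_def prj_ant)
  have m: "antipode H (antipode H (x \<cdot> y)) = ant (ant x) \<cdot> ant (ant y)" for x y
    using a[of "x \<cdot> y"] by (simp add: ant_mult)
  have "sw e (ant (ant x)) = sw (\<lambda>a b. e (ant (ant a)) (ant (ant b))) x" if e: "bilin e" for e x
  proof -
    note [simp] = lin_comp[OF bilin_left[OF e]] lin_comp[OF bilin_right[OF e]]
    have "bilin (\<lambda>a b. e (ant b) (ant a))" by (rule bilinI) simp_all
    then show ?thesis by (simp add: sw_ant e)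
  qed
  then show ?thesis
    using linear_on_comp[OF antipode_linear antipode_linear] a[of \<one>]
    by (simp add: hopf_endo_def a m)
qed

definition tw :: "('a \<Rightarrow> 'a) \<Rightarrow> 'a \<Rightarrow> 'a" where "tw T x = T (prj x)"

lemma tw_id [simp]: "tw (\<lambda>h. h) x = prj x" by (simp add: tw_def)

lemma tw_prj [simp]: "tw T (prj x) = tw T x" by (simp add: tw_def)

context
  fixes T :: "'a \<Rightarrow> 'a"
  assumes T: "hopf_endo T"
begin

lemma lin_map_tw [simp]: "lin_map g \<Longrightarrow> lin_map (\<lambda>x. tw T (g x))"
  using lin_map_comp[OF lin_map_linear_on] T by (simp add: hopf_endo_def tw_def)

lemma prj_tw [simp]: "prj (tw T x) = tw T x"
  using T by (auto simp: hopf_endo_def tw_def intro!: prj_id linear_on_closed[of H H T])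

lemma tw_mult: "tw T (x \<cdot> y) = tw T x \<cdot> tw T y"
  using T by (simp add: hopf_endo_def tw_def)

lemma tw_one [simp]: "tw T \<one> = \<one>"
  using T by (simp add: hopf_endo_def tw_def)

lemma cou_tw [simp]: "cou (tw T x) = cou x"
  using T by (simp add: hopf_endo_def tw_def)

lemma sw_tw: "bilin e \<Longrightarrow> sw e (tw T x) = sw (\<lambda>a b. e (tw T a) (tw T b)) x"
  using T by (simp add: hopf_endo_def tw_def)

text \<open>The coproduct is multiplicative, S^-1 reverses it and T preserves it; hence the first
  tensor leg carries c_2 and d_1, the second c_1 and d_2.\<close>

lemma sw_conjugate:
  assumes e: "bilin e"
  shows "sw e (ian c \<cdot> z \<cdot> tw T d) =
    sw (\<lambda>b b'. sw (\<lambda>c1 c2. sw (\<lambda>d1 d2. e (ian c2 \<cdot> b \<cdot> tw T d1) (ian c1 \<cdot> b' \<cdot> tw T d2)) d) c) z"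
proof -
  note [simp] = lin_comp[OF bilin_left[OF e]] lin_comp[OF bilin_right[OF e]]
    bilin_left[OF e] bilin_right[OF e]
  have "sw e (ian c \<cdot> z \<cdot> tw T d) = sw (\<lambda>a b. sw (\<lambda>d1 d2. e (a \<cdot> d1) (b \<cdot> d2)) (tw T d)) (ian c \<cdot> z)"
    by (rule sw_mult[OF e])
  also have "\<dots> = sw (\<lambda>c1 c2. sw (\<lambda>b b'. sw (\<lambda>d1 d2.
      e (c1 \<cdot> b \<cdot> d1) (c2 \<cdot> b' \<cdot> d2)) (tw T d)) z) (ian c)"
    by (subst sw_mult) (auto intro!: bilinI)
  also have "\<dots> = sw (\<lambda>c1 c2. sw (\<lambda>b b'. sw (\<lambda>d1 d2.
      e (ian c2 \<cdot> b \<cdot> d1) (ian c1 \<cdot> b' \<cdot> d2)) (tw T d)) z) c"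
    by (subst sw_ian) (auto intro!: bilinI)
  also have "\<dots> = sw (\<lambda>c1 c2. sw (\<lambda>b b'. sw (\<lambda>d1 d2.
      e (ian c2 \<cdot> b \<cdot> tw T d1) (ian c1 \<cdot> b' \<cdot> tw T d2)) d) z) c"
    by (subst sw_tw) (auto intro!: bilinI)
  also have "\<dots> = sw (\<lambda>b b'. sw (\<lambda>c1 c2. sw (\<lambda>d1 d2.
      e (ian c2 \<cdot> b \<cdot> tw T d1) (ian c1 \<cdot> b' \<cdot> tw T d2)) d) c) z"
    by (rule sw_swap)
  finally show ?thesis .
qed

abbreviation dmul where "dmul \<equiv> double_mul H T"

definition pprod where
  "pprod \<phi> h \<psi> g = sw3 Hd (\<lambda>\<psi>1 \<psi>2 \<psi>3. sw3 H (\<lambda>h1 h2 h3.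
     fscale (\<psi>1 (inv_antipode H h3) * \<psi>3 (T h1)) (dpure H (mul Hd \<phi> \<psi>2) (mul H h2 g))) h) \<psi>"

lemma double_mul_pprod: "dmul x y = tlift Hd H (\<lambda>\<phi> h. tlift Hd H (pprod \<phi> h) y) x"
  by (simp add: double_mul_def pprod_def[abs_def])

text \<open>The legs of \<psi> recombine: \<psi>_1(S^-1(h_3)) \<psi>_2(x_2) \<psi>_3(T(h_1)) =
  \<psi>(S^-1(h_3) x_2 T(h_1)), where x_2 is the leg of x that the convolution of \<phi> with
  \<psi>_2 hands to \<psi>_2. This removes the coproduct of the dual from all later
  computations.\<close>

lemma
  assumes \<phi>: "\<phi> \<in> carrier Hd" and h: "h \<in> carrier H" and \<psi>: "\<psi> \<in> carrier Hd" and g: "g \<in> carrier H"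
  shows pprod_closed: "pprod \<phi> h \<psi> g \<in> carrier DS"
    and ev_pprod: "lin \<alpha> \<Longrightarrow> ev (pprod \<phi> h \<psi> g) x \<alpha> =
      sw (\<lambda>x1 x2. ext \<phi> x1 * sw (\<lambda>h1 r. sw (\<lambda>h2 h3. ext \<psi> (ian h3 \<cdot> x2 \<cdot> tw T h1) * \<alpha> (h2 \<cdot> g)) r) h) x"
proof -
  interpret D: kspace DS by (rule kspace_DS)
  have mc: "mul H a c \<in> carrier H" if "a \<in> carrier H" "c \<in> carrier H" for a c
    using bilinear_on_closed[OF mul_bilinear that] .
  let ?p = "\<lambda>\<psi>1 \<psi>2 \<psi>3 h1 h2 h3. fscale (\<psi>1 (inv_antipode H h3) * \<psi>3 (T h1)) (dpure H (mul Hd \<phi> \<psi>2) (mul H h2 g))"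
  have pc: "?p \<psi>1 \<psi>2 \<psi>3 h1 h2 h3 \<in> carrier DS" if "\<psi>2 \<in> carrier Hd" "h2 \<in> carrier H" for \<psi>1 \<psi>2 \<psi>3 h1 h2 h3
    using D.scl_closed[OF dpure_closed[OF mul_dual_closed[OF \<phi> that(1)] mc[OF that(2) g]]]
    by (simp add: scl_DS)
  have pc3: "sw3 H (?p \<psi>1 \<psi>2 \<psi>3) h \<in> carrier DS" if "\<psi>2 \<in> carrier Hd" for \<psi>1 \<psi>2 \<psi>3
    by (rule sw3_closed[OF kspace_H kspace_DS comul_closed pc h]) (use that in simp_all)
  show "pprod \<phi> h \<psi> g \<in> carrier DS"
    unfolding pprod_def by (rule sw3_closed[OF kspace_dual kspace_DS comul_dual_closed pc3 \<psi>])
  assume \<alpha>: "lin \<alpha>"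
  note [simp] = lin_comp[OF \<alpha>]
  let ?f = "\<lambda>\<psi>1 \<psi>2 \<psi>3 h1 h2 h3. sw (\<lambda>x1 x2. ext \<phi> x1 * \<alpha> (h2 \<cdot> g) *
      (ext \<psi>1 (ian h3) * ext \<psi>2 x2 * ext \<psi>3 (tw T h1))) x"
  have Tc: "T a \<in> carrier H" if "a \<in> carrier H" for a
    using T that by (auto simp: hopf_endo_def intro: linear_on_closed)
  have 1: "ev (sw3 H (?p \<psi>1 \<psi>2 \<psi>3) h) x \<alpha> = sw (\<lambda>h1 r. sw (\<lambda>h2 h3. ?f \<psi>1 \<psi>2 \<psi>3 h1 h2 h3) r) h"
    if \<psi>s: "\<psi>1 \<in> carrier Hd" "\<psi>2 \<in> carrier Hd" "\<psi>3 \<in> carrier Hd" for \<psi>1 \<psi>2 \<psi>3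
  proof -
    have "ev (sw3 H (?p \<psi>1 \<psi>2 \<psi>3) h) x \<alpha> = sw3 H (\<lambda>h1 h2 h3. ev (?p \<psi>1 \<psi>2 \<psi>3 h1 h2 h3) x \<alpha>) h"
      by (rule sw3_linear_apply(2)[OF kspace_H kspace_DS comul_closed pc h linear_ev[OF \<alpha>]])
        (use \<psi>s in simp_all)
    also have "\<dots> = sw (\<lambda>h1 r. sw (\<lambda>h2 h3. ?f \<psi>1 \<psi>2 \<psi>3 h1 h2 h3) r) h"
    proof (rule sw3_sw[OF _ _ _ _ h])
      fix a b c assume "a \<in> carrier H" "b \<in> carrier H" "c \<in> carrier H"
      then show "ev (?p \<psi>1 \<psi>2 \<psi>3 a b c) x \<alpha> = ?f \<psi>1 \<psi>2 \<psi>3 a b c"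
        using \<psi>s \<phi> g \<alpha>
        by (simp add: ev_fscale dpure_closed mul_dual_closed mc ev_pure ext_mul_dual
            sw_mult_left[symmetric] sw_mult_right[symmetric] mult_def prj_id tw_def ian_def
            ext_eq[OF Tc] ext_eq[OF inv_antipode_closed] mult_ac)
    qed (use \<psi>s \<phi> in simp_all)
    finally show ?thesis .
  qed
  have "ev (pprod \<phi> h \<psi> g) x \<alpha> = sw3 Hd (\<lambda>\<psi>1 \<psi>2 \<psi>3. ev (sw3 H (?p \<psi>1 \<psi>2 \<psi>3) h) x \<alpha>) \<psi>"
    unfolding pprod_def
    by (rule sw3_linear_apply(2)[OF kspace_dual kspace_DS comul_dual_closed pc3 \<psi> linear_ev[OF \<alpha>]])
  also have "\<dots> = sw3 Hd (\<lambda>\<psi>1 \<psi>2 \<psi>3. sw (\<lambda>h1 r. sw (\<lambda>h2 h3. ?f \<psi>1 \<psi>2 \<psi>3 h1 h2 h3) r) h) \<psi>"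
    unfolding sw3_def[of Hd] sw2_def[of Hd]
    by (rule tlift_cong[OF kspace_dual comul_dual_closed[OF \<psi>]],
        rule tlift_cong[OF kspace_dual comul_dual_closed]) (simp_all only: 1)
  also have "\<dots> = sw (\<lambda>h1 r. sw (\<lambda>h2 h3. sw (\<lambda>x1 x2. ext \<phi> x1 * \<alpha> (h2 \<cdot> g) *
      sw3 Hd (\<lambda>\<psi>1 \<psi>2 \<psi>3. ext \<psi>1 (ian h3) * ext \<psi>2 x2 * ext \<psi>3 (tw T h1)) \<psi>) x) r) h"
    unfolding sw3_def[of Hd] sw2_def[of Hd] by (simp only: tlift_sw tlift_mult_left)
  also have "\<dots> = sw (\<lambda>h1 r. sw (\<lambda>h2 h3. sw (\<lambda>x1 x2. ext \<phi> x1 *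
      (ext \<psi> (ian h3 \<cdot> x2 \<cdot> tw T h1) * \<alpha> (h2 \<cdot> g))) x) r) h"
    by (simp only: sw3_dual[OF \<psi>]) (simp only: mult_ac)
  also have "\<dots> = sw (\<lambda>h1 r. sw (\<lambda>x1 x2. sw (\<lambda>h2 h3. ext \<phi> x1 *
      (ext \<psi> (ian h3 \<cdot> x2 \<cdot> tw T h1) * \<alpha> (h2 \<cdot> g))) r) x) h"
    by (subst sw_swap) (rule refl)
  also have "\<dots> = sw (\<lambda>x1 x2. sw (\<lambda>h1 r. sw (\<lambda>h2 h3. ext \<phi> x1 *
      (ext \<psi> (ian h3 \<cdot> x2 \<cdot> tw T h1) * \<alpha> (h2 \<cdot> g))) r) h) x"
    by (subst sw_swap) (rule refl)
  also have "\<dots> = sw (\<lambda>x1 x2. ext \<phi> x1 * sw (\<lambda>h1 r. sw (\<lambda>h2 h3.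
      ext \<psi> (ian h3 \<cdot> x2 \<cdot> tw T h1) * \<alpha> (h2 \<cdot> g)) r) h) x"
    by (simp only: sw_mult_left)
  finally show "ev (pprod \<phi> h \<psi> g) x \<alpha> =
      sw (\<lambda>x1 x2. ext \<phi> x1 * sw (\<lambda>h1 r. sw (\<lambda>h2 h3. ext \<psi> (ian h3 \<cdot> x2 \<cdot> tw T h1) * \<alpha> (h2 \<cdot> g)) r) h) x" .
qed

lemma bilinear_pprod:
  assumes \<phi>: "\<phi> \<in> carrier Hd" and h: "h \<in> carrier H"
  shows "bilinear_on Hd H DS (pprod \<phi> h)"
  unfolding bilinear_on_def
proof (intro conjI ballI)
  fix \<psi> assume \<psi>: "\<psi> \<in> carrier Hd"
  show "linear_on H DS (pprod \<phi> h \<psi>)"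
  proof (rule linear_on_DS[OF kspace_H])
    fix x \<alpha> assume \<alpha>: "lin \<alpha>"
    note [simp] = lin_comp[OF \<alpha>]
    have "linear_on H scalars (\<lambda>g. sw (\<lambda>x1 x2. ext \<phi> x1 * sw (\<lambda>h1 r. sw (\<lambda>h2 h3. ext \<psi> (ian h3 \<cdot> x2 \<cdot> tw T h1) * \<alpha> (h2 \<cdot> g)) r) h) x)"
      by (rule linear_on_lin) simp
    then show "linear_on H scalars (\<lambda>g. ev (pprod \<phi> h \<psi> g) x \<alpha>)"
      using ev_pprod[OF \<phi> h \<psi> _ \<alpha>] add_closed scl_closed by (simp add: linear_on_def)
  qed (rule pprod_closed[OF \<phi> h \<psi>])
next
  fix g assume g: "g \<in> carrier H"
  interpret D: kspace Hd by (rule kspace_dual)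
  show "linear_on Hd DS (\<lambda>\<psi>. pprod \<phi> h \<psi> g)"
  proof (rule linear_on_DS[OF kspace_dual])
    fix x \<alpha> assume \<alpha>: "lin \<alpha>"
    have "linear_on Hd scalars (\<lambda>\<psi>. sw (\<lambda>x1 x2. ext \<phi> x1 * sw (\<lambda>h1 r. sw (\<lambda>h2 h3. ext \<psi> (ian h3 \<cdot> x2 \<cdot> tw T h1) * \<alpha> (h2 \<cdot> g)) r) h) x)"
      by (intro linear_on_sw linear_on_mult_left linear_on_mult_right linear_ext)
    then show "linear_on Hd scalars (\<lambda>\<psi>. ev (pprod \<phi> h \<psi> g) x \<alpha>)"
      using ev_pprod[OF \<phi> h _ g \<alpha>] D.add_closed D.scl_closed by (simp add: linear_on_def)
  qed (rule pprod_closed[OF \<phi> h _ g])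
qed

lemma bilinear_pprod_left:
  assumes \<psi>: "\<psi> \<in> carrier Hd" and g: "g \<in> carrier H"
  shows "bilinear_on Hd H DS (\<lambda>\<phi> h. pprod \<phi> h \<psi> g)"
  unfolding bilinear_on_def
proof (intro conjI ballI)
  fix \<phi> assume \<phi>: "\<phi> \<in> carrier Hd"
  show "linear_on H DS (\<lambda>h. pprod \<phi> h \<psi> g)"
  proof (rule linear_on_DS[OF kspace_H])
    fix x \<alpha> assume \<alpha>: "lin \<alpha>"
    have "linear_on H scalars (\<lambda>h. sw (\<lambda>x1 x2. ext \<phi> x1 * sw (\<lambda>h1 r. sw (\<lambda>h2 h3. ext \<psi> (ian h3 \<cdot> x2 \<cdot> tw T h1) * \<alpha> (h2 \<cdot> g)) r) h) x)"
      by (rule linear_on_lin) simp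
    then show "linear_on H scalars (\<lambda>h. ev (pprod \<phi> h \<psi> g) x \<alpha>)"
      using ev_pprod[OF \<phi> _ \<psi> g \<alpha>] add_closed scl_closed by (simp add: linear_on_def)
  qed (rule pprod_closed[OF \<phi> _ \<psi> g])
next
  fix h assume h: "h \<in> carrier H"
  interpret D: kspace Hd by (rule kspace_dual)
  show "linear_on Hd DS (\<lambda>\<phi>. pprod \<phi> h \<psi> g)"
  proof (rule linear_on_DS[OF kspace_dual])
    fix x \<alpha> assume \<alpha>: "lin \<alpha>"
    have "linear_on Hd scalars (\<lambda>\<phi>. sw (\<lambda>x1 x2. ext \<phi> x1 * sw (\<lambda>h1 r. sw (\<lambda>h2 h3. ext \<psi> (ian h3 \<cdot> x2 \<cdot> tw T h1) * \<alpha> (h2 \<cdot> g)) r) h) x)"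
      by (intro linear_on_sw linear_on_mult_left linear_on_mult_right linear_ext)
    then show "linear_on Hd scalars (\<lambda>\<phi>. ev (pprod \<phi> h \<psi> g) x \<alpha>)"
      using ev_pprod[OF _ h \<psi> g \<alpha>] D.add_closed D.scl_closed by (simp add: linear_on_def)
  qed (rule pprod_closed[OF _ h \<psi> g])
qed

lemma bilinear_inner_product:
  assumes y: "y \<in> carrier DS"
  shows "bilinear_on Hd H DS (\<lambda>\<phi> h. tlift Hd H (pprod \<phi> h) y)"
  unfolding bilinear_on_def
proof (intro conjI ballI)
  have y': "y \<in> carrier (tensor Hd H)" using y by (simp add: double_space_def)
  show "linear_on H DS (\<lambda>h. tlift Hd H (pprod \<phi> h) y)" if "\<phi> \<in> carrier Hd" for \<phi>
    by (rule linear_on_tlift_param[OF kspace_dual kspace_DS y'])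
      (rule bilinear_on_right[OF bilinear_pprod_left that])
  show "linear_on Hd DS (\<lambda>\<phi>. tlift Hd H (pprod \<phi> h) y)" if "h \<in> carrier H" for h
    by (rule linear_on_tlift_param[OF kspace_dual kspace_DS y'])
      (rule bilinear_on_left[OF bilinear_pprod_left that])
qed

lemma double_mul_bilinear: "bilinear_on DS DS DS dmul"
  unfolding bilinear_on_def
proof (intro conjI ballI)
  fix y assume y: "y \<in> carrier DS"
  show "linear_on DS DS (\<lambda>x. dmul x y)"
    unfolding double_mul_pprod
    using linear_on_tlift[OF kspace_dual kspace_DS bilinear_inner_product[OF y]]
    by (simp add: double_space_def)
  have "linear_on (tensor Hd H) DS (tlift Hd H (pprod \<phi> h))"
    if "\<phi> \<in> carrier Hd" "h \<in> carrier H" for \<phi> h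
    by (rule linear_on_tlift[OF kspace_dual kspace_DS bilinear_pprod[OF that]])
  then show "linear_on DS DS (dmul y)"
    unfolding double_mul_pprod using y
    by (intro linear_on_tlift_param[OF kspace_dual kspace_DS]) (simp_all add: double_space_def)
qed

lemma double_mul_closed: "s \<in> carrier DS \<Longrightarrow> t \<in> carrier DS \<Longrightarrow> dmul s t \<in> carrier DS"
  by (rule bilinear_on_closed[OF double_mul_bilinear])

text \<open>The cross relation of the double, evaluated at \<open>z\<close> and \<open>\<alpha>\<close>: \<open>h\<close> acts on \<open>s\<close> by
  \<open>\<psi> \<otimes> g \<mapsto> \<psi>\<^sub>1(S\<^sup>-\<^sup>1(h\<^sub>3)) \<psi>\<^sub>3(T(h\<^sub>1)) \<psi>\<^sub>2 \<otimes> h\<^sub>2g\<close>.\<close>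

definition act :: "('k, 'a \<Rightarrow> 'k, 'a) tens \<Rightarrow> 'a \<Rightarrow> ('a \<Rightarrow> 'k) \<Rightarrow> 'a \<Rightarrow> 'k" where
  "act s z \<alpha> h = sw (\<lambda>h1 r. sw (\<lambda>h2 h3. ev s (ian h3 \<cdot> z \<cdot> tw T h1) (\<lambda>g. \<alpha> (h2 \<cdot> g))) r) h"

lemma ev_double_mul:
  assumes t: "t \<in> carrier DS" and s: "s \<in> carrier DS" and \<alpha>: "lin \<alpha>"
  shows "ev (dmul t s) x \<alpha> = sw (\<lambda>x1 x2. ev t x1 (act s x2 \<alpha>)) x"
proof -
  have t': "t \<in> carrier (tensor Hd H)" and s': "s \<in> carrier (tensor Hd H)"
    using s t by (simp_all add: double_space_def)
  have "ev (dmul t s) x \<alpha> = tlift Hd H (\<lambda>\<phi> h. ev (tlift Hd H (pprod \<phi> h) s) x \<alpha>) t"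
    unfolding double_mul_pprod
    by (rule linear_on_tlift_apply[OF kspace_dual kspace_DS t' _ linear_ev[OF \<alpha>]])
      (rule bilinear_on_closed[OF bilinear_inner_product[OF s]])
  also have "\<dots> = tlift Hd H (\<lambda>\<phi> h. tlift Hd H (\<lambda>\<psi> g. sw (\<lambda>x1 x2. ext \<phi> x1 *
      sw (\<lambda>h1 r. sw (\<lambda>h2 h3. ext \<psi> (ian h3 \<cdot> x2 \<cdot> tw T h1) * \<alpha> (h2 \<cdot> g)) r) h) x) s) t"
  proof (rule tlift_cong[OF kspace_dual t'])
    fix \<phi> h assume \<phi>: "\<phi> \<in> carrier Hd" and h: "h \<in> carrier H"
    have "ev (tlift Hd H (pprod \<phi> h) s) x \<alpha> = tlift Hd H (\<lambda>\<psi> g. ev (pprod \<phi> h \<psi> g) x \<alpha>) s"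
      by (rule linear_on_tlift_apply[OF kspace_dual kspace_DS s' _ linear_ev[OF \<alpha>]])
        (rule pprod_closed[OF \<phi> h])
    also have "\<dots> = tlift Hd H (\<lambda>\<psi> g. sw (\<lambda>x1 x2. ext \<phi> x1 *
      sw (\<lambda>h1 r. sw (\<lambda>h2 h3. ext \<psi> (ian h3 \<cdot> x2 \<cdot> tw T h1) * \<alpha> (h2 \<cdot> g)) r) h) x) s"
      by (rule tlift_cong[OF kspace_dual s']) (rule ev_pprod[OF \<phi> h _ _ \<alpha>])
    finally show "ev (tlift Hd H (pprod \<phi> h) s) x \<alpha> = \<dots>" .
  qed
  also have "\<dots> = sw (\<lambda>x1 x2. ev t x1 (act s x2 \<alpha>)) x"
    unfolding ev_def act_def by (simp only: tlift_sw tlift_mult_left)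
  finally show ?thesis .
qed

lemma lin_act [simp]: "lin (act s z \<alpha>)"
  unfolding act_def[abs_def] by simp

lemma lin_act_comp [simp]: "lin_map g \<Longrightarrow> lin (\<lambda>x. act s z \<alpha> (g x))"
  by (rule lin_comp[OF lin_act])

lemma lin_act_point [simp]: "s \<in> carrier DS \<Longrightarrow> lin_map f \<Longrightarrow> lin (\<lambda>z. act s (f z) \<alpha> h)"
  unfolding act_def by simp

text \<open>The cross relation respects products in H: S^-1(a_3 b_3) z T(a_1 b_1) is the conjugate
  under b of S^-1(a_3) z T(a_1), because S^-1 reverses products and T preserves them.\<close>

lemma act_mult:
  assumes s: "s \<in> carrier DS" and \<alpha>: "lin \<alpha>"
  shows "act s z \<alpha> (x \<cdot> y) =
    sw (\<lambda>a1 r. sw (\<lambda>a2 a3. act s (ian a3 \<cdot> z \<cdot> tw T a1) (\<lambda>k. \<alpha> (a2 \<cdot> k)) y) r) x"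
proof -
  note [simp] = lin_comp[OF \<alpha>] s
  have "act s z \<alpha> (x \<cdot> y) = sw (\<lambda>a1 r. sw (\<lambda>b1 q. sw (\<lambda>a2 a3. sw (\<lambda>b2 b3.
      ev s (ian (a3 \<cdot> b3) \<cdot> z \<cdot> tw T (a1 \<cdot> b1)) (\<lambda>g. \<alpha> (a2 \<cdot> b2 \<cdot> g))) q) r) y) x"
  proof -
    have "act s z \<alpha> (x \<cdot> y) = sw (\<lambda>a1 r. sw (\<lambda>b1 q. sw (\<lambda>h2 h3.
        ev s (ian h3 \<cdot> z \<cdot> tw T (a1 \<cdot> b1)) (\<lambda>g. \<alpha> (h2 \<cdot> g))) (r \<cdot> q)) y) x"
      unfolding act_def by (subst sw_mult) (auto intro!: bilinI)
    then show ?thesis by (subst (asm) sw_mult) (auto intro!: bilinI)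
  qed
  also have "\<dots> = sw (\<lambda>a1 r. sw (\<lambda>a2 a3. sw (\<lambda>b1 q. sw (\<lambda>b2 b3.
      ev s (ian (a3 \<cdot> b3) \<cdot> z \<cdot> tw T (a1 \<cdot> b1)) (\<lambda>g. \<alpha> (a2 \<cdot> b2 \<cdot> g))) q) y) r) x"
    by (subst sw_swap) (rule refl)
  finally show ?thesis by (simp only: act_def ian_mult tw_mult mult_assoc)
qed

text \<open>The step on which associativity rests. Splitting S^-1(h_3) z T(h_1) by
  \<open>sw_conjugate\<close> yields five legs of h: the outer two conjugate b, and the inner three
  reassemble by \<open>act_mult\<close> into a single leg acting on r.\<close>

lemma act_double_mul:
  assumes s: "s \<in> carrier DS" and r: "r \<in> carrier DS" and \<alpha>: "lin \<alpha>"
  shows "act (dmul s r) z \<alpha> h = sw (\<lambda>b c. act s b (act r c \<alpha>) h) z"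
proof -
  note [simp] = lin_comp[OF \<alpha>] s r
  let ?X = "\<lambda>b c d1 d2 h2 c1 c2. ev s (ian c2 \<cdot> b \<cdot> tw T d1) (act r (ian c1 \<cdot> c \<cdot> tw T d2) (\<lambda>k. \<alpha> (h2 \<cdot> k)))"
  have "act (dmul s r) z \<alpha> h = sw (\<lambda>h1 q. sw (\<lambda>h2 h3. sw (\<lambda>w1 w2.
      ev s w1 (act r w2 (\<lambda>k. \<alpha> (h2 \<cdot> k)))) (ian h3 \<cdot> z \<cdot> tw T h1)) q) h"
    unfolding act_def[of "dmul s r"] by (subst ev_double_mul) simp_all
  also have "\<dots> = sw (\<lambda>h1 q. sw (\<lambda>h2 h3. sw (\<lambda>b c. sw (\<lambda>c1 c2. sw (\<lambda>d1 d2.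
      ?X b c d1 d2 h2 c1 c2) h1) h3) z) q) h"
    by (subst sw_conjugate) (auto intro!: bilinI)
  \<comment> \<open>The exchanges from here on move the sum over z outwards and place the splittings
    of the legs of h next to each other, so that \<open>sw_coassoc\<close> can renumber these
    legs.\<close>
  also have "\<dots> = sw (\<lambda>h1 q. sw (\<lambda>b c. sw (\<lambda>h2 h3. sw (\<lambda>c1 c2. sw (\<lambda>d1 d2.
      ?X b c d1 d2 h2 c1 c2) h1) h3) q) z) h"
    by (subst sw_swap[where y = z]) (rule refl)
  also have "\<dots> = sw (\<lambda>b c. sw (\<lambda>h1 q. sw (\<lambda>h2 h3. sw (\<lambda>c1 c2. sw (\<lambda>d1 d2.
      ?X b c d1 d2 h2 c1 c2) h1) h3) q) h) z"
    by (subst sw_swap[where y = z]) (rule refl)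
  also have "\<dots> = sw (\<lambda>b c. sw (\<lambda>h1 q. sw (\<lambda>h2 h3. sw (\<lambda>d1 d2. sw (\<lambda>c1 c2.
      ?X b c d1 d2 h2 c1 c2) h3) h1) q) h) z"
    by (subst sw_swap) (rule refl)
  also have "\<dots> = sw (\<lambda>b c. sw (\<lambda>h1 q. sw (\<lambda>d1 d2. sw (\<lambda>h2 h3. sw (\<lambda>c1 c2.
      ?X b c d1 d2 h2 c1 c2) h3) q) h1) h) z"
    by (subst sw_swap) (rule refl)
  also have "\<dots> = sw (\<lambda>b c. sw (\<lambda>h1 q. sw (\<lambda>h2 h3. sw (\<lambda>a1 u. sw (\<lambda>a2 a3.
      ?X b c h1 a1 a2 a3 h3) u) h2) q) h) z"
    by (simp only: sw_coassoc)
  also have "\<dots> = sw (\<lambda>b c. sw (\<lambda>h1 q. sw (\<lambda>h2 h3.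
      ev s (ian h3 \<cdot> b \<cdot> tw T h1) (\<lambda>g. act r c \<alpha> (h2 \<cdot> g))) q) h) z"
    by (simp only: act_mult[OF r \<alpha>] ev_sw)
  finally show ?thesis by (simp only: act_def[of s])
qed

lemma double_mul_assoc:
  assumes t: "t \<in> carrier DS" and s: "s \<in> carrier DS" and r: "r \<in> carrier DS"
  shows "dmul (dmul t s) r = dmul t (dmul s r)"
proof (rule ev_eqI)
  fix x \<alpha> assume \<alpha>: "lin \<alpha>"
  have "ev (dmul (dmul t s) r) x \<alpha> = sw (\<lambda>x1 x2. sw (\<lambda>a b. ev t a (act s b (act r x2 \<alpha>))) x1) x"
    using assms \<alpha> by (simp add: ev_double_mul double_mul_closed)
  also have "\<dots> = sw (\<lambda>a x'. sw (\<lambda>b c. ev t a (act s b (act r c \<alpha>))) x') x"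
    by (rule sw_coassoc)
  also have "\<dots> = sw (\<lambda>a x'. ev t a (\<lambda>h. sw (\<lambda>b c. act s b (act r c \<alpha>) h) x')) x"
    by (simp only: ev_sw)
  also have "\<dots> = sw (\<lambda>a x'. ev t a (act (dmul s r) x' \<alpha>)) x"
    by (simp only: act_double_mul[OF s r \<alpha>, symmetric])
  also have "\<dots> = ev (dmul t (dmul s r)) x \<alpha>"
    using assms \<alpha> by (simp add: ev_double_mul double_mul_closed)
  finally show "ev (dmul (dmul t s) r) x \<alpha> = ev (dmul t (dmul s r)) x \<alpha>" .
qed (simp_all add: assms double_mul_closed)

end

end

section \<open>Tensor notions depend only on carriers and scalar multiplications\<close>

lemma bilinear_on_cong:
  assumes "carrier V = carrier V'" "scl V = scl V'" "carrier W = carrier W'" "scl W = scl W'"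
    "carrier U = carrier U'" "scl U = scl U'"
  shows "bilinear_on V W U = bilinear_on V' W' U'"
  using assms by (simp add: bilinear_on_def[abs_def] linear_on_def)

lemma pure_cong:
  assumes "carrier V = carrier V'" "scl V = scl V'" "carrier W = carrier W'" "scl W = scl W'"
  shows "pure V W = pure V' W'"
  unfolding pure_def[abs_def] by (simp add: bilinear_on_cong[OF assms refl refl])

lemma tensor_cong:
  assumes "carrier V = carrier V'" "scl V = scl V'" "carrier W = carrier W'" "scl W = scl W'"
  shows "tensor V W = tensor V' W'"
  unfolding tensor_def by (simp add: pure_cong[OF assms] assms)

lemma tlift_congruence:
  assumes "carrier V = carrier V'" "scl V = scl V'" "carrier W = carrier W'" "scl W = scl W'"
  shows "tlift V W = tlift V' W'"
  unfolding tlift_def[abs_def] by (simp add: pure_cong[OF assms] assms)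

lemma bilinear_on_compose:
  assumes "linear_on V V' f" "linear_on W W' g" "bilinear_on V' W' U \<beta>"
  shows "bilinear_on V W U (\<lambda>v w. \<beta> (f v) (g w))"
  using assms by (simp add: bilinear_on_def linear_on_def)

lemma bilinear_on_flip: "bilinear_on V W U \<beta> \<Longrightarrow> bilinear_on W V U (\<lambda>w v. \<beta> v w)"
  by (simp add: bilinear_on_def)

lemma kspace_cong:
  "kspace V \<Longrightarrow> carrier V = carrier V' \<Longrightarrow> scl V = scl V' \<Longrightarrow> kspace V'"
  by (simp add: kspace_def)

context fd_hopf_algebra
begin

subsection \<open>Unit\<close>

abbreviation dunit where "dunit \<equiv> dpure H (unit Hd) (unit H)"

lemma dunit_closed: "dunit \<in> carrier DS"
  by (intro dpure_closed unit_closed) (simp add: unit_dual)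

lemma ev_dunit: "lin \<alpha> \<Longrightarrow> ev dunit x \<alpha> = cou x * \<alpha> \<one>"
  using unit_closed by (simp add: ev_pure unit_dual one_def)

lemma sw_ian_right_cancel:
  assumes "\<And>c. lin (\<lambda>z. F z c)" "\<And>z. lin (F z)"
  shows "sw (\<lambda>a r. sw (\<lambda>b c. F (b \<cdot> ian a) c) r) h = F \<one> h"
  using assms by (simp add: sw_coassoc[symmetric] sw_ian_right[where f = "\<lambda>z. F z c" for c] sw_counit_left)

context
  fixes T :: "'a \<Rightarrow> 'a"
  assumes T: "hopf_endo T"
begin

lemma act_one:
  assumes s: "s \<in> carrier DS" and \<alpha>: "lin \<alpha>"
  shows "act T s z \<alpha> \<one> = ev s z \<alpha>"
proof -
  note [simp] = lin_comp[OF \<alpha>] s lin_prj[OF \<alpha>] lin_map_tw[OF T] prj_tw[OF T] tw_one[OF T]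
  have "act T s z \<alpha> \<one> = sw (\<lambda>h2 h3. ev s (ian h3 \<cdot> z \<cdot> tw T \<one>) (\<lambda>g. \<alpha> (h2 \<cdot> g))) \<one>"
    unfolding act_def[OF T] by (subst sw_one) (auto intro!: bilinI)
  also have "\<dots> = ev s (ian \<one> \<cdot> z \<cdot> tw T \<one>) (\<lambda>g. \<alpha> (\<one> \<cdot> g))"
    by (subst sw_one) (auto intro!: bilinI)
  finally show ?thesis by simp
qed

lemma act_dunit:
  assumes \<alpha>: "lin \<alpha>" shows "act T dunit z \<alpha> h = cou z * \<alpha> h"
proof -
  note [simp] = lin_comp[OF \<alpha>] \<alpha> lin_prj[OF \<alpha>] cou_tw[OF T]
  have "act T dunit z \<alpha> h = sw (\<lambda>h1 r. sw (\<lambda>h2 h3. cou h1 * (cou h3 * (cou z * \<alpha> h2))) r) h"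
    unfolding act_def[OF T] by (simp add: ev_dunit mult_ac)
  also have "\<dots> = cou z * \<alpha> h"
    by (simp add: sw_mult_left sw_counit_left sw_counit_right)
  finally show ?thesis .
qed

lemma double_mul_unit_left:
  assumes s: "s \<in> carrier DS" shows "double_mul H T dunit s = s"
proof (rule ev_eqI)
  fix x \<alpha> assume \<alpha>: "lin \<alpha>"
  note [simp] = s lin_act_point[OF T]
  have "ev (double_mul H T dunit s) x \<alpha> = sw (\<lambda>x1 x2. cou x1 * ev s x2 \<alpha>) x"
    using \<alpha> by (simp add: ev_double_mul[OF T] dunit_closed ev_dunit lin_act[OF T] act_one)
  then show "ev (double_mul H T dunit s) x \<alpha> = ev s x \<alpha>" by (simp add: sw_counit_left)
qed (simp_all add: s double_mul_closed[OF T] dunit_closed)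

lemma double_mul_unit_right:
  assumes s: "s \<in> carrier DS" shows "double_mul H T s dunit = s"
proof (rule ev_eqI)
  fix x \<alpha> assume \<alpha>: "lin \<alpha>"
  note [simp] = s
  have "act T dunit z \<alpha> = (\<lambda>h. cou z * \<alpha> h)" for z by (rule HOL.ext) (rule act_dunit[OF \<alpha>])
  then have "ev (double_mul H T s dunit) x \<alpha> = sw (\<lambda>x1 x2. cou x2 * ev s x1 \<alpha>) x"
    using \<alpha> by (simp add: ev_double_mul[OF T] dunit_closed ev_mult_left)
  then show "ev (double_mul H T s dunit) x \<alpha> = ev s x \<alpha>" by (simp add: sw_counit_right)
qed (simp_all add: s double_mul_closed[OF T] dunit_closed)

text \<open>Stated for any record with these four components, since \<open>A_alg\<close> and
  \<open>drinfeld_double\<close> are records of different types.\<close>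

lemma k_algebra_twisted_double:
  assumes A: "carrier A = carrier DS" "scl A = scl DS" "mul A = double_mul H T" "unit A = dunit"
  shows "k_algebra A"
proof (intro k_algebra.intro k_algebra_axioms.intro)
  show "kspace A" by (rule kspace_cong[OF kspace_DS]) (simp_all add: A)
  show "bilinear_on A A A (mul A)"
    using double_mul_bilinear[OF T] bilinear_on_cong[OF A(1,2) A(1,2) A(1,2)] by (simp add: A(3))
qed (simp_all add: A double_mul_assoc[OF T] dunit_closed double_mul_unit_left double_mul_unit_right)

end

subsection \<open>The coaction\<close>

abbreviation "DS2 \<equiv> tensor DS DS"

section \<open>Separating evaluations on twofold and threefold tensors\<close>

lemma ev_tensor_eqI:
  assumes "s \<in> carrier DS2" "t \<in> carrier DS2"
    and "\<And>x \<alpha> y \<beta>. lin \<alpha> \<Longrightarrow> lin \<beta> \<Longrightarrow>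
      tlift DS DS (\<lambda>a b. ev a x \<alpha> * ev b y \<beta>) s = tlift DS DS (\<lambda>a b. ev a x \<alpha> * ev b y \<beta>) t"
  shows "s = t"
  by (rule tensor_eqI_separating[OF kspace_DS kspace_DS assms(1,2),
        of "{\<lambda>t. ev t x \<alpha> |x \<alpha>. lin \<alpha>}" "{\<lambda>t. ev t x \<alpha> |x \<alpha>. lin \<alpha>}"])
    (use assms(3) linear_ev in \<open>auto intro: DS_separating\<close>)

lemma bilinear_ev_ev: "lin \<alpha> \<Longrightarrow> lin \<beta> \<Longrightarrow> bilinear_on DS DS scalars (\<lambda>a b. ev a x \<alpha> * ev b y \<beta>)"
  by (intro bilinear_on_mult linear_ev)

text \<open>Iterates the separation criterion: by \<open>ev_tensor_eqI\<close> the double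
  evaluations separate \<open>DS2\<close>, so they can serve as the first of the two
  families.\<close>

lemma ev_tensor3_eqI:
  assumes s: "s \<in> carrier (tensor DS2 DS)" and t: "t \<in> carrier (tensor DS2 DS)"
    and eq: "\<And>x \<alpha> y \<beta> z \<gamma>. lin \<alpha> \<Longrightarrow> lin \<beta> \<Longrightarrow> lin \<gamma> \<Longrightarrow>
      tlift DS2 DS (\<lambda>u c. tlift DS DS (\<lambda>a b. ev a x \<alpha> * ev b y \<beta>) u * ev c z \<gamma>) s =
      tlift DS2 DS (\<lambda>u c. tlift DS DS (\<lambda>a b. ev a x \<alpha> * ev b y \<beta>) u * ev c z \<gamma>) t"
  shows "s = t"
proof (rule tensor_eqI_separating[OF kspace_tensor kspace_DS s t])
  let ?P = "{tlift DS DS (\<lambda>a b. ev a x \<alpha> * ev b y \<beta>) |x \<alpha> y \<beta>. lin \<alpha> \<and> lin \<beta>}"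
  let ?Q = "{\<lambda>t. ev t x \<alpha> |x \<alpha>. lin \<alpha>}"
  show lin: "linear_on DS2 scalars f" if "f \<in> ?P" for f
    using that by (auto intro: linear_on_tlift[OF kspace_DS kspace_scalars bilinear_ev_ev])
  show "linear_on DS scalars g" if "g \<in> ?Q" for g using that by (auto intro: linear_ev)
  show "u = 0" if u: "u \<in> carrier DS2" and z: "\<And>f. f \<in> ?P \<Longrightarrow> f u = 0" for u
  proof (rule ev_tensor_eqI[OF u kspace.zero_closed[OF kspace_tensor]])
    fix x y :: 'a and \<alpha> \<beta> :: "'a \<Rightarrow> 'k" assume "lin \<alpha>" "lin \<beta>"
    then have "tlift DS DS (\<lambda>a b. ev a x \<alpha> * ev b y \<beta>) \<in> ?P" by blast
    from z[OF this] linear_on_zero[OF kspace_tensor lin[OF this]]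
    show "tlift DS DS (\<lambda>a b. ev a x \<alpha> * ev b y \<beta>) u = tlift DS DS (\<lambda>a b. ev a x \<alpha> * ev b y \<beta>) 0"
      by simp
  qed
  show "w = 0" if "w \<in> carrier DS" "\<And>g. g \<in> ?Q \<Longrightarrow> g w = 0" for w
    using that by (auto intro: DS_separating)
qed (use eq in auto)

abbreviation coact where "coact \<equiv> double_comul H"

definition pcomul where
  "pcomul \<phi> h = sw2 Hd (\<lambda>\<phi>1 \<phi>2. sw2 H (\<lambda>h1 h2. pure DS DS (dpure H \<phi>2 h1) (dpure H \<phi>1 h2)) h) \<phi>"

lemma double_comul_pcomul: "coact = tlift Hd H pcomul"
  by (simp add: double_comul_def pcomul_def[abs_def])

lemma linear_dpure_left: "h \<in> carrier H \<Longrightarrow> linear_on Hd DS (\<lambda>\<phi>. dpure H \<phi> h)"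
  and linear_dpure_right: "\<phi> \<in> carrier Hd \<Longrightarrow> linear_on H DS (dpure H \<phi>)"
  using bilinear_on_pure[of Hd H] by (simp_all add: double_space_def bilinear_on_def)

lemma bilinear_pcomul_H:
  "\<phi>1 \<in> carrier Hd \<Longrightarrow> \<phi>2 \<in> carrier Hd \<Longrightarrow>
    bilinear_on H H DS2 (\<lambda>h1 h2. pure DS DS (dpure H \<phi>2 h1) (dpure H \<phi>1 h2))"
  by (rule bilinear_on_compose[OF linear_dpure_right linear_dpure_right bilinear_on_pure])

lemma bilinear_pcomul_dual:
  "h1 \<in> carrier H \<Longrightarrow> h2 \<in> carrier H \<Longrightarrow>
    bilinear_on Hd Hd DS2 (\<lambda>\<phi>1 \<phi>2. pure DS DS (dpure H \<phi>2 h1) (dpure H \<phi>1 h2))"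
  by (rule bilinear_on_flip, rule bilinear_on_compose[OF linear_dpure_left linear_dpure_left bilinear_on_pure])

lemma bilinear_pcomul: "bilinear_on Hd H DS2 pcomul"
  unfolding bilinear_on_def
proof (intro conjI ballI)
  fix \<phi> assume \<phi>: "\<phi> \<in> carrier Hd"
  show "linear_on H DS2 (pcomul \<phi>)"
    unfolding pcomul_def[abs_def] sw2_def
    by (rule linear_on_tlift_param[OF kspace_dual kspace_tensor comul_dual_closed[OF \<phi>]])
      (rule linear_on_comp[OF comul_linear linear_on_tlift[OF kspace_H kspace_tensor bilinear_pcomul_H]])
next
  fix h assume h: "h \<in> carrier H"
  have "bilinear_on Hd Hd DS2 (\<lambda>\<phi>1 \<phi>2. tlift H H (\<lambda>h1 h2. pure DS DS (dpure H \<phi>2 h1) (dpure H \<phi>1 h2)) (comul H h))"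
    unfolding bilinear_on_def
    by (intro conjI ballI linear_on_tlift_param[OF kspace_H kspace_tensor comul_closed[OF h]])
      (rule bilinear_on_right[OF bilinear_pcomul_dual] bilinear_on_left[OF bilinear_pcomul_dual];
        assumption)+
  then show "linear_on Hd DS2 (\<lambda>\<phi>. pcomul \<phi> h)"
    unfolding pcomul_def sw2_def
    by (rule linear_on_comp[OF comul_dual_linear linear_on_tlift[OF kspace_dual kspace_tensor]])
qed

lemma coact_linear: "linear_on DS DS2 coact"
  unfolding double_comul_pcomul
  using linear_on_tlift[OF kspace_dual kspace_tensor bilinear_pcomul] by (simp add: double_space_def)

lemma coact_closed: "t \<in> carrier DS \<Longrightarrow> coact t \<in> carrier DS2"
  by (rule linear_on_closed[OF coact_linear])

lemma coact_pure: "\<phi> \<in> carrier Hd \<Longrightarrow> h \<in> carrier H \<Longrightarrow> coact (dpure H \<phi> h) = pcomul \<phi> h"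
  unfolding double_comul_pcomul by (rule tlift_pure[OF kspace_dual kspace_tensor bilinear_pcomul])

lemma tlift_pcomul:
  assumes f: "bilinear_on DS DS scalars f" and \<phi>: "\<phi> \<in> carrier Hd" and h: "h \<in> carrier H"
  shows "tlift DS DS f (pcomul \<phi> h) =
    sw2 Hd (\<lambda>\<phi>1 \<phi>2. sw2 H (\<lambda>h1 h2. f (dpure H \<phi>2 h1) (dpure H \<phi>1 h2)) h) \<phi>"
proof -
  have F: "linear_on DS2 scalars (tlift DS DS f)"
    by (rule linear_on_tlift[OF kspace_DS kspace_scalars f])
  have p: "pure DS DS (dpure H \<phi>2 h1) (dpure H \<phi>1 h2) \<in> carrier DS2"
    if "\<phi>1 \<in> carrier Hd" "\<phi>2 \<in> carrier Hd" "h1 \<in> carrier H" "h2 \<in> carrier H" for \<phi>1 \<phi>2 h1 h2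
    using that by (intro pure_closed dpure_closed)
  have "tlift DS DS f (pcomul \<phi> h) = tlift Hd Hd (\<lambda>\<phi>1 \<phi>2. tlift DS DS f (tlift H H
      (\<lambda>h1 h2. pure DS DS (dpure H \<phi>2 h1) (dpure H \<phi>1 h2)) (comul H h))) (comul Hd \<phi>)"
    unfolding pcomul_def sw2_def
    by (intro linear_on_tlift_apply[OF kspace_dual kspace_tensor comul_dual_closed[OF \<phi>] _ F]
        tlift_closed[OF kspace_H kspace_tensor comul_closed[OF h]] p)
  also have "\<dots> = sw2 Hd (\<lambda>\<phi>1 \<phi>2. sw2 H (\<lambda>h1 h2. f (dpure H \<phi>2 h1) (dpure H \<phi>1 h2)) h) \<phi>"
    unfolding sw2_def
  proof (rule tlift_cong[OF kspace_dual comul_dual_closed[OF \<phi>]])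
    fix \<phi>1 \<phi>2 assume \<phi>s: "\<phi>1 \<in> carrier Hd" "\<phi>2 \<in> carrier Hd"
    have "tlift DS DS f (tlift H H (\<lambda>h1 h2. pure DS DS (dpure H \<phi>2 h1) (dpure H \<phi>1 h2)) (comul H h)) =
      tlift H H (\<lambda>h1 h2. tlift DS DS f (pure DS DS (dpure H \<phi>2 h1) (dpure H \<phi>1 h2))) (comul H h)"
      by (rule linear_on_tlift_apply[OF kspace_H kspace_tensor comul_closed[OF h] _ F]) (rule p[OF \<phi>s])
    also have "\<dots> = tlift H H (\<lambda>h1 h2. f (dpure H \<phi>2 h1) (dpure H \<phi>1 h2)) (comul H h)"
      by (rule tlift_cong[OF kspace_H comul_closed[OF h]])
        (rule tlift_pure[OF kspace_DS kspace_scalars f], (intro dpure_closed \<phi>s; assumption)+)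
    finally show "tlift DS DS f (tlift H H (\<lambda>h1 h2. pure DS DS (dpure H \<phi>2 h1) (dpure H \<phi>1 h2)) (comul H h)) = \<dots>" .
  qed
  finally show ?thesis .
qed

text \<open>The coaction is dual to the product of the opposite of \<open>H\<close> with the convolution algebra.\<close>

lemma tlift_coact:
  assumes t: "t \<in> carrier DS" and \<Theta>: "bilin \<Theta>"
  shows "tlift DS DS (\<lambda>a b. ev a x (\<lambda>h. ev b y (\<lambda>l. \<Theta> h l))) (coact t) = ev t (y \<cdot> x) (sw \<Theta>)"
proof -
  note [simp] = lin_comp[OF bilin_left[OF \<Theta>]] lin_comp[OF bilin_right[OF \<Theta>]]
    bilin_left[OF \<Theta>] bilin_right[OF \<Theta>]
  let ?f = "\<lambda>a b. ev a x (\<lambda>h. ev b y (\<lambda>l. \<Theta> h l))"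
  have f: "bilinear_on DS DS scalars ?f"
    unfolding bilinear_on_def
  proof (intro conjI ballI)
    show "linear_on DS scalars (\<lambda>a. ?f a b)" if "b \<in> carrier DS" for b
      by (rule linear_ev) (use that in simp)
    fix a assume "a \<in> carrier DS"
    then have a: "a \<in> carrier (tensor Hd H)" by (simp add: double_space_def)
    show "linear_on DS scalars (?f a)"
      unfolding ev_def[of a]
      by (intro linear_on_tlift_param[OF kspace_dual kspace_scalars a] linear_on_mult_left linear_ev)
        simp
  qed
  have t': "t \<in> carrier (tensor Hd H)" using t by (simp add: double_space_def)
  have "tlift DS DS ?f (coact t) = tlift Hd H (\<lambda>\<phi> h. tlift DS DS ?f (pcomul \<phi> h)) t"
    unfolding double_comul_pcomul
    by (rule linear_on_tlift_apply[OF kspace_dual kspace_tensor t' _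
          linear_on_tlift[OF kspace_DS kspace_scalars f]])
      (rule bilinear_on_closed[OF bilinear_pcomul])
  also have "\<dots> = tlift Hd H (\<lambda>\<phi> h. ext \<phi> (y \<cdot> x) * sw \<Theta> h) t"
  proof (rule tlift_cong[OF kspace_dual t'])
    fix \<phi> h assume \<phi>: "\<phi> \<in> carrier Hd" and h: "h \<in> carrier H"
    have "tlift DS DS ?f (pcomul \<phi> h) =
        sw2 Hd (\<lambda>\<phi>1 \<phi>2. sw2 H (\<lambda>h1 h2. ?f (dpure H \<phi>2 h1) (dpure H \<phi>1 h2)) h) \<phi>"
      by (rule tlift_pcomul[OF f \<phi> h])
    also have "\<dots> = tlift Hd Hd (\<lambda>\<phi>1 \<phi>2. (ext \<phi>1 y * ext \<phi>2 x) * sw \<Theta> h) (comul Hd \<phi>)"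
      unfolding sw2_def[of Hd]
    proof (rule tlift_cong[OF kspace_dual comul_dual_closed[OF \<phi>]])
      fix \<phi>1 \<phi>2 assume \<phi>s: "\<phi>1 \<in> carrier Hd" "\<phi>2 \<in> carrier Hd"
      have "sw2 H (\<lambda>h1 h2. ?f (dpure H \<phi>2 h1) (dpure H \<phi>1 h2)) h =
          tlift H H (\<lambda>h1 h2. (ext \<phi>1 y * ext \<phi>2 x) * \<Theta> h1 h2) (comul H h)"
        unfolding sw2_def
        by (rule tlift_cong[OF kspace_H comul_closed[OF h]])
          (simp add: ev_pure \<phi>s dpure_closed mult_ac)
      also have "\<dots> = (ext \<phi>1 y * ext \<phi>2 x) * sw2 H \<Theta> h"
        by (simp add: tlift_mult_left sw2_def)
      finally show "sw2 H (\<lambda>h1 h2. ?f (dpure H \<phi>2 h1) (dpure H \<phi>1 h2)) h = (ext \<phi>1 y * ext \<phi>2 x) * sw \<Theta> h"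
        by (simp add: sw2_sw[OF bilinear_on_bilin[OF \<Theta>] h])
    qed
    also have "\<dots> = ext \<phi> (y \<cdot> x) * sw \<Theta> h"
      by (simp only: tlift_mult_right comul_dual[OF \<phi>])
    finally show "tlift DS DS ?f (pcomul \<phi> h) = ext \<phi> (y \<cdot> x) * sw \<Theta> h" .
  qed
  finally show ?thesis by (simp only: ev_def)
qed

text \<open>The case of a product form. In \<open>coact_mult\<close> the two legs of the coaction
  are met by a bilinear form that is not given as a product, so \<open>tlift_coact\<close> itself is
  applied there.\<close>

lemma tlift_coact_prod:
  assumes t: "t \<in> carrier DS" and \<alpha>: "lin \<alpha>" and \<beta>: "lin \<beta>"
  shows "tlift DS DS (\<lambda>a b. ev a x \<alpha> * ev b y \<beta>) (coact t) = ev t (y \<cdot> x) (sw (\<lambda>a b. \<alpha> a * \<beta> b))"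
  using tlift_coact[OF t, of "\<lambda>a b. \<alpha> a * \<beta> b" x y] \<alpha> \<beta>
  by (simp add: bilinI ev_mult_left ev_mult_right)

lemma coact_coassoc:
  assumes t: "t \<in> carrier DS"
  shows "tlift DS DS (\<lambda>u d. tlift DS DS (\<lambda>a b. pure DS2 DS (pure DS DS a b) d) (coact u)) (coact t) =
    tlift DS DS (\<lambda>a u. tlift DS DS (\<lambda>b d. pure DS2 DS (pure DS DS a b) d) (coact u)) (coact t)"
    (is "?L = ?R")
proof (rule ev_tensor3_eqI)
  have p: "pure DS2 DS (pure DS DS a b) d \<in> carrier (tensor DS2 DS)"
    if "a \<in> carrier DS" "b \<in> carrier DS" "d \<in> carrier DS" for a b d
    using that by (intro pure_closed)
  note tc = tlift_closed[OF kspace_DS kspace_tensor coact_closed]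
  show "?L \<in> carrier (tensor DS2 DS)" "?R \<in> carrier (tensor DS2 DS)"
    by (intro tc p t; assumption)+
  fix x y z :: 'a and \<alpha> \<beta> \<gamma> :: "'a \<Rightarrow> 'k" assume l: "lin \<alpha>" "lin \<beta>" "lin \<gamma>"
  note [simp] = l lin_comp[OF l(1)] lin_comp[OF l(2)] lin_comp[OF l(3)]
  let ?ab = "\<lambda>a b. ev a x \<alpha> * ev b y \<beta>"
  let ?G = "\<lambda>u c. tlift DS DS ?ab u * ev c z \<gamma>"
  let ?F = "tlift DS2 DS ?G"
  have bG: "bilinear_on DS2 DS scalars ?G"
    by (intro bilinear_on_mult linear_ev linear_on_tlift[OF kspace_DS kspace_scalars] bilinear_ev_ev l)
  have F: "linear_on (tensor DS2 DS) scalars ?F"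
    by (rule linear_on_tlift[OF kspace_tensor kspace_scalars bG])
  have Fp: "?F (pure DS2 DS (pure DS DS a b) d) = ?ab a b * ev d z \<gamma>"
    if "a \<in> carrier DS" "b \<in> carrier DS" "d \<in> carrier DS" for a b d
    using that by (simp add: tlift_pure[OF kspace_tensor kspace_scalars bG] pure_closed
        tlift_pure[OF kspace_DS kspace_scalars bilinear_ev_ev[OF l(1,2)]])
  have "?F ?L = tlift DS DS (\<lambda>u d. ?F (tlift DS DS (\<lambda>a b. pure DS2 DS (pure DS DS a b) d) (coact u))) (coact t)"
    by (rule linear_on_tlift_apply[OF kspace_DS kspace_tensor coact_closed[OF t] _ F])
      (intro tc p; assumption)
  also have "\<dots> = tlift DS DS (\<lambda>u d. ev u (y \<cdot> x) (sw (\<lambda>a b. \<alpha> a * \<beta> b)) * ev d z \<gamma>) (coact t)"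
  proof (rule tlift_cong[OF kspace_DS coact_closed[OF t]])
    fix u d assume u: "u \<in> carrier DS" and d: "d \<in> carrier DS"
    have "?F (tlift DS DS (\<lambda>a b. pure DS2 DS (pure DS DS a b) d) (coact u)) =
        tlift DS DS (\<lambda>a b. ?F (pure DS2 DS (pure DS DS a b) d)) (coact u)"
      by (rule linear_on_tlift_apply[OF kspace_DS kspace_tensor coact_closed[OF u] _ F])
        (intro p d; assumption)
    also have "\<dots> = tlift DS DS (\<lambda>a b. ?ab a b * ev d z \<gamma>) (coact u)"
      by (rule tlift_cong[OF kspace_DS coact_closed[OF u]]) (rule Fp[OF _ _ d])
    finally show "?F (tlift DS DS (\<lambda>a b. pure DS2 DS (pure DS DS a b) d) (coact u)) =
        ev u (y \<cdot> x) (sw (\<lambda>a b. \<alpha> a * \<beta> b)) * ev d z \<gamma>"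
      by (simp add: tlift_mult_right tlift_coact_prod u)
  qed
  also have "\<dots> = ev t (z \<cdot> (y \<cdot> x)) (sw (\<lambda>u c. sw (\<lambda>a b. \<alpha> a * \<beta> b) u * \<gamma> c))"
    using t by (simp add: tlift_coact_prod)
  also have "\<dots> = ev t (z \<cdot> (y \<cdot> x)) (sw (\<lambda>a u. \<alpha> a * sw (\<lambda>b c. \<beta> b * \<gamma> c) u))"
    by (intro arg_cong[where f = "ev t (z \<cdot> (y \<cdot> x))"] HOL.ext)
      (simp only: sw_mult_left[symmetric] sw_mult_right[symmetric] sw_coassoc mult.assoc)
  finally have L: "?F ?L = ev t (z \<cdot> (y \<cdot> x)) (sw (\<lambda>a u. \<alpha> a * sw (\<lambda>b c. \<beta> b * \<gamma> c) u))" .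
  have "?F ?R = tlift DS DS (\<lambda>a u. ?F (tlift DS DS (\<lambda>b d. pure DS2 DS (pure DS DS a b) d) (coact u))) (coact t)"
    by (rule linear_on_tlift_apply[OF kspace_DS kspace_tensor coact_closed[OF t] _ F])
      (intro tc p; assumption)
  also have "\<dots> = tlift DS DS (\<lambda>a u. ev a x \<alpha> * ev u (z \<cdot> y) (sw (\<lambda>b c. \<beta> b * \<gamma> c))) (coact t)"
  proof (rule tlift_cong[OF kspace_DS coact_closed[OF t]])
    fix a u assume a: "a \<in> carrier DS" and u: "u \<in> carrier DS"
    have "?F (tlift DS DS (\<lambda>b d. pure DS2 DS (pure DS DS a b) d) (coact u)) =
        tlift DS DS (\<lambda>b d. ?F (pure DS2 DS (pure DS DS a b) d)) (coact u)"
      by (rule linear_on_tlift_apply[OF kspace_DS kspace_tensor coact_closed[OF u] _ F])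
        (intro p a; assumption)
    also have "\<dots> = tlift DS DS (\<lambda>b d. ev a x \<alpha> * (ev b y \<beta> * ev d z \<gamma>)) (coact u)"
      by (rule tlift_cong[OF kspace_DS coact_closed[OF u]]) (simp only: Fp[OF a] mult.assoc)
    finally show "?F (tlift DS DS (\<lambda>b d. pure DS2 DS (pure DS DS a b) d) (coact u)) =
        ev a x \<alpha> * ev u (z \<cdot> y) (sw (\<lambda>b c. \<beta> b * \<gamma> c))"
      by (simp add: tlift_mult_left tlift_coact_prod u)
  qed
  also have "\<dots> = ev t (z \<cdot> y \<cdot> x) (sw (\<lambda>a u. \<alpha> a * sw (\<lambda>b c. \<beta> b * \<gamma> c) u))"
    using t by (simp add: tlift_coact_prod)
  finally show "?F ?L = ?F ?R" using L by (simp only: mult_assoc)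
qed

lemma sw_counit_left_prod: "lin \<alpha> \<Longrightarrow> sw (\<lambda>a b. cou a * \<alpha> b) = \<alpha>"
  and sw_counit_right_prod: "lin \<alpha> \<Longrightarrow> sw (\<lambda>a b. \<alpha> a * cou b) = \<alpha>"
  by (simp_all add: fun_eq_iff sw_counit_left sw_counit_right mult.commute[of "\<alpha> _" "cou _"])

text \<open>\<open>ev b \<one> cou\<close> is the counit of the double, as \<open>counit_DD\<close>
  confirms. It evaluates the second leg at the unit pair \<open>\<one>\<close>, \<open>cou\<close>,
  which drops out of the product dual to the coaction.\<close>

lemma coact_counit_right:
  assumes t: "t \<in> carrier DS"
  shows "tlift DS DS (\<lambda>a b. fscale (ev b \<one> cou) a) (coact t) = t"
proof (rule ev_eqI)
  interpret D: kspace DS by (rule kspace_DS)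
  have c: "fscale r a \<in> carrier DS" if "a \<in> carrier DS" for r a
    using D.scl_closed[OF that] by (simp add: scl_DS)
  show "tlift DS DS (\<lambda>a b. fscale (ev b \<one> cou) a) (coact t) \<in> carrier DS"
    by (intro tlift_closed[OF kspace_DS kspace_DS coact_closed[OF t]] c)
  fix x \<alpha> assume \<alpha>: "lin \<alpha>"
  have "ev (tlift DS DS (\<lambda>a b. fscale (ev b \<one> cou) a) (coact t)) x \<alpha> =
      tlift DS DS (\<lambda>a b. ev (fscale (ev b \<one> cou) a) x \<alpha>) (coact t)"
    by (rule linear_on_tlift_apply[OF kspace_DS kspace_DS coact_closed[OF t] _ linear_ev[OF \<alpha>]]) (rule c)
  also have "\<dots> = tlift DS DS (\<lambda>a b. ev a x \<alpha> * ev b \<one> cou) (coact t)"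
    by (rule tlift_cong[OF kspace_DS coact_closed[OF t]]) (simp add: ev_fscale \<alpha> mult.commute)
  also have "\<dots> = ev t x \<alpha>"
    using t \<alpha> by (simp add: tlift_coact_prod sw_counit_right_prod)
  finally show "ev (tlift DS DS (\<lambda>a b. fscale (ev b \<one> cou) a) (coact t)) x \<alpha> = ev t x \<alpha>" .
qed (rule t)

lemma coact_counit_left:
  assumes t: "t \<in> carrier DS"
  shows "tlift DS DS (\<lambda>a b. fscale (ev a \<one> cou) b) (coact t) = t"
proof (rule ev_eqI)
  interpret D: kspace DS by (rule kspace_DS)
  have c: "fscale r a \<in> carrier DS" if "a \<in> carrier DS" for r a
    using D.scl_closed[OF that] by (simp add: scl_DS)
  show "tlift DS DS (\<lambda>a b. fscale (ev a \<one> cou) b) (coact t) \<in> carrier DS"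
    by (intro tlift_closed[OF kspace_DS kspace_DS coact_closed[OF t]] c)
  fix x \<alpha> assume \<alpha>: "lin \<alpha>"
  have "ev (tlift DS DS (\<lambda>a b. fscale (ev a \<one> cou) b) (coact t)) x \<alpha> =
      tlift DS DS (\<lambda>a b. ev (fscale (ev a \<one> cou) b) x \<alpha>) (coact t)"
    by (rule linear_on_tlift_apply[OF kspace_DS kspace_DS coact_closed[OF t] _ linear_ev[OF \<alpha>]]) (rule c)
  also have "\<dots> = tlift DS DS (\<lambda>a b. ev a \<one> cou * ev b x \<alpha>) (coact t)"
    by (rule tlift_cong[OF kspace_DS coact_closed[OF t]]) (simp add: ev_fscale \<alpha>)
  also have "\<dots> = ev t x \<alpha>"
    using t \<alpha> by (simp add: tlift_coact_prod sw_counit_left_prod)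
  finally show "ev (tlift DS DS (\<lambda>a b. fscale (ev a \<one> cou) b) (coact t)) x \<alpha> = ev t x \<alpha>" .
qed (rule t)

lemma coact_unit: "coact dunit = pure DS DS dunit dunit"
proof (rule ev_tensor_eqI)
  show "coact dunit \<in> carrier DS2" "pure DS DS dunit dunit \<in> carrier DS2"
    by (intro coact_closed pure_closed dunit_closed)+
  fix x y :: 'a and \<alpha> \<beta> :: "'a \<Rightarrow> 'k" assume l: "lin \<alpha>" "lin \<beta>"
  then show "tlift DS DS (\<lambda>a b. ev a x \<alpha> * ev b y \<beta>) (coact dunit) =
      tlift DS DS (\<lambda>a b. ev a x \<alpha> * ev b y \<beta>) (pure DS DS dunit dunit)"
    by (simp add: tlift_coact_prod dunit_closed ev_dunit sw_one bilinI
        tlift_pure[OF kspace_DS kspace_scalars bilinear_ev_ev] mult_ac)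
qed

lemma tlift_ev_swap:
  "tlift V W (\<lambda>v w. ev a x (\<lambda>h. Q v w h)) t = ev a x (\<lambda>h. tlift V W (\<lambda>v w. Q v w h) t)"
  unfolding ev_def by (subst tlift_swap) (simp only: tlift_mult_left)

context
  fixes T :: "'a \<Rightarrow> 'a"
  assumes T: "hopf_endo T"
begin

text \<open>Here the factors \<open>S\<^sup>-\<^sup>1(h\<^sub>3)\<close> of the first and \<open>h\<^sub>4\<close> of the second component cancel,
  whatever \<open>T\<close> is.\<close>

lemma act_coact:
  assumes s: "s \<in> carrier DS" and \<alpha>: "lin \<alpha>" and \<beta>: "lin \<beta>"
  shows "sw (\<lambda>h l. tlift DS DS (\<lambda>a b. act T a x \<alpha> h * act (\<lambda>h. h) b y \<beta> l) (coact s)) k =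
    act T s (y \<cdot> x) (sw (\<lambda>a b. \<alpha> a * \<beta> b)) k"
proof -
  note [simp] = lin_comp[OF \<alpha>] lin_comp[OF \<beta>] s \<alpha> \<beta> lin_map_tw[OF T]
  let ?Y = "\<lambda>h1 h2 z l2 l3. ev s (ian l3 \<cdot> y \<cdot> (z \<cdot> (x \<cdot> tw T h1))) (sw (\<lambda>a b. \<alpha> (h2 \<cdot> a) * \<beta> (l2 \<cdot> b)))"
  have "tlift DS DS (\<lambda>a b. act T a x \<alpha> h * act (\<lambda>h. h) b y \<beta> l) (coact s) =
    sw (\<lambda>h1 r. sw (\<lambda>h2 h3. sw (\<lambda>l1 q. sw (\<lambda>l2 l3. ?Y h1 h2 (l1 \<cdot> ian h3) l2 l3) q) l) r) h" for h l
  proof -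
    have "tlift DS DS (\<lambda>a b. act T a x \<alpha> h * act (\<lambda>h. h) b y \<beta> l) (coact s) =
      sw (\<lambda>h1 r. sw (\<lambda>h2 h3. sw (\<lambda>l1 q. sw (\<lambda>l2 l3. tlift DS DS (\<lambda>a b.
        ev a (ian h3 \<cdot> x \<cdot> tw T h1) (\<lambda>g. \<alpha> (h2 \<cdot> g)) * ev b (ian l3 \<cdot> y \<cdot> l1) (\<lambda>g. \<beta> (l2 \<cdot> g)))
        (coact s)) q) l) r) h"
      unfolding act_def[OF T] act_def[OF hopf_endo_id] tw_id mult_prj_right
      by (simp only: sw_mult_right[symmetric]) (simp only: sw_mult_left[symmetric] tlift_sw)
    then show ?thesis by (simp add: tlift_coact_prod mult_assoc)
  qed
  then have "sw (\<lambda>h l. tlift DS DS (\<lambda>a b. act T a x \<alpha> h * act (\<lambda>h. h) b y \<beta> l) (coact s)) k =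
    sw (\<lambda>h l. sw (\<lambda>h1 r. sw (\<lambda>h2 h3. sw (\<lambda>l1 q. sw (\<lambda>l2 l3. ?Y h1 h2 (l1 \<cdot> ian h3) l2 l3) q) l) r) h) k"
    by simp
  also have "\<dots> = sw (\<lambda>h1 r. sw (\<lambda>h2 u. sw (\<lambda>h3 v. sw (\<lambda>l1 q. sw (\<lambda>l2 l3.
      ?Y h1 h2 (l1 \<cdot> ian h3) l2 l3) q) v) u) r) k"
    by (simp only: sw_coassoc)
  also have "\<dots> = sw (\<lambda>h1 r. sw (\<lambda>h2 u. sw (\<lambda>l2 l3. ?Y h1 h2 \<one> l2 l3) u) r) k"
    by (subst sw_ian_right_cancel[where F = "\<lambda>z q. sw (\<lambda>l2 l3. ?Y h1 h2 z l2 l3) q" for h1 h2]) simp_all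
  also have "\<dots> = sw (\<lambda>h1 r. sw (\<lambda>h2 l3. sw (\<lambda>c d. ?Y h1 c \<one> d l3) h2) r) k"
    by (simp only: sw_coassoc)
  also have "\<dots> = sw (\<lambda>h1 r. sw (\<lambda>h2 h3. ev s (ian h3 \<cdot> (y \<cdot> x) \<cdot> tw T h1)
      (\<lambda>g. sw (\<lambda>a b. \<alpha> a * \<beta> b) (h2 \<cdot> g))) r) k"
    by (subst sw_mult) (auto intro!: bilinI simp: ev_sw mult_assoc)
  finally show ?thesis by (simp only: act_def[OF T])
qed

text \<open>Evaluated at x, \<alpha> and y, \<beta>, the right side splits x and y separately.
  \<open>act_coact\<close> merges the two actions of the legs of s into one at y_2 x_2,
  \<open>tlift_coact\<close> merges the legs of t into t at y_1 x_1, and the two sums form the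
  coproduct of y x, which is what the left side gives.\<close>

lemma coact_mult:
  assumes t: "t \<in> carrier DS" and s: "s \<in> carrier DS"
  shows "coact (double_mul H T t s) = tlift DS DS (\<lambda>a b. tlift DS DS (\<lambda>a' b'.
    pure DS DS (double_mul H T a a') (double_mul H (\<lambda>h. h) b b')) (coact s)) (coact t)"
    (is "?L = ?R")
proof (rule ev_tensor_eqI)
  note mc = double_mul_closed[OF T] and mc1 = double_mul_closed[OF hopf_endo_id]
  note tc = tlift_closed[OF kspace_DS kspace_tensor coact_closed]
  note linact [simp] = lin_act[OF T] lin_act[OF hopf_endo_id] lin_act_point[OF T] lin_act_point[OF hopf_endo_id]
    lin_act_comp[OF T] lin_act_comp[OF hopf_endo_id]
  show "?L \<in> carrier DS2" by (intro coact_closed mc t s)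
  show "?R \<in> carrier DS2" by (intro tc pure_closed mc mc1 t s)
  fix x y :: 'a and \<alpha> \<beta> :: "'a \<Rightarrow> 'k" assume l: "lin \<alpha>" "lin \<beta>"
  note [simp] = l lin_comp[OF l(1)] lin_comp[OF l(2)] s t
  let ?F = "tlift DS DS (\<lambda>a b. ev a x \<alpha> * ev b y \<beta>)"
  have F: "linear_on DS2 scalars ?F"
    by (rule linear_on_tlift[OF kspace_DS kspace_scalars bilinear_ev_ev[OF l]])
  let ?w = "\<lambda>a b a' b' x1 x2 y1 y2.
      ev a x1 (\<lambda>h. ev b y1 (\<lambda>l. act T a' x2 \<alpha> h * act (\<lambda>h. h) b' y2 \<beta> l))"
  let ?Th = "\<lambda>x2 y2 h l. tlift DS DS (\<lambda>a' b'. act T a' x2 \<alpha> h * act (\<lambda>h. h) b' y2 \<beta> l) (coact s)"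
  have bT: "bilin (?Th x2 y2)" for x2 y2
    by (intro bilinI lin_tlift[OF kspace_DS coact_closed[OF s]]) simp_all
  have "?F ?R = tlift DS DS (\<lambda>a b. ?F (tlift DS DS (\<lambda>a' b'.
      pure DS DS (double_mul H T a a') (double_mul H (\<lambda>h. h) b b')) (coact s))) (coact t)"
    by (rule linear_on_tlift_apply[OF kspace_DS kspace_tensor coact_closed[OF t] _ F])
      (intro tc pure_closed mc mc1 s; assumption)
  also have "\<dots> = tlift DS DS (\<lambda>a b. tlift DS DS (\<lambda>a' b'.
      sw (\<lambda>x1 x2. sw (\<lambda>y1 y2. ?w a b a' b' x1 x2 y1 y2) y) x) (coact s)) (coact t)"
  proof (rule tlift_cong[OF kspace_DS coact_closed[OF t]])
    fix a b assume a: "a \<in> carrier DS" and b: "b \<in> carrier DS"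
    have "?F (tlift DS DS (\<lambda>a' b'. pure DS DS (double_mul H T a a') (double_mul H (\<lambda>h. h) b b')) (coact s)) =
      tlift DS DS (\<lambda>a' b'. ?F (pure DS DS (double_mul H T a a') (double_mul H (\<lambda>h. h) b b'))) (coact s)"
      by (rule linear_on_tlift_apply[OF kspace_DS kspace_tensor coact_closed[OF s] _ F])
        (intro pure_closed mc mc1 a b; assumption)
    also have "\<dots> = tlift DS DS (\<lambda>a' b'. sw (\<lambda>x1 x2. sw (\<lambda>y1 y2. ?w a b a' b' x1 x2 y1 y2) y) x) (coact s)"
    proof (rule tlift_cong[OF kspace_DS coact_closed[OF s]])
      fix a' b' assume a': "a' \<in> carrier DS" and b': "b' \<in> carrier DS"
      show "?F (pure DS DS (double_mul H T a a') (double_mul H (\<lambda>h. h) b b')) =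
          sw (\<lambda>x1 x2. sw (\<lambda>y1 y2. ?w a b a' b' x1 x2 y1 y2) y) x"
        using a b a' b'
        by (simp add: tlift_pure[OF kspace_DS kspace_scalars bilinear_ev_ev[OF l]] mc mc1
            ev_double_mul[OF T] ev_double_mul[OF hopf_endo_id] ev_mult_left ev_mult_right
            sw_mult_left sw_mult_right)
    qed
    finally show "?F (tlift DS DS (\<lambda>a' b'. pure DS DS (double_mul H T a a')
        (double_mul H (\<lambda>h. h) b b')) (coact s)) = \<dots>" .
  qed
  also have "\<dots> = sw (\<lambda>x1 x2. sw (\<lambda>y1 y2. tlift DS DS (\<lambda>a b. ev a x1 (\<lambda>h. ev b y1 (\<lambda>l.
      ?Th x2 y2 h l))) (coact t)) y) x"
    by (simp only: tlift_sw tlift_ev_swap)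
  also have "\<dots> = sw (\<lambda>x1 x2. sw (\<lambda>y1 y2. ev t (y1 \<cdot> x1) (act T s (y2 \<cdot> x2) (sw (\<lambda>a b. \<alpha> a * \<beta> b)))) y) x"
  proof -
    have "sw (?Th x2 y2) = act T s (y2 \<cdot> x2) (sw (\<lambda>a b. \<alpha> a * \<beta> b))" for x2 y2
      by (rule HOL.ext) (rule act_coact[OF s l])
    then show ?thesis by (simp only: tlift_coact[OF t bT])
  qed
  also have "\<dots> = sw (\<lambda>y1 y2. sw (\<lambda>x1 x2. ev t (y1 \<cdot> x1) (act T s (y2 \<cdot> x2) (sw (\<lambda>a b. \<alpha> a * \<beta> b)))) x) y"
    by (rule sw_swap)
  also have "\<dots> = sw (\<lambda>w1 w2. ev t w1 (act T s w2 (sw (\<lambda>a b. \<alpha> a * \<beta> b)))) (y \<cdot> x)"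
    by (subst sw_mult) (auto intro!: bilinI)
  also have "\<dots> = ?F ?L"
    by (simp add: tlift_coact_prod mc ev_double_mul[OF T])
  finally show "?F ?L = ?F ?R" by simp
qed

end

end

lemma linear_on_cong:
  assumes "carrier V = carrier V'" "scl V = scl V'" "carrier U = carrier U'" "scl U = scl U'"
  shows "linear_on V U = linear_on V' U'"
  using assms by (simp add: linear_on_def[abs_def])

context fd_hopf_algebra
begin

lemma tensor_alg_simps:
  "carrier (tensor_alg A B) = carrier (tensor A B)" "scl (tensor_alg A B) = scl (tensor A B)"
  "unit (tensor_alg A B) = pure A B (unit A) (unit B)"
  by (simp_all add: tensor_alg_def)

text \<open>Serves twice: for the coaction of D(H) on A(H), and with T the identity for the
  multiplicativity of the coproduct of D(H) itself.\<close>

lemma algebra_hom_coact: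
  assumes T: "hopf_endo T"
    and A: "carrier A = carrier DS" "scl A = scl DS" "mul A = double_mul H T" "unit A = dunit"
    and D: "carrier D = carrier DS" "scl D = scl DS" "mul D = double_mul H (\<lambda>h. h)" "unit D = dunit"
  shows "algebra_hom A (tensor_alg A D) coact"
proof -
  note c = A(1,2) D(1,2)
  have "linear_on A (tensor_alg A D) = linear_on DS DS2"
    by (rule linear_on_cong) (simp_all add: A tensor_alg_simps tensor_cong[OF c])
  then show ?thesis
    unfolding algebra_hom_def
    by (simp add: coact_linear coact_unit coact_mult[OF T] A D tensor_alg_def pure_cong[OF c]
        tlift_congruence[OF c])
qed

subsection \<open>The antipode of the double\<close>

abbreviation dm where "dm \<equiv> double_mul H (\<lambda>h. h)"

text \<open>The formula is dictated by antimultiplicativity: \<phi> \<otimes> h is the product of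
  \<phi> \<otimes> 1 and \<epsilon> \<otimes> h, and H* lies in the double with the opposite
  coproduct, for which composition with S^-1 is the antipode.\<close>

definition dant where
  "dant = tlift Hd H (\<lambda>\<phi> h. dm (dpure H (unit Hd) (antipode H h))
     (dpure H (res (\<lambda>x. ext \<phi> (ian x))) (unit H)))"

lemmas dm_bilinear = double_mul_bilinear[OF hopf_endo_id]
lemmas dm_closed = double_mul_closed[OF hopf_endo_id]
lemmas ev_dm = ev_double_mul[OF hopf_endo_id]
lemmas act_id_def = act_def[OF hopf_endo_id]

lemma unit_dual_closed: "unit Hd \<in> carrier Hd" by (simp add: unit_dual)

lemma linear_res_ian: "linear_on Hd Hd (\<lambda>\<phi>. res (\<lambda>x. ext \<phi> (ian x)))"
  by (auto simp: linear_on_def res_def zero_ext_def fun_eq_iff ext_add ext_fscale)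
    (simp_all add: res_closed[unfolded res_def zero_ext_def[abs_def]] fscale_def ext_fscale[unfolded fscale_def])

lemma bilinear_dant: "bilinear_on Hd H DS (\<lambda>\<phi> h. dm (dpure H (unit Hd) (antipode H h))
     (dpure H (res (\<lambda>x. ext \<phi> (ian x))) (unit H)))"
  by (rule bilinear_on_flip, rule bilinear_on_compose[OF
        linear_on_comp[OF antipode_linear linear_dpure_right[OF unit_dual_closed]]
        linear_on_comp[OF linear_res_ian linear_dpure_left[OF unit_closed]] dm_bilinear])

lemma dant_linear: "linear_on DS DS dant"
  unfolding dant_def
  using linear_on_tlift[OF kspace_dual kspace_DS bilinear_dant] by (simp add: double_space_def)

lemma dant_closed: "t \<in> carrier DS \<Longrightarrow> dant t \<in> carrier DS"
  by (rule linear_on_closed[OF dant_linear])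

lemma act_pure_id:
  assumes \<phi>: "\<phi> \<in> carrier Hd" and g: "g \<in> carrier H" and \<alpha>: "lin \<alpha>"
  shows "act (\<lambda>h. h) (dpure H \<phi> g) z \<alpha> k =
    sw (\<lambda>s1 r. sw (\<lambda>s2 s3. ext \<phi> (ian s3 \<cdot> z \<cdot> s1) * \<alpha> (s2 \<cdot> g)) r) k"
  using assms by (simp add: act_id_def ev_pure lin_comp[OF \<alpha>])

text \<open>Pushing the coproduct through S reverses the legs of k, so S^-1 meets S(k_1) and cancels
  it; only S occurs in the result.\<close>

lemma act_pure_ant:
  assumes \<phi>: "\<phi> \<in> carrier Hd" and g: "g \<in> carrier H" and \<alpha>: "lin \<alpha>"
  shows "act (\<lambda>h. h) (dpure H \<phi> g) z \<alpha> (ant k) =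
    sw (\<lambda>k1 r. sw (\<lambda>k2 k3. ext \<phi> (k1 \<cdot> z \<cdot> ant k3) * \<alpha> (ant k2 \<cdot> g)) r) k"
proof -
  note [simp] = lin_comp[OF \<alpha>] \<phi>
  have "act (\<lambda>h. h) (dpure H \<phi> g) z \<alpha> (ant k) =
      sw (\<lambda>a b. sw (\<lambda>s2 s3. ext \<phi> (ian s3 \<cdot> z \<cdot> ant b) * \<alpha> (s2 \<cdot> g)) (ant a)) k"
    unfolding act_pure_id[OF assms] by (subst sw_ant) (auto intro!: bilinI)
  also have "\<dots> = sw (\<lambda>a b. sw (\<lambda>c d. ext \<phi> (c \<cdot> z \<cdot> ant b) * \<alpha> (ant d \<cdot> g)) a) k"
    by (subst sw_ant) (auto intro!: bilinI)
  finally show ?thesis by (simp only: sw_coassoc)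
qed

lemma ev_dant_pure:
  assumes \<phi>: "\<phi> \<in> carrier Hd" and h: "h \<in> carrier H" and \<gamma>: "lin \<gamma>"
  shows "ev (dant (dpure H \<phi> h)) x \<gamma> =
    sw (\<lambda>h1 r. sw (\<lambda>h2 h3. ext \<phi> (h3 \<cdot> (ian x \<cdot> ian h1)) * \<gamma> (ant h2)) r) h"
proof -
  note [simp] = lin_comp[OF \<gamma>] \<phi> lin_prj[OF \<gamma>]
  let ?\<psi> = "res (\<lambda>x. ext \<phi> (ian x))"
  have \<psi>: "?\<psi> \<in> carrier Hd" by simp
  have b: "dpure H ?\<psi> (unit H) \<in> carrier DS" by (intro dpure_closed \<psi> unit_closed)
  have c: "antipode H h \<in> carrier H" using h by (rule linear_on_closed[OF antipode_linear])
  have a: "dpure H (unit Hd) (antipode H h) \<in> carrier DS" by (intro dpure_closed unit_dual_closed c)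
  have ah: "antipode H h = ant h" by (simp add: ant_def prj_id h)
  have "ev (dant (dpure H \<phi> h)) x \<gamma> =
      sw (\<lambda>x1 x2. cou x1 * act (\<lambda>h. h) (dpure H ?\<psi> (unit H)) x2 \<gamma> (ant h)) x"
    unfolding dant_def tlift_pure[OF kspace_dual kspace_DS bilinear_dant \<phi> h] ev_dm[OF a b \<gamma>]
    by (subst ev_pure[OF lin_act[OF hopf_endo_id] unit_dual_closed c]) (simp add: unit_dual ah)
  also have "\<dots> = act (\<lambda>h. h) (dpure H ?\<psi> (unit H)) x \<gamma> (ant h)"
    by (rule sw_counit_left) (simp add: lin_act_point[OF hopf_endo_id] b)
  also have "\<dots> = sw (\<lambda>h1 r. sw (\<lambda>h2 h3. ext \<phi> (ian (h1 \<cdot> x \<cdot> ant h3)) * \<gamma> (ant h2)) r) h"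
    by (subst act_pure_ant[OF \<psi> unit_closed \<gamma>]) (simp add: one_def[symmetric])
  also have "\<dots> = sw (\<lambda>h1 r. sw (\<lambda>h2 h3. ext \<phi> (h3 \<cdot> (ian x \<cdot> ian h1)) * \<gamma> (ant h2)) r) h"
    by (simp add: ian_mult)
  finally show ?thesis .
qed

lemma sw2_dual_sw2:
  assumes \<phi>: "\<phi> \<in> carrier Hd" and h: "h \<in> carrier H"
    and f: "\<And>\<phi>1 \<phi>2 a b. \<phi>1 \<in> carrier Hd \<Longrightarrow> \<phi>2 \<in> carrier Hd \<Longrightarrow> a \<in> carrier H \<Longrightarrow> b \<in> carrier H \<Longrightarrow>
      f \<phi>1 \<phi>2 a b = g \<phi>1 \<phi>2 a b"
    and g: "\<And>\<phi>1 \<phi>2. \<phi>1 \<in> carrier Hd \<Longrightarrow> \<phi>2 \<in> carrier Hd \<Longrightarrow> bilin (g \<phi>1 \<phi>2)"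
  shows "sw2 Hd (\<lambda>\<phi>1 \<phi>2. sw2 H (f \<phi>1 \<phi>2) h) \<phi> = tlift Hd Hd (\<lambda>\<phi>1 \<phi>2. sw (g \<phi>1 \<phi>2) h) (comul Hd \<phi>)"
  unfolding sw2_def[of Hd]
proof (rule tlift_cong[OF kspace_dual comul_dual_closed[OF \<phi>]])
  fix \<phi>1 \<phi>2 assume \<phi>s: "\<phi>1 \<in> carrier Hd" "\<phi>2 \<in> carrier Hd"
  have "sw2 H (f \<phi>1 \<phi>2) h = sw2 H (g \<phi>1 \<phi>2) h"
    unfolding sw2_def by (rule tlift_cong[OF kspace_H comul_closed[OF h]]) (rule f[OF \<phi>s])
  then show "sw2 H (f \<phi>1 \<phi>2) h = sw (g \<phi>1 \<phi>2) h"
    using sw2_sw[OF bilinear_on_bilin[OF g[OF \<phi>s]] h] by simp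
qed

text \<open>Reduces either antipode axiom, with e built from \<open>dant\<close> in the first or the
  second argument, to a scalar identity for a single \<phi> \<otimes> h. Here
  \<open>ev t \<one> cou\<close> is the counit of t.\<close>

lemma convolution_eqI:
  assumes e: "bilinear_on DS DS DS e" and t: "t \<in> carrier DS"
    and eq: "\<And>\<phi> h x \<alpha>. \<phi> \<in> carrier Hd \<Longrightarrow> h \<in> carrier H \<Longrightarrow> lin \<alpha> \<Longrightarrow>
      sw2 Hd (\<lambda>\<phi>1 \<phi>2. sw2 H (\<lambda>h1 h2. ev (e (dpure H \<phi>2 h1) (dpure H \<phi>1 h2)) x \<alpha>) h) \<phi> =
      (ext \<phi> \<one> * cou h) * (cou x * \<alpha> \<one>)"
  shows "tlift DS DS e (coact t) = fscale (ev t \<one> cou) dunit"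
proof -
  interpret D: kspace DS by (rule kspace_DS)
  have lin_l: "linear_on DS DS (\<lambda>t. tlift DS DS e (coact t))"
    by (rule linear_on_comp[OF coact_linear linear_on_tlift[OF kspace_DS kspace_DS e]])
  have lin_r: "linear_on DS DS (\<lambda>t. fscale (ev t \<one> cou) dunit)"
    using linear_on_comp[OF linear_ev[OF lin_cou] linear_on_scl_vector[OF kspace_DS dunit_closed]]
    by (simp add: scl_DS)
  show ?thesis
  proof (rule linear_on_eq_on_pure[OF kspace_dual kspace_DS, of H "\<lambda>t. tlift DS DS e (coact t)"
        "\<lambda>t. fscale (ev t \<one> cou) dunit"])
    show "linear_on (tensor Hd H) DS (\<lambda>t. tlift DS DS e (coact t))"
      "linear_on (tensor Hd H) DS (\<lambda>t. fscale (ev t \<one> cou) dunit)"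
      "t \<in> carrier (tensor Hd H)"
      using lin_l lin_r t by (simp_all add: double_space_def)
    fix \<phi> h assume \<phi>: "\<phi> \<in> carrier Hd" and h: "h \<in> carrier H"
    have p: "dpure H \<phi> h \<in> carrier DS" by (intro dpure_closed \<phi> h)
    show "tlift DS DS e (coact (dpure H \<phi> h)) = fscale (ev (dpure H \<phi> h) \<one> cou) dunit"
    proof (rule ev_eqI)
      show "tlift DS DS e (coact (dpure H \<phi> h)) \<in> carrier DS"
        "fscale (ev (dpure H \<phi> h) \<one> cou) dunit \<in> carrier DS"
        using linear_on_closed[OF lin_l p] linear_on_closed[OF lin_r p] by simp_all
      fix x \<alpha> assume \<alpha>: "lin \<alpha>"
      have "ev (tlift DS DS e (coact (dpure H \<phi> h))) x \<alpha> =
          tlift DS DS (\<lambda>a b. ev (e a b) x \<alpha>) (coact (dpure H \<phi> h))"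
        by (rule linear_on_tlift_apply[OF kspace_DS kspace_DS coact_closed[OF p] _ linear_ev[OF \<alpha>]])
          (rule bilinear_on_closed[OF e])
      also have "\<dots> = (ext \<phi> \<one> * cou h) * (cou x * \<alpha> \<one>)"
        unfolding coact_pure[OF \<phi> h] tlift_pcomul[OF bilinear_on_comp[OF e linear_ev[OF \<alpha>]] \<phi> h]
        by (rule eq[OF \<phi> h \<alpha>])
      also have "\<dots> = ev (fscale (ev (dpure H \<phi> h) \<one> cou) dunit) x \<alpha>"
        by (simp add: ev_fscale \<alpha> dunit_closed ev_dunit ev_pure \<phi> h)
      finally show "ev (tlift DS DS e (coact (dpure H \<phi> h))) x \<alpha> =
        ev (fscale (ev (dpure H \<phi> h) \<one> cou) dunit) x \<alpha>" .
    qed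
  qed
qed

text \<open>\<open>comul_dual\<close> merges the two legs of \<phi> into one evaluation, and
  adjacent factors then cancel in turn: S(b_3) c, S(b_2) h_2, x_2 S^-1(x_1) and finally b_1
  S^-1(a).\<close>

lemma dant_left:
  assumes t: "t \<in> carrier DS"
  shows "tlift DS DS (\<lambda>a b. dm (dant a) b) (coact t) = fscale (ev t \<one> cou) dunit"
proof (rule convolution_eqI[OF _ t])
  have "linear_on DS DS (\<lambda>x. x)" by (simp add: linear_on_def)
  from bilinear_on_compose[OF dant_linear this dm_bilinear]
  show "bilinear_on DS DS DS (\<lambda>a b. dm (dant a) b)" .
  fix \<phi> h x \<alpha> assume \<phi>: "\<phi> \<in> carrier Hd" and h: "h \<in> carrier H" and \<alpha>: "lin \<alpha>"
  note [simp] = lin_comp[OF \<alpha>]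
  let ?g = "\<lambda>\<phi>1 \<phi>2 h1 h2. sw (\<lambda>x1 x2. sw (\<lambda>a r. sw (\<lambda>b c. sw (\<lambda>b1 q. sw (\<lambda>b2 b3.
      (ext \<phi>1 (b1 \<cdot> x2 \<cdot> ant b3) * ext \<phi>2 (c \<cdot> (ian x1 \<cdot> ian a))) * \<alpha> (ant b2 \<cdot> h2)) q) b) r) h1) x"
  have ev1: "ev (dm (dant (dpure H \<phi>2 h1)) (dpure H \<phi>1 h2)) x \<alpha> = ?g \<phi>1 \<phi>2 h1 h2"
    if p: "\<phi>1 \<in> carrier Hd" "\<phi>2 \<in> carrier Hd" "h1 \<in> carrier H" "h2 \<in> carrier H" for \<phi>1 \<phi>2 h1 h2
  proof -
    have "ev (dm (dant (dpure H \<phi>2 h1)) (dpure H \<phi>1 h2)) x \<alpha> =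
      sw (\<lambda>x1 x2. sw (\<lambda>a r. sw (\<lambda>b c. ext \<phi>2 (c \<cdot> (ian x1 \<cdot> ian a)) *
        sw (\<lambda>b1 q. sw (\<lambda>b2 b3. ext \<phi>1 (b1 \<cdot> x2 \<cdot> ant b3) * \<alpha> (ant b2 \<cdot> h2)) q) b) r) h1) x"
      using p \<alpha> by (simp add: ev_dm dant_closed dpure_closed ev_dant_pure lin_act[OF hopf_endo_id] act_pure_ant)
    then show ?thesis by (simp only: sw_mult_left[symmetric] mult.left_commute mult.assoc)
  qed
  have "sw2 Hd (\<lambda>\<phi>1 \<phi>2. sw2 H (\<lambda>h1 h2. ev (dm (dant (dpure H \<phi>2 h1)) (dpure H \<phi>1 h2)) x \<alpha>) h) \<phi> =
      tlift Hd Hd (\<lambda>\<phi>1 \<phi>2. sw (?g \<phi>1 \<phi>2) h) (comul Hd \<phi>)"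
    by (rule sw2_dual_sw2[OF \<phi> h]) (auto intro!: bilinI simp: ev1)
  also have "\<dots> = sw (\<lambda>h1 h2. sw (\<lambda>x1 x2. sw (\<lambda>a r. sw (\<lambda>b c. sw (\<lambda>b1 q. sw (\<lambda>b2 b3.
      ext \<phi> (b1 \<cdot> x2 \<cdot> ant b3 \<cdot> (c \<cdot> (ian x1 \<cdot> ian a))) * \<alpha> (ant b2 \<cdot> h2)) q) b) r) h1) x) h"
    by (simp only: tlift_sw tlift_mult_right comul_dual[OF \<phi>])
  also have "\<dots> = sw (\<lambda>h1 h2. sw (\<lambda>x1 x2. sw (\<lambda>a r. sw (\<lambda>b c. sw (\<lambda>b1 q. sw (\<lambda>b2 b3.
      ext \<phi> (b1 \<cdot> (x2 \<cdot> ((ant b3 \<cdot> c) \<cdot> (ian x1 \<cdot> ian a)))) * \<alpha> (ant b2 \<cdot> h2)) q) b) r) h1) x) h"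
    by (simp only: mult_assoc)
  also have "\<dots> = sw (\<lambda>x1 x2. sw (\<lambda>h1 h2. sw (\<lambda>a r. sw (\<lambda>b c. sw (\<lambda>b1 q. sw (\<lambda>b2 b3.
      ext \<phi> (b1 \<cdot> (x2 \<cdot> ((ant b3 \<cdot> c) \<cdot> (ian x1 \<cdot> ian a)))) * \<alpha> (ant b2 \<cdot> h2)) q) b) r) h1) h) x"
    by (rule sw_swap)
  also have "\<dots> = sw (\<lambda>x1 x2. sw (\<lambda>a r. sw (\<lambda>b1 s. sw (\<lambda>b2 u. sw (\<lambda>b3 v. sw (\<lambda>c h2.
      ext \<phi> (b1 \<cdot> (x2 \<cdot> ((ant b3 \<cdot> c) \<cdot> (ian x1 \<cdot> ian a)))) * \<alpha> (ant b2 \<cdot> h2)) v) u) s) r) h) x"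
    by (simp only: sw_coassoc)
  also have "\<dots> = sw (\<lambda>x1 x2. sw (\<lambda>a r. sw (\<lambda>b1 s. sw (\<lambda>b2 h2.
      ext \<phi> (b1 \<cdot> (x2 \<cdot> (\<one> \<cdot> (ian x1 \<cdot> ian a)))) * \<alpha> (ant b2 \<cdot> h2)) s) r) h) x"
    by (subst sw_ant_left_cancel[where F = "\<lambda>z h2. ext \<phi> (b1 \<cdot> (x2 \<cdot> (z \<cdot> (ian x1 \<cdot> ian a)))) *
        \<alpha> (ant b2 \<cdot> h2)" for b1 x2 x1 a b2]) (simp_all add: \<phi>)
  also have "\<dots> = sw (\<lambda>x1 x2. sw (\<lambda>a r. sw (\<lambda>b1 s. cou s *
      (ext \<phi> (b1 \<cdot> ((x2 \<cdot> ian x1) \<cdot> ian a)) * \<alpha> \<one>)) r) h) x"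
    by (subst sw_ant_left[where f = "\<lambda>z. ext \<phi> (b1 \<cdot> (x2 \<cdot> (\<one> \<cdot> (ian x1 \<cdot> ian a)))) * \<alpha> z"
        for b1 x2 x1 a]) (simp_all add: \<alpha> mult_assoc)
  also have "\<dots> = sw (\<lambda>x1 x2. sw (\<lambda>a b1. ext \<phi> (b1 \<cdot> ((x2 \<cdot> ian x1) \<cdot> ian a)) * \<alpha> \<one>) h) x"
    by (subst sw_counit_right) (simp_all add: \<phi>)
  also have "\<dots> = cou x * sw (\<lambda>a b1. ext \<phi> (b1 \<cdot> (\<one> \<cdot> ian a)) * \<alpha> \<one>) h"
    by (rule sw_ian_right) (simp add: \<phi>)
  also have "sw (\<lambda>a b1. ext \<phi> (b1 \<cdot> (\<one> \<cdot> ian a)) * \<alpha> \<one>) h = cou h * ext \<phi> \<one> * \<alpha> \<one>"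
    by (simp add: sw_mult_right sw_ian_right[OF lin_ext[OF \<phi>]])
  finally show "sw2 Hd (\<lambda>\<phi>1 \<phi>2. sw2 H (\<lambda>h1 h2. ev (dm (dant (dpure H \<phi>2 h1)) (dpure H \<phi>1 h2)) x \<alpha>) h) \<phi> =
      (ext \<phi> \<one> * cou h) * (cou x * \<alpha> \<one>)"
    by (simp add: mult_ac)
qed

text \<open>As in \<open>dant_left\<close>, now with the cancellations d S^-1(c), b S(e), f S^-1(a)
  and S^-1(x_2) x_1, in this order.\<close>

lemma dant_right:
  assumes t: "t \<in> carrier DS"
  shows "tlift DS DS (\<lambda>a b. dm a (dant b)) (coact t) = fscale (ev t \<one> cou) dunit"
proof (rule convolution_eqI[OF _ t])
  have "linear_on DS DS (\<lambda>x. x)" by (simp add: linear_on_def)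
  from bilinear_on_compose[OF this dant_linear dm_bilinear]
  show "bilinear_on DS DS DS (\<lambda>a b. dm a (dant b))" .
  fix \<phi> h x \<alpha> assume \<phi>: "\<phi> \<in> carrier Hd" and h: "h \<in> carrier H" and \<alpha>: "lin \<alpha>"
  note [simp] = lin_comp[OF \<alpha>]
  let ?g = "\<lambda>\<phi>1 \<phi>2 h1 h2. sw (\<lambda>x1 x2. sw (\<lambda>a r. sw (\<lambda>b c. sw (\<lambda>d q. sw (\<lambda>e f.
      (ext \<phi>1 (f \<cdot> (ian (ian c \<cdot> x2 \<cdot> a) \<cdot> ian d)) * ext \<phi>2 x1) * \<alpha> (b \<cdot> ant e)) q) h2) r) h1) x"
  have ev1: "ev (dm (dpure H \<phi>2 h1) (dant (dpure H \<phi>1 h2))) x \<alpha> = ?g \<phi>1 \<phi>2 h1 h2"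
    if p: "\<phi>1 \<in> carrier Hd" "\<phi>2 \<in> carrier Hd" "h1 \<in> carrier H" "h2 \<in> carrier H" for \<phi>1 \<phi>2 h1 h2
  proof -
    have "ev (dm (dpure H \<phi>2 h1) (dant (dpure H \<phi>1 h2))) x \<alpha> =
      sw (\<lambda>x1 x2. ext \<phi>2 x1 * sw (\<lambda>a r. sw (\<lambda>b c. sw (\<lambda>d q. sw (\<lambda>e f.
        ext \<phi>1 (f \<cdot> (ian (ian c \<cdot> x2 \<cdot> a) \<cdot> ian d)) * \<alpha> (b \<cdot> ant e)) q) h2) r) h1) x"
      using p \<alpha> by (simp add: ev_dm dant_closed dpure_closed ev_pure lin_act[OF hopf_endo_id]
          act_id_def ev_dant_pure)
    then show ?thesis by (simp only: sw_mult_left[symmetric] mult.left_commute mult.assoc)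
  qed
  have "sw2 Hd (\<lambda>\<phi>1 \<phi>2. sw2 H (\<lambda>h1 h2. ev (dm (dpure H \<phi>2 h1) (dant (dpure H \<phi>1 h2))) x \<alpha>) h) \<phi> =
      tlift Hd Hd (\<lambda>\<phi>1 \<phi>2. sw (?g \<phi>1 \<phi>2) h) (comul Hd \<phi>)"
    by (rule sw2_dual_sw2[OF \<phi> h]) (auto intro!: bilinI simp: ev1)
  also have "\<dots> = sw (\<lambda>h1 h2. sw (\<lambda>x1 x2. sw (\<lambda>a r. sw (\<lambda>b c. sw (\<lambda>d q. sw (\<lambda>e f.
      ext \<phi> (f \<cdot> (ian (ian c \<cdot> x2 \<cdot> a) \<cdot> ian d) \<cdot> x1) * \<alpha> (b \<cdot> ant e)) q) h2) r) h1) x) h"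
    by (simp only: tlift_sw tlift_mult_right comul_dual[OF \<phi>])
  also have "\<dots> = sw (\<lambda>h1 h2. sw (\<lambda>x1 x2. sw (\<lambda>a r. sw (\<lambda>b c. sw (\<lambda>d q. sw (\<lambda>e f.
      ext \<phi> (f \<cdot> (ian a \<cdot> (ian x2 \<cdot> (ian (d \<cdot> ian c) \<cdot> x1)))) * \<alpha> (b \<cdot> ant e)) q) h2) r) h1) x) h"
    by (simp only: ian_mult mult_assoc)
  also have "\<dots> = sw (\<lambda>x1 x2. sw (\<lambda>h1 h2. sw (\<lambda>a r. sw (\<lambda>b c. sw (\<lambda>d q. sw (\<lambda>e f.
      ext \<phi> (f \<cdot> (ian a \<cdot> (ian x2 \<cdot> (ian (d \<cdot> ian c) \<cdot> x1)))) * \<alpha> (b \<cdot> ant e)) q) h2) r) h1) h) x"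
    by (rule sw_swap)
  also have "\<dots> = sw (\<lambda>x1 x2. sw (\<lambda>a r. sw (\<lambda>b s. sw (\<lambda>c u. sw (\<lambda>d v. sw (\<lambda>e f.
      ext \<phi> (f \<cdot> (ian a \<cdot> (ian x2 \<cdot> (ian (d \<cdot> ian c) \<cdot> x1)))) * \<alpha> (b \<cdot> ant e)) v) u) s) r) h) x"
    by (simp only: sw_coassoc)
  also have "\<dots> = sw (\<lambda>x1 x2. sw (\<lambda>a r. sw (\<lambda>b s. sw (\<lambda>e f.
      ext \<phi> (f \<cdot> (ian a \<cdot> (ian x2 \<cdot> (ian \<one> \<cdot> x1)))) * \<alpha> (b \<cdot> ant e)) s) r) h) x"
    by (subst sw_ian_right_cancel[where F = "\<lambda>z v. sw (\<lambda>e f.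
        ext \<phi> (f \<cdot> (ian a \<cdot> (ian x2 \<cdot> (ian z \<cdot> x1)))) * \<alpha> (b \<cdot> ant e)) v" for a x2 x1 b])
      (simp_all add: \<phi>)
  also have "\<dots> = sw (\<lambda>x1 x2. sw (\<lambda>a f. ext \<phi> ((f \<cdot> ian a) \<cdot> (ian x2 \<cdot> x1)) * \<alpha> \<one>) h) x"
    by (subst sw_ant_right_cancel[where F = "\<lambda>z f. ext \<phi> (f \<cdot> (ian a \<cdot> (ian x2 \<cdot> (ian \<one> \<cdot> x1)))) * \<alpha> z"
        for a x2 x1]) (simp_all add: \<phi> \<alpha> mult_assoc)
  also have "\<dots> = sw (\<lambda>x1 x2. cou h * (ext \<phi> (\<one> \<cdot> (ian x2 \<cdot> x1)) * \<alpha> \<one>)) x"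
    by (subst sw_ian_right[where f = "\<lambda>z. ext \<phi> (z \<cdot> (ian x2 \<cdot> x1)) * \<alpha> \<one>" for x1 x2]) (simp_all add: \<phi>)
  also have "\<dots> = cou h * (cou x * ext \<phi> \<one> * \<alpha> \<one>)"
    by (simp add: sw_mult_left sw_mult_right sw_ian_left[OF lin_ext[OF \<phi>]])
  finally show "sw2 Hd (\<lambda>\<phi>1 \<phi>2. sw2 H (\<lambda>h1 h2. ev (dm (dpure H \<phi>2 h1) (dant (dpure H \<phi>1 h2))) x \<alpha>) h) \<phi> =
      (ext \<phi> \<one> * cou h) * (cou x * \<alpha> \<one>)"
    by (simp add: mult_ac)
qed

text \<open>At the pair \<open>\<one>\<close>, \<open>cou\<close> the leg h_2 only contributes its
  counit, and S^-1(h_3) h_1 collapses because T is the identity here; hence h acts on s through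
  \<open>cou h\<close>.\<close>

lemma ev_counit_mult:
  assumes t: "t \<in> carrier DS" and s: "s \<in> carrier DS"
  shows "ev (dm t s) \<one> cou = ev t \<one> cou * ev s \<one> cou"
proof -
  note [simp] = s t
  have "act (\<lambda>h. h) s \<one> cou h = cou h * ev s \<one> cou" for h
  proof -
    have "act (\<lambda>h. h) s \<one> cou h = sw (\<lambda>h1 r. sw (\<lambda>h2 h3. cou h2 * ev s (ian h3 \<cdot> h1) cou) r) h"
      by (simp add: act_id_def ev_mult_left)
    also have "\<dots> = cou h * ev s \<one> cou"
      by (simp add: sw_counit_left sw_ian_left[where f = "\<lambda>z. ev s z cou"])
    finally show ?thesis .
  qed
  then have "act (\<lambda>h. h) s \<one> cou = (\<lambda>h. cou h * ev s \<one> cou)" by (rule HOL.ext)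
  then show ?thesis
    by (simp add: ev_dm sw_one bilinI lin_act_point[OF hopf_endo_id] lin_act[OF hopf_endo_id] ev_mult_right)
qed

section \<open>The Drinfeld double and the comodule algebra\<close>

abbreviation "DD \<equiv> drinfeld_double H"
abbreviation "AA \<equiv> A_alg H"

lemma DD_simps:
  "carrier DD = carrier DS" "scl DD = scl DS" "mul DD = dm" "unit DD = dunit" "comul DD = coact"
  by (simp_all add: drinfeld_double_def)

lemma AA_simps:
  "carrier AA = carrier DS" "scl AA = scl DS" "mul AA = double_mul H (\<lambda>h. antipode H (antipode H h))"
  "unit AA = dunit"
  by (simp_all add: A_alg_def)

lemmas DD_cong =
  pure_cong[OF DD_simps(1,2) refl refl] pure_cong[OF refl refl DD_simps(1,2)]
  tensor_cong[OF DD_simps(1,2) refl refl] tensor_cong[OF refl refl DD_simps(1,2)]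
  tlift_congruence[OF DD_simps(1,2) refl refl] tlift_congruence[OF refl refl DD_simps(1,2)]

lemmas AA_cong =
  pure_cong[OF AA_simps(1,2) refl refl] tensor_cong[OF AA_simps(1,2) refl refl]
  tlift_congruence[OF AA_simps(1,2) refl refl]

lemma A_coaction_coact: "A_coaction H = coact"
  by (simp add: A_coaction_def double_comul_def AA_cong DD_cong)

lemma counit_DD: "t \<in> carrier DS \<Longrightarrow> counit DD t = ev t \<one> cou"
  unfolding ev_def double_space_def
  by (simp add: drinfeld_double_def, rule tlift_cong[OF kspace_dual])
    (simp_all add: ext_eq unit_closed one_def cou_def prj_id)

lemma counit_DD_linear: "linear_on DD scalars (counit DD)"
proof -
  interpret D: kspace DS by (rule kspace_DS)
  show ?thesis
    using linear_ev[OF lin_cou, of \<one>]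
    by (simp add: linear_on_def DD_simps counit_DD D.add_closed D.scl_closed)
qed

lemma k_algebra_DD: "k_algebra DD"
  by (rule k_algebra_twisted_double[OF hopf_endo_id]) (rule DD_simps)+

lemma k_coalgebra_DD: "k_coalgebra DD"
proof (intro k_coalgebra.intro k_coalgebra_axioms.intro)
  show "kspace DD" using k_algebra_DD by (simp add: k_algebra_def)
  show "linear_on DD (tensor DD DD) (comul DD)"
    using coact_linear linear_on_cong[OF DD_simps(1,2) refl refl, of DS2] by (simp add: DD_simps DD_cong)
  show "linear_on DD scalars (counit DD)" by (rule counit_DD_linear)
  fix t assume "t \<in> carrier DD"
  then have t: "t \<in> carrier DS" by (simp add: DD_simps)
  show "sw2 DD (\<lambda>x c3. sw2 DD (\<lambda>c1 c2. pure (tensor DD DD) DD (pure DD DD c1 c2) c3) x) t =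
      sw2 DD (\<lambda>c1 x. sw2 DD (\<lambda>c2 c3. pure (tensor DD DD) DD (pure DD DD c1 c2) c3) x) t"
    unfolding sw2_def DD_cong DD_simps by (rule coact_coassoc[OF t])
  show "sw2 DD (\<lambda>c1 c2. scl DD (counit DD c1) c2) t = t"
    unfolding sw2_def DD_cong DD_simps scl_DS
    using tlift_cong[OF kspace_DS coact_closed[OF t], of "\<lambda>a b. fscale (counit DD a) b"
        "\<lambda>a b. fscale (ev a \<one> cou) b"]
    by (simp add: counit_DD coact_counit_left[OF t])
  show "sw2 DD (\<lambda>c1 c2. scl DD (counit DD c2) c1) t = t"
    unfolding sw2_def DD_cong DD_simps scl_DS
    using tlift_cong[OF kspace_DS coact_closed[OF t], of "\<lambda>a b. fscale (counit DD b) a"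
        "\<lambda>a b. fscale (ev b \<one> cou) a"]
    by (simp add: counit_DD coact_counit_right[OF t])
qed

lemma bialgebra_DD: "bialgebra DD"
proof (intro bialgebra.intro bialgebra_axioms.intro k_algebra_DD k_coalgebra_DD)
  show "algebra_hom DD (tensor_alg DD DD) (comul DD)"
    unfolding DD_simps(5) by (rule algebra_hom_coact[OF hopf_endo_id]) (rule DD_simps)+
  have "linear_on DD scalar_alg (counit DD)"
    using counit_DD_linear linear_on_cong[OF refl refl, of scalar_alg scalars DD]
    by (simp add: scalar_alg_def scalars_def)
  then show "algebra_hom DD scalar_alg (counit DD)"
    by (simp add: algebra_hom_def DD_simps counit_DD dunit_closed ev_dunit dm_closed ev_counit_mult)
      (simp add: scalar_alg_def)
qed

lemma hopf_algebra_DD: "hopf_algebra DD"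
proof (intro hopf_algebra.intro hopf_algebra_axioms.intro bialgebra_DD exI)
  show "is_antipode DD dant"
    unfolding is_antipode_def sw2_def DD_cong
  proof (intro conjI ballI)
    show "linear_on DD DD dant"
      using dant_linear linear_on_cong[OF DD_simps(1,2) DD_simps(1,2)] by simp
  qed (simp_all add: DD_simps scl_DS counit_DD dant_left dant_right)
qed

theorem right_comodule_algebra_A_alg: "right_comodule_algebra DD AA (A_coaction H)"
proof (intro right_comodule_algebra.intro right_comodule_algebra_axioms.intro hopf_algebra_DD)
  show "k_algebra AA"
    by (rule k_algebra_twisted_double[OF hopf_endo_antipode_sq]) (rule AA_simps)+
  show "algebra_hom AA (tensor_alg AA DD) (A_coaction H)"
    unfolding A_coaction_coact
    by (rule algebra_hom_coact[OF hopf_endo_antipode_sq]) (rule AA_simps DD_simps)+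
  fix t assume "t \<in> carrier AA"
  then have t: "t \<in> carrier DS" by (simp add: AA_simps)
  show "tlift AA DD (\<lambda>x d. tlift AA DD (\<lambda>a0 a1. pure (tensor AA DD) DD (pure AA DD a0 a1) d)
      (A_coaction H x)) (A_coaction H t) =
    tlift AA DD (\<lambda>a0 x. sw2 DD (\<lambda>d1 d2. pure (tensor AA DD) DD (pure AA DD a0 d1) d2) x)
      (A_coaction H t)"
    unfolding sw2_def AA_cong DD_cong DD_simps A_coaction_coact by (rule coact_coassoc[OF t])
  show "tlift AA DD (\<lambda>a0 a1. scl AA (counit DD a1) a0) (A_coaction H t) = t"
    unfolding AA_cong DD_cong AA_simps scl_DS A_coaction_coact
    using tlift_cong[OF kspace_DS coact_closed[OF t], of "\<lambda>a b. fscale (counit DD b) a"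
        "\<lambda>a b. fscale (ev b \<one> cou) a"]
    by (simp add: counit_DD coact_counit_right[OF t])
qed

end

theorem mainTheorem6:
  fixes H :: "('k::field, 'a::ab_group_add) bialg"
  assumes "hopf_algebra H"
    and "fin_dim H"
  shows "right_comodule_algebra (drinfeld_double H) (A_alg H) (A_coaction H)"
  using assms
  by (intro fd_hopf_algebra.right_comodule_algebra_A_alg fd_hopf_algebra.intro
      fd_hopf_algebra_axioms.intro)

end
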